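(* Let $\mathbb{K}$ be a field, let $s \geq 1$ be an integer, let $t_1,\ldots,t_s$ be positive integers, and let $G(t_1,\ldots,t_s)$ be the graph consisting of $s$ odd cycles of lengths $2t_1+1,\ldots,2t_s+1$ all sharing one common vertex. Then the Castelnuovo–Mumford regularity of the toric edge ring $\mathbb{K}[G(t_1,\ldots,t_s)]$ is $$\mathrm{reg}(\mathbb{K}[G(t_1,\ldots,t_s)])=\begin{cases} t_1+\cdots+t_s & \text{if } s\geq 2,\\ 0 & \text{if } s=1.\end{cases}$$
   Context: The graph $G(t_1,\ldots,t_s)$. It is the finite simple graph with a center vertex $v$ and, for each $1 \le i \le s$, further vertices $v_{i,1},\ldots,v_{i,2t_i}$ (all vertices distinct), and edges $e_{i,1}=\{v,v_{i,1}\}$, $e_{i,j}=\{v_{i,j-1},v_{i,j}\}$ for $2\le j\le 2t_i$, and $e_{i,2t_i+1}=\{v_{i,2t_i},v\}$. Thus it consists of $s$ odd cycles of lengths $2t_i+1$ whose only common vertex is $v$. Toric edge ring. For a finite simple graph $G$ with vertices $x_1,\ldots,x_n$ and edges $e_1,\ldots,e_m$, the toric ideal $I_G$ is the kernel of the $\mathbb{K}$-algebra homomorphism $\varphi:\mathbb{K}[e_1,\ldots,e_m]\to\mathbb{K}[x_1,\ldots,x_n]$ given by $\varphi(e_i)=x_jx_k$ if $e_i=\{x_j,x_k\}$, and the toric edge ring is $\mathbb{K}[G]=\mathbb{K}[e_1,\ldots,e_m]/I_G$. The ring $R=\mathbb{K}[e_1,\ldots,e_m]$ has the standard grading ($\deg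 e_i=1$), with respect to which $I_G$ is homogeneous. Regularity. For a homogeneous ideal $I$ of a standard graded polynomial ring $R$ over $\mathbb{K}$, $\mathrm{reg}(R/I)=\max\{j-i\mid \beta_{i,j}(R/I)\neq 0\}$, where $\beta_{i,j}(R/I)$ is the $(i,j)$-th graded Betti number in the minimal graded free resolution of $R/I$ over $R$. Here $\mathrm{reg}(\mathbb{K}[G])$ is computed with $R=\mathbb{K}[e_1,\ldots,e_m]$ and $I=I_G$. *)

theory Defs
  imports Complex_Main "HOL-Library.Poly_Mapping"
begin

section \<open>Polynomials\<close>

text \<open>
  A polynomial is a finitely supported map from monomials to coefficients, a monomial being a
  finitely supported map from variables to exponents; multiplication on
  \<^theory>\<open>HOL-Library.Poly_Mapping\<close> is convolution, i.e. polynomial multiplication. Polynomials in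
  a given set \<open>X\<close> of variables are selected by the carrier set \<open>poly_ring X\<close>.
\<close>

type_synonym ('x, 'k) mpoly = "('x \<Rightarrow>\<^sub>0 nat) \<Rightarrow>\<^sub>0 'k"

definition poly_ring :: "'x set \<Rightarrow> ('x, 'k::zero) mpoly set" where
  "poly_ring X = {p. \<forall>m\<in>Poly_Mapping.keys p. Poly_Mapping.keys m \<subseteq> X}"

definition var :: "'x \<Rightarrow> ('x, 'k::comm_ring_1) mpoly" where
  "var x = Poly_Mapping.single (Poly_Mapping.single x 1) 1"

definition const :: "'k \<Rightarrow> ('x, 'k::comm_ring_1) mpoly" where
  "const c = Poly_Mapping.single 0 c"

definition mono_degree :: "('x \<Rightarrow>\<^sub>0 nat) \<Rightarrow> nat" where
  "mono_degree m = (\<Sum>x\<in>Poly_Mapping.keys m. Poly_Mapping.lookup m x)"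

text \<open>The zero polynomial is homogeneous of every degree, and it is the only polynomial that is
  homogeneous of a negative degree.\<close>

definition homogeneous :: "int \<Rightarrow> ('x, 'k::zero) mpoly \<Rightarrow> bool" where
  "homogeneous n p \<longleftrightarrow> (\<forall>m\<in>Poly_Mapping.keys p. int (mono_degree m) = n)"

text \<open>The homogeneous maximal ideal of the polynomial ring: polynomials without constant term.\<close>

definition irrelevant_ideal :: "'x set \<Rightarrow> ('x, 'k::zero) mpoly set" where
  "irrelevant_ideal X = {p \<in> poly_ring X. Poly_Mapping.lookup p 0 = 0}"


section \<open>Minimal graded free resolutions of \<open>R/I\<close>\<close>

text \<open>
  Let \<open>R = poly_ring X\<close>. The graded free module \<open>R(-b 0) \<oplus> \<dots> \<oplus> R(-b (r-1))\<close> is given by the list \<open>b\<close>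
  of the degrees of its basis elements. Its elements are functions on \<open>nat\<close> that vanish from
  \<open>length b\<close> on, so that equality of elements is equality of functions.
\<close>

definition free_module :: "'x set \<Rightarrow> nat \<Rightarrow> (nat \<Rightarrow> ('x, 'k::zero) mpoly) set" where
  "free_module X r = {u. (\<forall>k<r. u k \<in> poly_ring X) \<and> (\<forall>k\<ge>r. u k = 0)}"

definition mat_map ::
  "nat \<Rightarrow> nat \<Rightarrow> (nat \<Rightarrow> nat \<Rightarrow> ('x, 'k::comm_ring_1) mpoly) \<Rightarrow>
   (nat \<Rightarrow> ('x, 'k) mpoly) \<Rightarrow> (nat \<Rightarrow> ('x, 'k) mpoly)" where
  "mat_map p q A u = (\<lambda>k. if k < p then \<Sum>l<q. A k l * u l else 0)"

text \<open>\<open>A\<close> is the matrix of a degree-preserving \<open>R\<close>-linear map from the graded free module with basis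
  degrees \<open>c\<close> to the one with basis degrees \<open>b\<close>.\<close>

definition graded_matrix ::
  "'x set \<Rightarrow> int list \<Rightarrow> int list \<Rightarrow> (nat \<Rightarrow> nat \<Rightarrow> ('x, 'k::zero) mpoly) \<Rightarrow> bool" where
  "graded_matrix X b c A \<longleftrightarrow>
     (\<forall>k<length b. \<forall>l<length c. A k l \<in> poly_ring X \<and> homogeneous (c ! l - b ! k) (A k l))"

text \<open>
  A graded free resolution
  \<open>\<dots> \<rightarrow> F 2 \<rightarrow> F 1 \<rightarrow> F 0 \<rightarrow> R/I \<rightarrow> 0\<close> by finitely generated free modules. The list \<open>a i\<close> contains the
  degrees of the basis of \<open>F i\<close>, \<open>d i\<close> is the matrix of the differential \<open>F i \<rightarrow> F (i - 1)\<close> for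
  \<open>i \<ge> 1\<close> (\<open>d 0\<close> is irrelevant), and the augmentation \<open>F 0 \<rightarrow> R/I\<close> sends the \<open>l\<close>-th basis element to
  the class of \<open>g l\<close>. The last three conditions are exactness at \<open>R/I\<close>, at \<open>F 0\<close>, and at \<open>F i\<close>
  for \<open>i \<ge> 1\<close>.
\<close>

definition graded_free_resolution ::
  "'x set \<Rightarrow> ('x, 'k::comm_ring_1) mpoly set \<Rightarrow> (nat \<Rightarrow> int list) \<Rightarrow> (nat \<Rightarrow> ('x, 'k) mpoly) \<Rightarrow>
   (nat \<Rightarrow> nat \<Rightarrow> nat \<Rightarrow> ('x, 'k) mpoly) \<Rightarrow> bool" where
  "graded_free_resolution X I a g d \<longleftrightarrow>
     (\<forall>l<length (a 0). g l \<in> poly_ring X \<and> homogeneous (a 0 ! l) (g l)) \<and>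
     (\<forall>i. graded_matrix X (a i) (a (Suc i)) (d (Suc i))) \<and>
     (\<forall>p\<in>poly_ring X. \<exists>u\<in>free_module X (length (a 0)). p - (\<Sum>l<length (a 0). u l * g l) \<in> I) \<and>
     {u \<in> free_module X (length (a 0)). (\<Sum>l<length (a 0). u l * g l) \<in> I} =
       mat_map (length (a 0)) (length (a 1)) (d 1) ` free_module X (length (a 1)) \<and>
     (\<forall>i\<ge>1. {u \<in> free_module X (length (a i)).
               mat_map (length (a (i - 1))) (length (a i)) (d i) u = (\<lambda>_. 0)} =
       mat_map (length (a i)) (length (a (Suc i))) (d (Suc i)) ` free_module X (length (a (Suc i))))"

definition minimal_graded_free_resolution ::
  "'x set \<Rightarrow> ('x, 'k::comm_ring_1) mpoly set \<Rightarrow> (nat \<Rightarrow> int list) \<Rightarrow> (nat \<Rightarrow> ('x, 'k) mpoly) \<Rightarrow>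
   (nat \<Rightarrow> nat \<Rightarrow> nat \<Rightarrow> ('x, 'k) mpoly) \<Rightarrow> bool" where
  "minimal_graded_free_resolution X I a g d \<longleftrightarrow>
     graded_free_resolution X I a g d \<and>
     (\<forall>i. \<forall>k<length (a i). \<forall>l<length (a (Suc i)). d (Suc i) k l \<in> irrelevant_ideal X)"

text \<open>Basis degrees of a minimal graded free resolution of \<open>R/I\<close>. It exists for every homogeneous
  ideal \<open>I\<close> when \<open>X\<close> is finite and the coefficients form a field, and it is unique up to isomorphism;
  so the Betti numbers below do not depend on the choice.\<close>

definition minimal_shifts :: "'x set \<Rightarrow> ('x, 'k::field) mpoly set \<Rightarrow> nat \<Rightarrow> int list" where
  "minimal_shifts X I = (SOME a. \<exists>g d. minimal_graded_free_resolution X I a g d)"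

definition graded_betti :: "'x set \<Rightarrow> ('x, 'k::field) mpoly set \<Rightarrow> nat \<Rightarrow> int \<Rightarrow> nat" where
  "graded_betti X I i j = count_list (minimal_shifts X I i) j"

text \<open>Castelnuovo--Mumford regularity of \<open>R/I\<close>, where \<open>R = poly_ring X\<close>.\<close>

definition regularity :: "'x set \<Rightarrow> ('x, 'k::field) mpoly set \<Rightarrow> int" where
  "regularity X I = Max {j - int i | i j. graded_betti X I i j \<noteq> 0}"


section \<open>Toric ideals of graphs\<close>

text \<open>A graph is a pair of a vertex set and an edge set. Edges are two-element sets of vertices and
  serve themselves as the variables of the polynomial ring \<open>K[E]\<close>.\<close>

type_synonym 'v graph = "'v set \<times> 'v set set"

abbreviation vertices :: "'v graph \<Rightarrow> 'v set" where "vertices G \<equiv> fst G"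
abbreviation edges :: "'v graph \<Rightarrow> 'v set set" where "edges G \<equiv> snd G"

definition finite_simple_graph :: "'v graph \<Rightarrow> bool" where
  "finite_simple_graph G \<longleftrightarrow>
     finite (vertices G) \<and> (\<forall>e\<in>edges G. e \<subseteq> vertices G \<and> card e = 2)"

text \<open>The \<open>K\<close>-algebra homomorphism \<open>K[E] \<rightarrow> K[V]\<close> that sends the variable \<open>e = {x, y}\<close> to the
  monomial \<open>x y\<close>.\<close>

definition toric_map :: "('v set, 'k::field) mpoly \<Rightarrow> ('v, 'k) mpoly" where
  "toric_map p =
     (\<Sum>m\<in>Poly_Mapping.keys p. const (Poly_Mapping.lookup p m) *
        (\<Prod>e\<in>Poly_Mapping.keys m. (\<Prod>x\<in>e. var x) ^ Poly_Mapping.lookup m e))"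

definition toric_ideal :: "'v graph \<Rightarrow> ('v set, 'k::field) mpoly set" where
  "toric_ideal G = {p \<in> poly_ring (edges G). toric_map p = 0}"


section \<open>Odd cycles sharing one vertex\<close>

datatype vertex = Center | Outer nat nat

definition cycle_edge :: "(nat \<Rightarrow> nat) \<Rightarrow> nat \<Rightarrow> nat \<Rightarrow> vertex set" where
  "cycle_edge t i j =
     (if j = 1 then {Center, Outer i 1}
      else if j \<le> 2 * t i then {Outer i (j - 1), Outer i j}
      else {Outer i (2 * t i), Center})"

definition odd_cycles_graph :: "nat \<Rightarrow> (nat \<Rightarrow> nat) \<Rightarrow> vertex graph" where
  "odd_cycles_graph s t =
     ({Center} \<union> {Outer i j | i j. i \<in> {1..s} \<and> j \<in> {1..2 * t i}},
      {cycle_edge t i j | i j. i \<in> {1..s} \<and> j \<in> {1..2 * t i + 1}})"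

lemma finite_simple_graph_odd_cycles_graph:
  assumes "\<And>i. i \<in> {1..s} \<Longrightarrow> t i \<ge> 1"
  shows "finite_simple_graph (odd_cycles_graph s t)"
proof -
  have "{Outer i j | i j. i \<in> {1..s} \<and> j \<in> {1..2 * t i}} =
      (\<lambda>(i, j). Outer i j) ` (SIGMA i:{1..s}. {1..2 * t i})"
    by auto
  moreover have "finite (SIGMA i:{1..s}. {1..2 * t i})"
    by auto
  ultimately have "finite (vertices (odd_cycles_graph s t))"
    unfolding odd_cycles_graph_def by simp
  moreover have "cycle_edge t i j \<subseteq> vertices (odd_cycles_graph s t) \<and> card (cycle_edge t i j) = 2"
    if "i \<in> {1..s}" "j \<in> {1..2 * t i + 1}" for i j
    using that assms[OF that(1)] by (auto simp: cycle_edge_def odd_cycles_graph_def)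
  moreover have "\<exists>i\<in>{1..s}. \<exists>j\<in>{1..2 * t i + 1}. e = cycle_edge t i j"
    if "e \<in> edges (odd_cycles_graph s t)" for e
    using that unfolding odd_cycles_graph_def snd_conv by blast
  ultimately show ?thesis
    unfolding finite_simple_graph_def by blast
qed

end

theory Submission
  imports Defs "Jordan_Normal_Form.Determinant"
begin

text \<open>
  Let \<open>A\<^sub>i\<close> be the product of the \<open>t\<^sub>i + 1\<close> odd-numbered edges of the \<open>i\<close>-th cycle and \<open>B\<^sub>i\<close> the product
  of its \<open>t\<^sub>i\<close> even-numbered edges. Two monomials in the edges have the same image exactly if they
  differ by a product of powers \<open>(A\<^sub>i / B\<^sub>i)\<^bsup>\<delta>\<^sub>i\<^esup>\<close> with \<open>\<Sum>i. \<delta>\<^sub>i = 0\<close>, so the toric ideal is generated by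
  the 2-minors \<open>A\<^sub>i B\<^sub>j - A\<^sub>j B\<^sub>i\<close>. Both \<open>A\<^sub>1, \<dots>, A\<^sub>s\<close> and \<open>B\<^sub>1, \<dots>, B\<^sub>s\<close> are regular sequences, being
  monomials in disjoint variables, and exactness of their Koszul complexes implies exactness of the
  Eagon--Northcott complex of these minors. The basis element of its \<open>i\<close>-th module given by a set \<open>S\<close> of
  \<open>i + 1\<close> columns and a divided power with \<open>a < i\<close> factors from the \<open>A\<close>-row has degree
  \<open>(\<Sum>k\<in>S. t\<^sub>k) + a + 1\<close>, which exceeds \<open>i\<close> by at most \<open>\<Sum>k. t\<^sub>k\<close>, with equality for \<open>i = s - 1 = a + 1\<close>
  and all columns. The complex is minimal, and the shifts of a minimal graded resolution do not depend on
  the resolution by a homotopy argument.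
\<close>


section \<open>Koszul complexes of a two-row matrix\<close>

text \<open>Write \<open>\<partial>\<^sub>x\<close> and \<open>\<partial>\<^sub>y\<close> for the
  Koszul differentials of the two rows; they anticommute. A cycle of the Eagon--Northcott complex is
  a chain of components with \<open>\<partial>\<^sub>x w (a+1) + \<partial>\<^sub>y w a = 0\<close>.
  Preimages of the higher components come from exactness for \<open>x\<close> alone. The obstacle is
  the bottom one, where \<open>\<partial>\<^sub>x \<partial>\<^sub>y w = 0\<close> has to imply
  \<open>w = \<partial>\<^sub>x p + \<partial>\<^sub>y q\<close>. Regularity of both rows would not
  give this by itself: for equal rows the premise always holds. What separates the rows is a weight,
  the total exponent of the first edges of the cycles, which is 1 on every A and 0 on every B. Two
  features of the definitions shape the rest. The regularity refers to some minimal resolution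
  picked by a choice operator, so every minimal resolution has to be compared with the constructed
  one. The polynomial type contains all variables, while the ring is only a carrier set; exactness
  is proved in the whole type and then projected to the ring.\<close>

definition ksgn :: "'i::linorder \<Rightarrow> 'i set \<Rightarrow> 'a::comm_ring_1" where
  "ksgn k T = (-1) ^ card {j\<in>T. j < k}"

text \<open>An element of the exterior algebra is the family of its coefficients \<open>w S\<close>,
  all exterior degrees together, with \<open>card S\<close> as homological degree. The value at
  \<open>T\<close> is the coefficient of the basis element of \<open>T\<close> in its Koszul
  differential.\<close>

definition kdiff :: "'i::linorder set \<Rightarrow> ('i \<Rightarrow> 'a::comm_ring_1) \<Rightarrow> ('i set \<Rightarrow> 'a) \<Rightarrow> 'i set \<Rightarrow> 'a" where
  "kdiff N f w T = (\<Sum>k\<in>N - T. ksgn k T * f k * w (insert k T))"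

text \<open>Regularity refers to the sequence of the \<open>f n\<close> in increasing order of the index; the ideal they
  generate may be the whole ring.\<close>

definition regular_family :: "'i::linorder set \<Rightarrow> ('i \<Rightarrow> 'a::comm_ring_1) \<Rightarrow> bool" where
  "regular_family N f \<longleftrightarrow>
     (\<forall>n\<in>N. \<forall>u. (\<exists>c. f n * u = (\<Sum>k\<in>{j\<in>N. j < n}. f k * c k)) \<longrightarrow>
                 (\<exists>c. u = (\<Sum>k\<in>{j\<in>N. j < n}. f k * c k)))"

lemma ksgn_insert_greater:
  assumes "k < l" shows "ksgn k (insert l T) = ksgn k T"
proof -
  have "{j \<in> insert l T. j < k} = {j \<in> T. j < k}" using assms by auto
  then show ?thesis by (simp add: ksgn_def)
qed

lemma ksgn_insert_less:
  assumes "k < l" "finite T" "k \<notin> T" shows "ksgn l (insert k T) = - ksgn l T"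
proof -
  have "{j \<in> insert k T. j < l} = insert k {j \<in> T. j < l}" using assms by auto
  then show ?thesis using assms by (simp add: ksgn_def)
qed

text \<open>Inserting the smaller index first flips the sign of the larger one; inserting the larger
  first leaves the sign of the smaller one alone.\<close>

lemma ksgn_swap:
  assumes "k \<noteq> l" "finite T" "k \<notin> T" "l \<notin> T"
  shows "ksgn k T * ksgn l (insert k T) = - (ksgn l T * ksgn k (insert l T))"
proof (cases "k < l")
  case True
  then show ?thesis using assms by (simp add: ksgn_insert_greater ksgn_insert_less mult.commute)
next
  case False
  then have "l < k" using assms by auto
  then show ?thesis using assms by (simp add: ksgn_insert_greater ksgn_insert_less mult.commute)
qed

text \<open>The diagonal is a separate hypothesis because antisymmetry gives only
  \<open>2 * a k k = 0\<close>, which is void in characteristic 2.\<close>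

lemma sum_alternating_eq_0:
  fixes a :: "'i \<Rightarrow> 'i \<Rightarrow> 'a::comm_ring_1"
  assumes "finite A" "\<And>k l. k \<in> A \<Longrightarrow> l \<in> A \<Longrightarrow> a k l = - a l k" "\<And>k. k \<in> A \<Longrightarrow> a k k = 0"
  shows "(\<Sum>k\<in>A. \<Sum>l\<in>A. a k l) = 0"
  using assms
proof (induction A rule: finite_induct)
  case (insert x A)
  have "(\<Sum>k\<in>A. a k x) = - (\<Sum>l\<in>A. a x l)"
    unfolding sum_negf [symmetric] by (intro sum.cong refl insert.prems(1)) auto
  moreover have "(\<Sum>k\<in>A. \<Sum>l\<in>A. a k l) = 0" by (rule insert.IH) (use insert.prems in blast)+
  ultimately show ?case using insert.hyps insert.prems(2) [of x] by (simp add: sum.distrib)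
qed simp

lemma kdiff_cong:
  assumes "\<And>k. k \<in> N - T \<Longrightarrow> w (insert k T) = w' (insert k T)"
  shows "kdiff N f w T = kdiff N f w' T"
  unfolding kdiff_def using assms by (intro sum.cong) auto

lemma kdiff_add: "kdiff N f (\<lambda>T. w T + w' T) T = kdiff N f w T + kdiff N f w' T"
  by (simp add: kdiff_def algebra_simps sum.distrib)

lemma kdiff_minus: "kdiff N f (\<lambda>T. - w T) T = - kdiff N f w T"
  by (simp add: kdiff_def sum_negf)

lemma kdiff_diff: "kdiff N f (\<lambda>T. w T - w' T) T = kdiff N f w T - kdiff N f w' T"
  by (simp add: kdiff_def algebra_simps sum_subtractf)

lemma kdiff_scale: "kdiff N f (\<lambda>T. c * w T) T = c * kdiff N f w T"
  by (simp add: kdiff_def sum_distrib_left algebra_simps)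

text \<open>Two maps \<open>h\<close> and \<open>g\<close> occur because pulling \<open>f k\<close>
  out can change the map: the bound of a truncation drops by one, or the toric map produces an extra
  factor.\<close>

lemma kdiff_hom:
  fixes f :: "'i::linorder \<Rightarrow> 'a::comm_ring_1" and f' :: "'i \<Rightarrow> 'b::comm_ring_1"
  assumes add: "\<And>u v. h (u + v) = h u + h v"
    and scale: "\<And>k u. k \<in> N \<Longrightarrow> h (f k * u) = f' k * g u"
  shows "h (kdiff N f w T) = kdiff N f' (\<lambda>T. g (w T)) T"
proof -
  have zero: "h 0 = 0" using add [of 0 0] by simp
  have neg: "h (- u) = - h u" for u using add [of u "- u"] zero by (simp add: eq_neg_iff_add_eq_0 add.commute)
  have sgn: "h (ksgn k T * f k * u) = ksgn k T * f' k * g u" if "k \<in> N" for k u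
    unfolding ksgn_def using scale [OF that] neg by (cases "even (card {j \<in> T. j < k})") auto
  have sums: "h (sum F A) = (\<Sum>k\<in>A. h (F k))" for F and A :: "'i set"
    by (induction A rule: infinite_finite_induct) (auto simp: zero add)
  show ?thesis unfolding kdiff_def sums by (intro sum.cong) (auto simp: sgn)
qed

text \<open>Both sums run over all of \<open>N - T\<close>, with zeros on the diagonal, so that
  exchanging \<open>k\<close> and \<open>l\<close> is a symmetry of the index set.\<close>

lemma kdiff_kdiff:
  assumes "finite N"
  shows "kdiff N f (kdiff N g w) T =
    (\<Sum>k\<in>N - T. \<Sum>l\<in>N - T. if k = l then 0
       else ksgn k T * ksgn l (insert k T) * (f k * g l * w (insert k (insert l T))))"
  unfolding kdiff_def
proof (intro sum.cong refl)
  fix k assume k: "k \<in> N - T"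
  have "(\<Sum>l\<in>N - T. if k = l then 0 else ksgn k T * ksgn l (insert k T) * (f k * g l * w (insert k (insert l T))))
      = (\<Sum>l\<in>N - insert k T. ksgn k T * ksgn l (insert k T) * (f k * g l * w (insert k (insert l T))))"
    using assms k by (intro sum.mono_neutral_cong_right) auto
  then show "ksgn k T * f k * (\<Sum>ka\<in>N - insert k T. ksgn ka (insert k T) * g ka * w (insert ka (insert k T))) =
     (\<Sum>l\<in>N - T. if k = l then 0 else ksgn k T * ksgn l (insert k T) * (f k * g l * w (insert k (insert l T))))"
    by (simp add: sum_distrib_left mult_ac insert_commute)
qed

lemma kdiff_anticommute:
  assumes "finite N" "T \<subseteq> N"
  shows "kdiff N f (kdiff N g w) T = - kdiff N g (kdiff N f w) T"
proof -
  have "finite T" using assms finite_subset by blast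
  then have "(if k = l then 0 else ksgn k T * ksgn l (insert k T) * (f k * g l * w (insert k (insert l T)))) =
     - (if l = k then 0 else ksgn l T * ksgn k (insert l T) * (g l * f k * w (insert l (insert k T))))"
    if "k \<in> N - T" "l \<in> N - T" for k l
    using that ksgn_swap [of k l T, where ?'b = 'b] by (auto simp: insert_commute mult_ac)
  then show ?thesis
    unfolding kdiff_kdiff [OF assms(1)] sum_negf [symmetric]
    by (subst (2) sum.swap) (intro sum.cong, auto)
qed

text \<open>Anticommutation with \<open>g = f\<close> would only show that twice the value vanishes,
  which says nothing in characteristic 2; hence the cancellation in pairs.\<close>

lemma kdiff_square:
  assumes "finite N" "T \<subseteq> N"
  shows "kdiff N f (kdiff N f w) T = 0"
  unfolding kdiff_kdiff [OF assms(1)]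
proof (rule sum_alternating_eq_0)
  have "finite T" using assms finite_subset by blast
  then show "(if k = l then 0 else ksgn k T * ksgn l (insert k T) * (f k * f l * w (insert k (insert l T)))) =
     - (if l = k then 0 else ksgn l T * ksgn k (insert l T) * (f l * f k * w (insert l (insert k T))))"
    if "k \<in> N - T" "l \<in> N - T" for k l
    using that ksgn_swap [of k l T, where ?'b = 'b] by (auto simp: insert_commute mult_ac)
qed (use assms in auto)

text \<open>The mapping cone structure of the Koszul complex: a family on \<open>insert b N\<close>
  is a pair of families on \<open>N\<close>, given by the sets without and with \<open>b\<close>.
  The added index is the largest, so its own sign is \<open>(-1) ^ card T\<close> and it does not
  affect the other signs.\<close>

lemma kdiff_insert_max:
  assumes "finite N" "\<And>a. a \<in> N \<Longrightarrow> a < b" "T \<subseteq> N"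
  shows "kdiff (insert b N) f w T = kdiff N f w T + (-1) ^ card T * f b * w (insert b T)"
    and "kdiff (insert b N) f w (insert b T) = kdiff N f (\<lambda>T. w (insert b T)) T"
proof -
  have b: "b \<notin> N" "b \<notin> T" using assms by auto
  have "insert b N - T = insert b (N - T)" using b by auto
  moreover have "{j \<in> T. j < b} = T" using assms by auto
  ultimately show "kdiff (insert b N) f w T = kdiff N f w T + (-1) ^ card T * f b * w (insert b T)"
    using b assms by (simp add: kdiff_def ksgn_def add.commute)
  have "insert b N - insert b T = N - T" using b by auto
  then show "kdiff (insert b N) f w (insert b T) = kdiff N f (\<lambda>T. w (insert b T)) T"
    unfolding kdiff_def using assms by (auto intro!: sum.cong simp: ksgn_insert_greater insert_commute)
qed

text \<open>Induction along the mapping cone of the largest index \<open>b\<close>. The part of a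
  cycle on sets containing \<open>b\<close> is a boundary over \<open>N\<close>, by induction in
  positive degree and by regularity in degree 0. Correcting the other part by \<open>f b\<close>
  times a preimage makes it a cycle over \<open>N\<close> too.\<close>

lemma koszul_exact:
  assumes "finite N" "regular_family N f"
    and "\<And>T. T \<subseteq> N \<Longrightarrow> card T = k \<Longrightarrow> kdiff N f w T = 0"
  shows "\<exists>p. \<forall>T\<subseteq>N. card T = Suc k \<longrightarrow> w T = kdiff N f p T"
  using assms
proof (induction N arbitrary: k w rule: finite_linorder_max_induct)
  case empty
  then show ?case by auto
next
  case (insert b N)
  have b: "b \<notin> N" using insert.hyps by auto
  have sub: "{j \<in> insert b N. j < n} = {j \<in> N. j < n}" if "n \<in> N" for n using insert.hyps that by auto
  have subb: "{j \<in> insert b N. j < b} = N" using insert.hyps by auto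
  have reg: "regular_family N f"
    using insert.prems(1) sub unfolding regular_family_def by simp
  have regb: "\<exists>c. u = (\<Sum>k\<in>N. f k * c k)" if "f b * u = (\<Sum>k\<in>N. f k * c k)" for u and c :: "'a \<Rightarrow> 'b"
    using insert.prems(1) [unfolded regular_family_def, rule_format, of b u] that
    unfolding subb by blast
  note ins = kdiff_insert_max [OF insert.hyps(1), of b]
  have h1: "kdiff N f w T + (-1) ^ k * f b * w (insert b T) = 0" if "T \<subseteq> N" "card T = k" for T
    using insert.prems(2) [of T] ins(1) [of T f w] that insert.hyps(2) by auto
  have "\<exists>q. \<forall>T\<subseteq>N. card T = k \<longrightarrow> w (insert b T) = kdiff N f q T"
  proof (cases k)
    \<comment> \<open>Here regularity of \<open>f b\<close> enters: \<open>w {b}\<close> is a ring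
      element that \<open>f b\<close> multiplies into the ideal of the earlier elements.\<close>
    case 0
    have "f b * w {b} = (\<Sum>k\<in>N. f k * - w {k})"
      using h1 [of "{}"] 0 by (simp add: kdiff_def ksgn_def sum_negf eq_neg_iff_add_eq_0 add.commute)
    then obtain c where "w {b} = (\<Sum>k\<in>N. f k * c k)" using regb [where c = "\<lambda>k. - w {k}"] by blast
    then have "w {b} = kdiff N f (\<lambda>T. c (the_elem T)) {}" by (simp add: kdiff_def ksgn_def)
    moreover have "T = {}" if "T \<subseteq> N" "card T = k" for T
      using that 0 finite_subset [OF that(1) insert.hyps(1)] by simp
    ultimately show ?thesis by blast
  next
    case (Suc k')
    have "kdiff N f (\<lambda>T. w (insert b T)) T = 0" if "T \<subseteq> N" "card T = k'" for T
    proof -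
      have "b \<notin> T" "finite T" using that b insert.hyps(1) finite_subset by blast+
      then show ?thesis
        using insert.prems(2) [of "insert b T"] ins(2) [of T f w] that insert.hyps(2) Suc by auto
    qed
    then show ?thesis using insert.IH [OF reg, of k' "\<lambda>T. w (insert b T)"] Suc by auto
  qed
  then obtain q where q: "\<And>T. T \<subseteq> N \<Longrightarrow> card T = k \<Longrightarrow> w (insert b T) = kdiff N f q T" by auto
  have "kdiff N f (\<lambda>T. w T + ((-1) ^ k * f b) * q T) T = 0" if "T \<subseteq> N" "card T = k" for T
    using h1 [OF that] q [OF that] by (simp add: kdiff_add kdiff_scale)
  from insert.IH [OF reg this] obtain r where
    r: "\<And>T. T \<subseteq> N \<Longrightarrow> card T = Suc k \<Longrightarrow> w T + ((-1) ^ k * f b) * q T = kdiff N f r T" by blast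
  define p where "p T = (if b \<in> T then q (T - {b}) else r T)" for T
  have p: "kdiff N f p T = kdiff N f r T" "kdiff N f (\<lambda>T. p (insert b T)) T = kdiff N f q T" if "T \<subseteq> N" for T
  proof -
    have "b \<notin> T" using b that by blast
    then show "kdiff N f p T = kdiff N f r T" "kdiff N f (\<lambda>T. p (insert b T)) T = kdiff N f q T"
      using b by (auto intro!: kdiff_cong simp: p_def insert_Diff_if)
  qed
  show ?case
  proof (intro exI [of _ p] allI impI)
    fix T assume T: "T \<subseteq> insert b N" "card T = Suc k"
    show "w T = kdiff (insert b N) f p T"
    proof (cases "b \<in> T")
      case True
      define T' where "T' = T - {b}"
      have T': "T = insert b T'" "T' \<subseteq> N" "card T' = k" using T True by (auto simp: T'_def)
      show ?thesis using ins(2) [of T' f p] T' q [of T'] p(2) [of T'] insert.hyps(2) by auto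
    next
      case False
      then have T': "T \<subseteq> N" using T by auto
      have "p (insert b T) = q T" using False by (simp add: p_def)
      then show ?thesis using ins(1) [of T f p] T' r [OF T' T(2)] p(1) [of T] insert.hyps(2) T(2)
        by (simp add: algebra_simps) (metis add_right_cancel)
    qed
  qed
qed

text \<open>With respect to a grading in which the \<open>x k\<close> have degree 1 and the \<open>y k\<close> degree 0, \<open>tr n\<close> keeps
  the components of degree less than \<open>n\<close>. Writing \<open>\<partial>\<^sub>y w = \<partial>\<^sub>x w'\<close>, the degree of \<open>w'\<close> is smaller than
  that of \<open>w\<close>, so the descent stops.\<close>

lemma two_row_exact:
  fixes x y :: "'i::linorder \<Rightarrow> 'a::comm_ring_1" and tr :: "nat \<Rightarrow> 'a \<Rightarrow> 'a"
  assumes N: "finite N" and regx: "regular_family N x" and regy: "regular_family N y"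
    and tr_add: "\<And>n u v. tr n (u + v) = tr n u + tr n v"
    and tr_0: "\<And>u. tr 0 u = 0"
    and tr_x: "\<And>n k u. k \<in> N \<Longrightarrow> tr (Suc n) (x k * u) = x k * tr n u"
    and tr_y: "\<And>n k u. k \<in> N \<Longrightarrow> tr n (y k * u) = y k * tr n u"
    and tr_idem: "\<And>n u. tr n (tr n u) = tr n u"
    and tr_id: "\<And>u. \<exists>n. \<forall>m\<ge>n. tr m u = u"
    and w: "\<And>T. T \<subseteq> N \<Longrightarrow> card T = k \<Longrightarrow> kdiff N x (kdiff N y w) T = 0"
  shows "\<exists>p q. \<forall>T\<subseteq>N. card T = Suc (Suc k) \<longrightarrow> w T = kdiff N x p T + kdiff N y q T"
proof -
  have main: "\<exists>p q. \<forall>T\<subseteq>N. card T = Suc (Suc k) \<longrightarrow> w T = kdiff N x p T + kdiff N y q T"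
    if "\<And>T. T \<subseteq> N \<Longrightarrow> card T = k \<Longrightarrow> kdiff N x (kdiff N y w) T = 0"
       "\<And>T. T \<subseteq> N \<Longrightarrow> tr n (w T) = w T" for n w
    using that
  proof (induction n arbitrary: w)
    case 0
    then have "w T = 0" if "T \<subseteq> N" for T using that tr_0 by metis
    then have "w T = kdiff N x (\<lambda>_. 0) T + kdiff N y (\<lambda>_. 0) T" if "T \<subseteq> N" for T
      using that by (simp add: kdiff_def)
    then show ?case by blast
  next
    case (Suc n)
    obtain w1 where w1: "\<And>T. T \<subseteq> N \<Longrightarrow> card T = Suc k \<Longrightarrow> kdiff N y w T = kdiff N x w1 T"
      using koszul_exact [OF N regx Suc.prems(1)] by blast
    \<comment> \<open>Exactness says nothing about the weight of \<open>w1\<close>. Cutting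
      \<open>w1\<close> off keeps the equation: \<open>tr (Suc n)\<close> fixes \<open>w\<close> and
      passes through both differentials, becoming \<open>tr n\<close> under the one of
      \<open>x\<close>.\<close>
    define w2 where "w2 T = tr n (w1 T)" for T
    have w2: "kdiff N x w2 T = kdiff N y w T" if T: "T \<subseteq> N" "card T = Suc k" for T
    proof -
      have "kdiff N x w2 T = tr (Suc n) (kdiff N x w1 T)"
        unfolding w2_def by (rule kdiff_hom [symmetric]) (auto simp: tr_add tr_x)
      also have "\<dots> = tr (Suc n) (kdiff N y w T)" using w1 T by simp
      also have "\<dots> = kdiff N y (\<lambda>T. tr (Suc n) (w T)) T"
        by (rule kdiff_hom) (auto simp: tr_add tr_y)
      also have "\<dots> = kdiff N y w T" using T Suc.prems(2) by (intro kdiff_cong) auto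
      finally show ?thesis .
    qed
    have Ins: "insert l T \<subseteq> N \<and> card (insert l T) = Suc (card T)" if "T \<subseteq> N" "l \<in> N - T" for l T
      using that finite_subset [OF that(1) N] by auto
    have "kdiff N x (kdiff N y w2) T = 0" if T: "T \<subseteq> N" "card T = k" for T
    proof -
      have "kdiff N x (kdiff N y w2) T = - kdiff N y (kdiff N x w2) T"
        using kdiff_anticommute [OF N T(1)] .
      also have "kdiff N y (kdiff N x w2) T = kdiff N y (kdiff N y w) T"
        using T Ins by (intro kdiff_cong) (auto intro!: w2)
      finally show ?thesis using kdiff_square [OF N T(1)] by simp
    qed
    moreover have "tr n (w2 T) = w2 T" for T by (simp add: w2_def tr_idem)
    ultimately obtain p q where
      pq: "\<And>T. T \<subseteq> N \<Longrightarrow> card T = Suc (Suc k) \<Longrightarrow> w2 T = kdiff N x p T + kdiff N y q T"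
      using Suc.IH [of w2] by blast
    \<comment> \<open>From \<open>w2 = \<partial>\<^sub>x p + \<partial>\<^sub>y q\<close> follows
      \<open>\<partial>\<^sub>y w = \<partial>\<^sub>x w2 = - \<partial>\<^sub>y \<partial>\<^sub>x
      q\<close>, so adding \<open>\<partial>\<^sub>x q\<close> to \<open>w\<close> gives a cycle for
      \<open>y\<close> alone.\<close>
    have "kdiff N y (\<lambda>T. w T + kdiff N x q T) T = 0" if T: "T \<subseteq> N" "card T = Suc k" for T
    proof -
      have "kdiff N y w T = kdiff N x w2 T" using w2 T by simp
      also have "\<dots> = kdiff N x (\<lambda>T. kdiff N x p T + kdiff N y q T) T"
        using T Ins by (intro kdiff_cong) (auto intro!: pq)
      also have "\<dots> = - kdiff N y (kdiff N x q) T"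
        using kdiff_square [OF N T(1)] kdiff_anticommute [OF N T(1), of x y q] by (simp add: kdiff_add)
      finally show ?thesis by (simp add: kdiff_add)
    qed
    from koszul_exact [OF N regy this] obtain r where
      r: "\<And>T. T \<subseteq> N \<Longrightarrow> card T = Suc (Suc k) \<Longrightarrow> w T + kdiff N x q T = kdiff N y r T" by blast
    have "w T = kdiff N x (\<lambda>T. - q T) T + kdiff N y r T" if "T \<subseteq> N" "card T = Suc (Suc k)" for T
      using r [OF that] by (simp add: kdiff_minus algebra_simps)
    then show ?case by blast
  qed
  have "\<forall>T. \<exists>n. \<forall>m\<ge>n. tr m (w T) = w T" using tr_id by blast
  then obtain b where b: "\<And>T m. m \<ge> b T \<Longrightarrow> tr m (w T) = w T" by (rule choice [THEN exE]) blast
  have "tr (Max (b ` Pow N)) (w T) = w T" if "T \<subseteq> N" for T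
    using N that by (intro b Max_ge) auto
  then show ?thesis using main w by blast
qed

text \<open>The index \<open>a\<close> is that of the divided power. Only \<open>w 0\<close> needs
  the two-row hypothesis: once \<open>p (Suc n)\<close> is known, the chain relation turns
  \<open>w (Suc n)\<close> minus the \<open>y\<close>-differential of \<open>p (Suc n)\<close> into
  a cycle for \<open>x\<close>, and the Koszul complex of \<open>x\<close> supplies
  \<open>p (Suc (Suc n))\<close>.\<close>

lemma two_row_chain_exact:
  fixes x y :: "'i::linorder \<Rightarrow> 'a::comm_ring_1"
  assumes N: "finite N" and regx: "regular_family N x"
    and base: "\<And>w. (\<And>T. T \<subseteq> N \<Longrightarrow> card T = k \<Longrightarrow> kdiff N x (kdiff N y w) T = 0) \<Longrightarrow>
      \<exists>p q. \<forall>T\<subseteq>N. card T = Suc (Suc k) \<longrightarrow> w T = kdiff N x p T + kdiff N y q T"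
    and w0: "\<And>T. T \<subseteq> N \<Longrightarrow> card T = k \<Longrightarrow> kdiff N x (kdiff N y (w 0)) T = 0"
    and chain: "\<And>a T. a < n \<Longrightarrow> T \<subseteq> N \<Longrightarrow> card T = Suc k \<Longrightarrow>
      kdiff N x (w (Suc a)) T + kdiff N y (w a) T = 0"
  shows "\<exists>p. \<forall>a\<le>n. \<forall>T\<subseteq>N. card T = Suc (Suc k) \<longrightarrow>
           w a T = kdiff N x (p (Suc a)) T + kdiff N y (p a) T"
  using chain
proof (induction n)
  case 0
  obtain p q where "\<forall>T\<subseteq>N. card T = Suc (Suc k) \<longrightarrow> w 0 T = kdiff N x p T + kdiff N y q T"
    using base [OF w0] by blast
  then show ?case by (intro exI [of _ "\<lambda>a. if a = 0 then q else p"]) simp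
next
  case (Suc n)
  then obtain p where p: "\<And>a T. a \<le> n \<Longrightarrow> T \<subseteq> N \<Longrightarrow> card T = Suc (Suc k) \<Longrightarrow>
      w a T = kdiff N x (p (Suc a)) T + kdiff N y (p a) T"
    by (metis less_Suc_eq)
  have "kdiff N x (\<lambda>T. w (Suc n) T - kdiff N y (p (Suc n)) T) T = 0" if T: "T \<subseteq> N" "card T = Suc k" for T
  proof -
    have "kdiff N x (w (Suc n)) T = - kdiff N y (w n) T"
      using Suc.prems [of n T] T by (simp add: eq_neg_iff_add_eq_0)
    also have "kdiff N y (w n) T = kdiff N y (\<lambda>T. kdiff N x (p (Suc n)) T + kdiff N y (p n) T) T"
      using T finite_subset [OF T(1) N] by (intro kdiff_cong p) auto
    also have "\<dots> = - kdiff N x (kdiff N y (p (Suc n))) T"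
      using kdiff_square [OF N T(1)] kdiff_anticommute [OF N T(1), of y x] by (simp add: kdiff_add)
    finally show ?thesis by (simp add: kdiff_diff)
  qed
  from koszul_exact [OF N regx this] obtain r where
    r: "\<And>T. T \<subseteq> N \<Longrightarrow> card T = Suc (Suc k) \<Longrightarrow> w (Suc n) T - kdiff N y (p (Suc n)) T = kdiff N x r T" by blast
  have "w a T = kdiff N x ((p(Suc (Suc n) := r)) (Suc a)) T + kdiff N y ((p(Suc (Suc n) := r)) a) T"
    if "a \<le> Suc n" "T \<subseteq> N" "card T = Suc (Suc k)" for a T
  proof (cases "a = Suc n")
    case True
    then show ?thesis using r [OF that(2,3)] by (simp add: algebra_simps)
  next
    case False
    then show ?thesis using that p [of a T] by simp
  qed
  then show ?case by blast
qed

section \<open>Polynomials\<close>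

abbreviation "pkeys \<equiv> Poly_Mapping.keys"
abbreviation "coef \<equiv> Poly_Mapping.lookup"
abbreviation "monom_of \<equiv> Poly_Mapping.single"

lemma keys_add_nat: "pkeys (m + n :: 'x \<Rightarrow>\<^sub>0 nat) = pkeys m \<union> pkeys n"
  by (auto simp: in_keys_iff lookup_add)

lemma add_eq_0_nat: "m + n = (0 :: 'x \<Rightarrow>\<^sub>0 nat) \<longleftrightarrow> m = 0 \<and> n = 0"
  by (auto simp: poly_mapping_eq_iff fun_eq_iff lookup_add)

lemma keys_uminus: "pkeys (- p :: 'm \<Rightarrow>\<^sub>0 'k::ab_group_add) = pkeys p"
  by (auto simp: in_keys_iff)

lemma keys_mult_memD:
  assumes "a \<in> pkeys (p * q)"
  obtains m n where "a = m + n" "m \<in> pkeys p" "n \<in> pkeys q"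
  using assms keys_mult [of p q] by blast

lemma poly_mapping_sum_single: "(\<Sum>m\<in>pkeys p. monom_of m (coef p m)) = p"
proof (rule poly_mapping_eqI)
  fix k
  show "coef (\<Sum>m\<in>pkeys p. monom_of m (coef p m)) k = coef p k"
  proof (cases "k \<in> pkeys p")
    case True
    then show ?thesis
      by (simp add: lookup_sum lookup_single when_def sum.delta)
  next
    case False
    then show ?thesis
      by (auto simp: lookup_sum lookup_single when_def in_keys_iff intro!: sum.neutral)
  qed
qed

section \<open>Selecting monomials of a polynomial\<close>

definition restrict_monoms :: "('m \<Rightarrow> bool) \<Rightarrow> ('m \<Rightarrow>\<^sub>0 'k::zero) \<Rightarrow> 'm \<Rightarrow>\<^sub>0 'k" where
  "restrict_monoms P p = Poly_Mapping.mapp (\<lambda>m c. c when P m) p"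

lemma lookup_restrict_monoms: "coef (restrict_monoms P p) m = (coef p m when P m)"
  by (simp add: restrict_monoms_def lookup_mapp when_def in_keys_iff)

lemma keys_restrict_monoms: "pkeys (restrict_monoms P p) = {m \<in> pkeys p. P m}"
  by (auto simp: in_keys_iff lookup_restrict_monoms)

lemma restrict_monoms_id_iff: "restrict_monoms P p = p \<longleftrightarrow> (\<forall>m\<in>pkeys p. P m)"
  by (auto simp: poly_mapping_eq_iff fun_eq_iff lookup_restrict_monoms when_def in_keys_iff)

lemma restrict_monoms_eq_0_iff: "restrict_monoms P p = 0 \<longleftrightarrow> (\<forall>m\<in>pkeys p. \<not> P m)"
  by (auto simp: poly_mapping_eq_iff fun_eq_iff lookup_restrict_monoms when_def in_keys_iff)

lemma restrict_monoms_0 [simp]: "restrict_monoms P 0 = 0"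
  by (simp add: restrict_monoms_eq_0_iff)

lemma restrict_monoms_add:
  "restrict_monoms P (p + q :: 'm \<Rightarrow>\<^sub>0 'k::comm_monoid_add) = restrict_monoms P p + restrict_monoms P q"
  by (rule poly_mapping_eqI) (simp add: lookup_restrict_monoms lookup_add when_def)

lemma restrict_monoms_diff:
  "restrict_monoms P (p - q :: 'm \<Rightarrow>\<^sub>0 'k::ab_group_add) = restrict_monoms P p - restrict_monoms P q"
  by (rule poly_mapping_eqI) (simp add: lookup_restrict_monoms lookup_minus when_def)

lemma restrict_monoms_sum:
  "restrict_monoms P (sum f A :: 'm \<Rightarrow>\<^sub>0 'k::comm_monoid_add) = (\<Sum>a\<in>A. restrict_monoms P (f a))"
  by (induction A rule: infinite_finite_induct) (auto simp: restrict_monoms_add)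

lemma restrict_monoms_idem: "restrict_monoms P (restrict_monoms P p) = restrict_monoms P p"
  by (simp add: restrict_monoms_id_iff keys_restrict_monoms)

text \<open>Adding a monomial of \<open>p\<close> translates \<open>Q\<close> into \<open>P\<close>,
  so the products with the selected and with the discarded monomials of \<open>q\<close> cannot mix.
  Homogeneous components, restriction to a set of variables and truncation by weight are all
  instances.\<close>

lemma restrict_monoms_mult:
  fixes p q :: "'m::monoid_add \<Rightarrow>\<^sub>0 'k::comm_ring_1"
  assumes "\<And>m n. m \<in> pkeys p \<Longrightarrow> P (m + n) \<longleftrightarrow> Q n"
  shows "restrict_monoms P (p * q) = p * restrict_monoms Q q"
proof -
  have q: "q = restrict_monoms Q q + restrict_monoms (\<lambda>m. \<not> Q m) q"
    by (rule poly_mapping_eqI) (simp add: lookup_add lookup_restrict_monoms when_def)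
  have "restrict_monoms P (p * restrict_monoms Q q) = p * restrict_monoms Q q"
    unfolding restrict_monoms_id_iff
  proof
    fix m assume "m \<in> pkeys (p * restrict_monoms Q q)"
    then show "P m" using assms by (auto elim!: keys_mult_memD simp: keys_restrict_monoms)
  qed
  moreover have "restrict_monoms P (p * restrict_monoms (\<lambda>m. \<not> Q m) q) = 0"
    unfolding restrict_monoms_eq_0_iff
  proof
    fix m assume "m \<in> pkeys (p * restrict_monoms (\<lambda>m. \<not> Q m) q)"
    then show "\<not> P m" using assms by (auto elim!: keys_mult_memD simp: keys_restrict_monoms)
  qed
  moreover have "p * q = p * restrict_monoms Q q + p * restrict_monoms (\<lambda>m. \<not> Q m) q"
    by (subst q) (simp add: algebra_simps)
  ultimately show ?thesis by (simp add: restrict_monoms_add)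
qed

text \<open>Exponents are natural numbers, so a product of monomials is constant only if both
  factors are.\<close>

lemma lookup_0_mult:
  fixes p q :: "('x, 'k::comm_ring_1) mpoly"
  shows "coef (p * q) 0 = coef p 0 * coef q 0"
proof -
  define c :: "('x, 'k) mpoly \<Rightarrow> ('x, 'k) mpoly" where "c r = monom_of 0 (coef r 0)" for r :: "('x, 'k) mpoly"
  have c0: "coef (r - c r) 0 = 0" for r by (simp add: c_def lookup_minus)
  have nil: "coef (r * r') 0 = 0" if "coef r 0 = 0" for r r' :: "('x, 'k) mpoly"
  proof (rule ccontr)
    assume "coef (r * r') 0 \<noteq> 0"
    then have "0 \<in> pkeys (r * r')" by (simp add: in_keys_iff)
    then obtain m n where "0 = m + n" "m \<in> pkeys r" by (rule keys_mult_memD)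
    then show False using that add_eq_0_nat [of m n] by (auto simp: in_keys_iff)
  qed
  have "p * q = (p - c p) * q + ((q - c q) * c p + c p * c q)" by (simp add: algebra_simps)
  also have "coef \<dots> 0 = coef (c p * c q) 0"
    using c0 by (simp add: lookup_add nil)
  finally show ?thesis by (simp add: c_def mult_single)
qed

lemma lookup_0_sum_mult:
  "coef (\<Sum>l\<in>A. (f l :: ('x, 'k::comm_ring_1) mpoly) * g l) 0 = (\<Sum>l\<in>A. coef (f l) 0 * coef (g l) 0)"
  by (simp add: lookup_sum lookup_0_mult)

section \<open>Carrier sets, degrees and projections\<close>

lemma poly_ring_0 [simp]: "0 \<in> poly_ring X" by (simp add: poly_ring_def)
lemma poly_ring_1 [simp]: "(1 :: ('x, 'k::comm_ring_1) mpoly) \<in> poly_ring X" by (simp add: poly_ring_def)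

lemma poly_ring_add: "p \<in> poly_ring X \<Longrightarrow> q \<in> poly_ring X \<Longrightarrow> p + q \<in> poly_ring X"
  using keys_add [of p q] by (auto simp: poly_ring_def)

lemma poly_ring_uminus: "p \<in> poly_ring X \<Longrightarrow> - (p :: ('x, 'k::comm_ring_1) mpoly) \<in> poly_ring X"
  by (auto simp: poly_ring_def keys_uminus)

lemma poly_ring_diff:
  "p \<in> poly_ring X \<Longrightarrow> q \<in> poly_ring X \<Longrightarrow> p - (q :: ('x, 'k::comm_ring_1) mpoly) \<in> poly_ring X"
  using poly_ring_add [of p X "- q"] poly_ring_uminus [of q X] by simp

lemma poly_ring_mult:
  assumes "p \<in> poly_ring X" "q \<in> poly_ring X"
  shows "p * (q :: ('x, 'k::comm_ring_1) mpoly) \<in> poly_ring X"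
  unfolding poly_ring_def mem_Collect_eq
proof
  fix m assume "m \<in> pkeys (p * q)"
  then show "pkeys m \<subseteq> X" using assms
    by (elim keys_mult_memD) (auto simp: poly_ring_def keys_add_nat)
qed

lemma poly_ring_sum:
  "(\<And>a. a \<in> A \<Longrightarrow> f a \<in> poly_ring X) \<Longrightarrow> (sum f A :: ('x, 'k::comm_ring_1) mpoly) \<in> poly_ring X"
  by (induction A rule: infinite_finite_induct) (auto intro: poly_ring_add)

lemma mono_degree_superset:
  "finite A \<Longrightarrow> pkeys m \<subseteq> A \<Longrightarrow> mono_degree m = (\<Sum>x\<in>A. coef m x)"
  unfolding mono_degree_def by (rule sum.mono_neutral_left) (auto simp: in_keys_iff)

lemma mono_degree_add: "mono_degree (m + n) = mono_degree m + mono_degree n"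
  using mono_degree_superset [of "pkeys m \<union> pkeys n" m] mono_degree_superset [of "pkeys m \<union> pkeys n" n]
    mono_degree_superset [of "pkeys m \<union> pkeys n" "m + n"]
  by (simp add: keys_add_nat lookup_add sum.distrib)

lemma mono_degree_0 [simp]: "mono_degree 0 = 0" by (simp add: mono_degree_def)

lemma mono_degree_single: "mono_degree (monom_of x n) = n"
  by (cases "n = 0") (simp_all add: mono_degree_def)

lemma mono_degree_sum: "mono_degree (sum f A) = (\<Sum>a\<in>A. mono_degree (f a))"
  by (induction A rule: infinite_finite_induct) (auto simp: mono_degree_add)

lemma mono_degree_eq_0_iff: "mono_degree m = 0 \<longleftrightarrow> m = 0"
  by (auto simp: mono_degree_def poly_mapping_eq_iff fun_eq_iff in_keys_iff)

lemma homogeneous_0 [simp]: "homogeneous n 0" by (simp add: homogeneous_def)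

lemma homogeneous_add: "homogeneous n p \<Longrightarrow> homogeneous n q \<Longrightarrow> homogeneous n (p + q)"
  using keys_add [of p q] by (auto simp: homogeneous_def)

lemma homogeneous_sum:
  "(\<And>a. a \<in> A \<Longrightarrow> homogeneous n (f a)) \<Longrightarrow> homogeneous n (sum f A :: ('x, 'k::comm_ring_1) mpoly)"
  by (induction A rule: infinite_finite_induct) (auto intro: homogeneous_add)

lemma homogeneous_uminus: "homogeneous n p \<Longrightarrow> homogeneous n (- (p :: ('x, 'k::comm_ring_1) mpoly))"
  by (auto simp: homogeneous_def keys_uminus)

lemma homogeneous_mult:
  assumes "homogeneous n p" "homogeneous n' q"
  shows "homogeneous (n + n') (p * (q :: ('x, 'k::comm_ring_1) mpoly))"
  unfolding homogeneous_def
proof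
  fix m assume "m \<in> pkeys (p * q)"
  then show "int (mono_degree m) = n + n'" using assms
    by (elim keys_mult_memD) (auto simp: homogeneous_def mono_degree_add)
qed

lemma homogeneous_1: "homogeneous 0 (1 :: ('x, 'k::comm_ring_1) mpoly)"
  by (simp add: homogeneous_def)

definition hom_comp :: "int \<Rightarrow> ('x, 'k::zero) mpoly \<Rightarrow> ('x, 'k) mpoly" where
  "hom_comp n p = restrict_monoms (\<lambda>m. int (mono_degree m) = n) p"

lemma homogeneous_hom_comp: "homogeneous n (hom_comp n p)"
  by (simp add: homogeneous_def hom_comp_def keys_restrict_monoms)

lemma hom_comp_homogeneous: "homogeneous n p \<Longrightarrow> hom_comp n p = p"
  by (simp add: homogeneous_def hom_comp_def restrict_monoms_id_iff)

lemma hom_comp_mult: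
  assumes "homogeneous n' p"
  shows "hom_comp n (p * (q :: ('x, 'k::comm_ring_1) mpoly)) = p * hom_comp (n - n') q"
  unfolding hom_comp_def
  by (rule restrict_monoms_mult) (use assms in \<open>auto simp: homogeneous_def mono_degree_add\<close>)

lemma poly_ring_hom_comp: "p \<in> poly_ring X \<Longrightarrow> hom_comp n p \<in> poly_ring X"
  by (auto simp: poly_ring_def hom_comp_def keys_restrict_monoms)

lemma hom_comp_sum:
  "hom_comp n (sum f A :: ('x, 'k::comm_ring_1) mpoly) = (\<Sum>a\<in>A. hom_comp n (f a))"
  by (simp add: hom_comp_def restrict_monoms_sum)

text \<open>This projection is linear over \<open>poly_ring X\<close>. A solution of a linear system
  over \<open>poly_ring X\<close> that is found in the whole type can therefore be moved into
  \<open>poly_ring X\<close>.\<close>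

definition carrier_part :: "'x set \<Rightarrow> ('x, 'k::zero) mpoly \<Rightarrow> ('x, 'k) mpoly" where
  "carrier_part X p = restrict_monoms (\<lambda>m. pkeys m \<subseteq> X) p"

lemma carrier_part_in: "carrier_part X p \<in> poly_ring X"
  by (simp add: carrier_part_def poly_ring_def keys_restrict_monoms)

lemma carrier_part_id: "p \<in> poly_ring X \<Longrightarrow> carrier_part X p = p"
  by (simp add: carrier_part_def poly_ring_def restrict_monoms_id_iff)

lemma carrier_part_mult:
  "p \<in> poly_ring X \<Longrightarrow> carrier_part X (p * (q :: ('x, 'k::comm_ring_1) mpoly)) = p * carrier_part X q"
  unfolding carrier_part_def by (rule restrict_monoms_mult) (auto simp: poly_ring_def keys_add_nat)

lemma carrier_part_add:
  "carrier_part X (p + q :: ('x, 'k::comm_ring_1) mpoly) = carrier_part X p + carrier_part X q"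
  by (simp add: carrier_part_def restrict_monoms_add)

section \<open>Monomial ideals and regular sequences of monomials\<close>

lemma monomial_ideal_iff:
  fixes u :: "('x, 'k::comm_ring_1) mpoly"
  assumes "finite N"
  shows "(\<exists>c. u = (\<Sum>k\<in>N. monom_of (\<mu> k) 1 * c k)) \<longleftrightarrow> (\<forall>m\<in>pkeys u. \<exists>k\<in>N. \<exists>n. m = \<mu> k + n)"
proof
  assume "\<exists>c. u = (\<Sum>k\<in>N. monom_of (\<mu> k) 1 * c k)"
  then obtain c where u: "u = (\<Sum>k\<in>N. monom_of (\<mu> k) 1 * c k)" by blast
  show "\<forall>m\<in>pkeys u. \<exists>k\<in>N. \<exists>n. m = \<mu> k + n"
  proof
    fix m assume "m \<in> pkeys u"
    then obtain k where k: "k \<in> N" "m \<in> pkeys (monom_of (\<mu> k) 1 * c k)"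
      unfolding u in_keys_iff lookup_sum by (meson sum.not_neutral_contains_not_neutral)
    from k(2) obtain a n where "m = a + n" "a \<in> pkeys (monom_of (\<mu> k) (1::'k))"
      by (rule keys_mult_memD)
    then show "\<exists>k\<in>N. \<exists>n. m = \<mu> k + n" using k(1) by auto
  qed
next
  assume *: "\<forall>m\<in>pkeys u. \<exists>k\<in>N. \<exists>n. m = \<mu> k + n"
  have "\<exists>c. (\<Sum>m\<in>A. monom_of m (coef u m)) = (\<Sum>k\<in>N. monom_of (\<mu> k) 1 * c k)"
    if "finite A" "A \<subseteq> pkeys u" for A
    using that
  proof (induction A rule: finite_induct)
    case empty
    have "(\<Sum>k\<in>N. monom_of (\<mu> k) (1::'k) * 0) = 0" by simp
    then show ?case by (auto intro!: exI [of _ "\<lambda>_. 0"])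
  next
    case (insert m A)
    then obtain c where c: "(\<Sum>m\<in>A. monom_of m (coef u m)) = (\<Sum>k\<in>N. monom_of (\<mu> k) 1 * c k)" by auto
    obtain k n where k: "k \<in> N" "m = \<mu> k + n" using * insert.prems by blast
    define d where "d l = (if l = k then monom_of n (coef u m) else 0)" for l
    have "monom_of m (coef u m) = (\<Sum>l\<in>N. monom_of (\<mu> l) 1 * d l)"
      using k assms by (simp add: d_def if_distrib [of "(*) _"] mult_single cong: if_cong)
    then have "(\<Sum>m\<in>insert m A. monom_of m (coef u m)) = (\<Sum>l\<in>N. monom_of (\<mu> l) 1 * (d l + c l))"
      using insert.hyps c by (simp add: distrib_left sum.distrib)
    then show ?case by (intro exI [of _ "\<lambda>l. d l + c l"])
  qed
  from this [of "pkeys u"] show "\<exists>c. u = (\<Sum>k\<in>N. monom_of (\<mu> k) 1 * c k)"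
    by (simp add: poly_mapping_sum_single)
qed

text \<open>Membership in a monomial ideal is decided monomial by monomial, and a monomial that
  divides a product with a monomial in other variables divides the remaining factor.\<close>

lemma regular_family_monomials:
  fixes \<mu> :: "'i::linorder \<Rightarrow> 'x \<Rightarrow>\<^sub>0 nat"
  assumes "finite N" and disj: "\<And>k l. k \<in> N \<Longrightarrow> l \<in> N \<Longrightarrow> k \<noteq> l \<Longrightarrow> pkeys (\<mu> k) \<inter> pkeys (\<mu> l) = {}"
  shows "regular_family N (\<lambda>k. monom_of (\<mu> k) (1::'k::comm_ring_1))"
  unfolding regular_family_def
proof (intro ballI allI impI)
  fix n and u :: "('x, 'k) mpoly"
  assume n: "n \<in> N"
  have fin: "finite {j \<in> N. j < n}" using assms by simp
  assume "\<exists>c. monom_of (\<mu> n) 1 * u = (\<Sum>k\<in>{j \<in> N. j < n}. monom_of (\<mu> k) 1 * c k)"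
  then have *: "\<exists>k\<in>{j \<in> N. j < n}. \<exists>a. m = \<mu> k + a" if "m \<in> pkeys (monom_of (\<mu> n) 1 * u)" for m
    using that unfolding monomial_ideal_iff [OF fin] by blast
  show "\<exists>c. u = (\<Sum>k\<in>{j \<in> N. j < n}. monom_of (\<mu> k) 1 * c k)"
    unfolding monomial_ideal_iff [OF fin]
  proof
    fix m assume "m \<in> pkeys u"
    \<comment> \<open>Multiplication by a monomial only translates exponents, so no cancellation can
      remove \<open>\<mu> n + m\<close> from the product.\<close>
    have "restrict_monoms ((=) (\<mu> n + m)) (monom_of (\<mu> n) 1 * u) = monom_of (\<mu> n) 1 * restrict_monoms ((=) m) u"
      by (rule restrict_monoms_mult) (auto split: if_splits)
    also have "restrict_monoms ((=) m) u = monom_of m (coef u m)"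
      by (rule poly_mapping_eqI) (simp add: lookup_restrict_monoms lookup_single when_def)
    finally have "\<mu> n + m \<in> pkeys (monom_of (\<mu> n) 1 * u)"
      using \<open>m \<in> pkeys u\<close> by (auto simp: mult_single in_keys_iff poly_mapping_eq_iff fun_eq_iff
          lookup_restrict_monoms lookup_single when_def split: if_splits)
    then obtain k a where k: "k \<in> N" "k < n" "\<mu> n + m = \<mu> k + a" using * [of "\<mu> n + m"] by blast
    have "coef (\<mu> k) x \<le> coef m x" for x
    proof (cases "x \<in> pkeys (\<mu> k)")
      case True
      then have "x \<notin> pkeys (\<mu> n)" using disj [OF k(1) n] k(2) by blast
      then have "coef (\<mu> n) x = 0" by (simp add: in_keys_iff)
      then show ?thesis using arg_cong [OF k(3), of "\<lambda>p. coef p x"] by (simp add: lookup_add)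
    qed (simp add: in_keys_iff)
    then have "m = \<mu> k + (m - \<mu> k)"
      by (intro poly_mapping_eqI) (simp add: lookup_add lookup_minus)
    then show "\<exists>k\<in>{j \<in> N. j < n}. \<exists>a. m = \<mu> k + a" using k by blast
  qed
qed

section \<open>Uniqueness of the shifts of a minimal resolution\<close>

text \<open>After padding with zeros to square matrices, \<open>A * B = 1\<close> forces
  \<open>B * A = 1\<close>; but if \<open>r = card T\<close> is less than \<open>card S\<close>, row
  \<open>r\<close> of \<open>B\<close> is zero.\<close>

lemma card_le_if_identity_factors:
  fixes P :: "'a \<Rightarrow> 'b \<Rightarrow> 'k::field" and Q :: "'b \<Rightarrow> 'a \<Rightarrow> 'k"
  assumes fin: "finite S" "finite T"
    and id: "\<And>m l. m \<in> S \<Longrightarrow> l \<in> S \<Longrightarrow> (\<Sum>k\<in>T. P m k * Q k l) = (if m = l then 1 else 0)"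
  shows "card S \<le> card T"
proof (rule ccontr)
  assume "\<not> card S \<le> card T"
  define n where "n = card S"
  define r where "r = card T"
  have rn: "r < n" using \<open>\<not> card S \<le> card T\<close> by (simp add: n_def r_def)
  obtain s where s: "bij_betw s {0..<n} S" using ex_bij_betw_nat_finite [OF fin(1)] by (auto simp: n_def)
  obtain t where t: "bij_betw t {0..<r} T" using ex_bij_betw_nat_finite [OF fin(2)] by (auto simp: r_def)
  define A where "A = mat n n (\<lambda>(i, j). if j < r then P (s i) (t j) else 0)"
  define B where "B = mat n n (\<lambda>(i, j). if i < r then Q (t i) (s j) else 0)"
  have AB: "A \<in> carrier_mat n n" "B \<in> carrier_mat n n" by (auto simp: A_def B_def)
  have "A * B = 1\<^sub>m n"
  proof (rule eq_matI)
    fix i j assume "i < dim_row (1\<^sub>m n :: 'k mat)" "j < dim_col (1\<^sub>m n :: 'k mat)"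
    then have ij: "i < n" "j < n" by auto
    have "(A * B) $$ (i, j) = (\<Sum>k\<in>{0..<n}. if k < r then P (s i) (t k) * Q (t k) (s j) else 0)"
      using ij by (auto simp: A_def B_def scalar_prod_def intro!: sum.cong)
    also have "\<dots> = (\<Sum>k\<in>{0..<r}. P (s i) (t k) * Q (t k) (s j))"
      using rn by (intro sum.mono_neutral_cong_right) auto
    also have "\<dots> = (\<Sum>k\<in>T. P (s i) k * Q k (s j))"
      by (rule sum.reindex_bij_betw [OF t])
    also have "\<dots> = (if s i = s j then 1 else 0)"
      using ij s by (intro id) (auto simp: bij_betw_def)
    also have "\<dots> = 1\<^sub>m n $$ (i, j)"
      using ij s by (auto simp: bij_betw_def inj_on_def)
    finally show "(A * B) $$ (i, j) = 1\<^sub>m n $$ (i, j)" .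
  qed (auto simp: A_def B_def)
  then have "B * A = 1\<^sub>m n" using mat_mult_left_right_inverse AB by blast
  then have "(B * A) $$ (r, r) = 1" using rn by simp
  moreover have "(B * A) $$ (r, r) = 0"
    using rn by (simp add: A_def B_def scalar_prod_def)
  ultimately show False by simp
qed

section \<open>Graded matrices and the comparison of exact sequences\<close>

definition poly_mats :: "'x set \<Rightarrow> nat \<Rightarrow> nat \<Rightarrow> ('x, 'k::comm_ring_1) mpoly mat set" where
  "poly_mats X m n = {A \<in> carrier_mat m n. \<forall>i<m. \<forall>j<n. A $$ (i, j) \<in> poly_ring X}"

definition graded_mats :: "'x set \<Rightarrow> int list \<Rightarrow> int list \<Rightarrow> ('x, 'k::comm_ring_1) mpoly mat set" where
  "graded_mats X b c = {A \<in> poly_mats X (length b) (length c).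
     \<forall>i<length b. \<forall>j<length c. homogeneous (c ! j - b ! i) (A $$ (i, j))}"

definition irrelevant_mat :: "('x, 'k::comm_ring_1) mpoly mat \<Rightarrow> bool" where
  "irrelevant_mat A \<longleftrightarrow> (\<forall>i<dim_row A. \<forall>j<dim_col A. coef (A $$ (i, j)) 0 = 0)"

lemma poly_mats_carrier: "A \<in> poly_mats X m n \<Longrightarrow> A \<in> carrier_mat m n"
  by (simp add: poly_mats_def)

lemma graded_mats_poly: "A \<in> graded_mats X b c \<Longrightarrow> A \<in> poly_mats X (length b) (length c)"
  by (simp add: graded_mats_def)

lemma mult_mat_index:
  assumes "A \<in> carrier_mat m n" "B \<in> carrier_mat n r" "i < m" "j < r"
  shows "(A * B) $$ (i, j) = (\<Sum>k<n. A $$ (i, k) * B $$ (k, j))"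
  using assms by (auto simp: scalar_prod_def atLeast0LessThan intro!: sum.cong)

lemma poly_mats_mult:
  assumes "A \<in> poly_mats X m n" "B \<in> poly_mats X n r" shows "A * B \<in> poly_mats X m r"
  using assms mult_mat_index [of A m n B r]
  by (auto simp: poly_mats_def intro!: poly_ring_sum poly_ring_mult)

lemma poly_mats_minus:
  assumes "A \<in> poly_mats X m n" "B \<in> poly_mats X m n" shows "A - B \<in> poly_mats X m n"
  using assms by (auto simp: poly_mats_def poly_ring_diff)

lemma poly_mats_one: "1\<^sub>m n \<in> poly_mats X n n"
  by (auto simp: poly_mats_def)

lemma poly_mats_zero: "0\<^sub>m m n \<in> poly_mats X m n"
  by (auto simp: poly_mats_def)

lemma graded_mats_one: "1\<^sub>m (length b) \<in> graded_mats X b b"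
  by (auto simp: graded_mats_def poly_mats_one homogeneous_1)

lemma graded_mats_mult:
  assumes A: "A \<in> graded_mats X b c" and B: "B \<in> graded_mats X c e" shows "A * B \<in> graded_mats X b e"
proof -
  have "homogeneous (e ! j - b ! i) ((A * B) $$ (i, j))" if ij: "i < length b" "j < length e" for i j
  proof -
    have "homogeneous (e ! j - b ! i) (A $$ (i, k) * B $$ (k, j))" if "k < length c" for k
      using homogeneous_mult [of "c ! k - b ! i" "A $$ (i, k)" "e ! j - c ! k" "B $$ (k, j)"] A B ij that
      by (simp add: graded_mats_def)
    moreover have "(A * B) $$ (i, j) = (\<Sum>k<length c. A $$ (i, k) * B $$ (k, j))"
      using A B ij by (intro mult_mat_index) (auto simp: graded_mats_def poly_mats_def)
    ultimately show ?thesis by (auto intro: homogeneous_sum)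
  qed
  then show ?thesis using A B by (auto simp: graded_mats_def intro: poly_mats_mult)
qed

lemma irrelevant_mat_mult_left:
  assumes "A \<in> carrier_mat m n" "B \<in> carrier_mat n r" "irrelevant_mat A" shows "irrelevant_mat (A * B)"
  using assms mult_mat_index [of A m n B r] by (auto simp: irrelevant_mat_def lookup_0_sum_mult)

lemma irrelevant_mat_mult_right:
  assumes "A \<in> carrier_mat m n" "B \<in> carrier_mat n r" "irrelevant_mat B" shows "irrelevant_mat (A * B)"
  using assms mult_mat_index [of A m n B r] by (auto simp: irrelevant_mat_def lookup_0_sum_mult)

lemma irrelevant_mat_add:
  assumes "A \<in> carrier_mat m n" "B \<in> carrier_mat m n" "irrelevant_mat A" "irrelevant_mat B"
  shows "irrelevant_mat (A + B)"
  using assms by (auto simp: irrelevant_mat_def lookup_add)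

text \<open>Since \<open>D\<close> and \<open>B\<close> are graded, the equation
  \<open>B = D * C\<close> splits by degree: each entry of \<open>C\<close> can be replaced by its
  component of the degree that a graded matrix prescribes there.\<close>

lemma graded_lift:
  assumes D: "D \<in> graded_mats X b c" and B: "B \<in> graded_mats X b e"
    and C: "C \<in> poly_mats X (length c) (length e)" and eq: "B = D * C"
  shows "\<exists>C'\<in>graded_mats X c e. B = D * C'"
proof
  define C' where "C' = mat (length c) (length e) (\<lambda>(i, j). hom_comp (e ! j - c ! i) (C $$ (i, j)))"
  show C': "C' \<in> graded_mats X c e"
    using C by (auto simp: C'_def graded_mats_def poly_mats_def poly_ring_hom_comp homogeneous_hom_comp)
  have cD: "D \<in> carrier_mat (length b) (length c)" and cC: "C \<in> carrier_mat (length c) (length e)"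
    and cC': "C' \<in> carrier_mat (length c) (length e)" and cB: "B \<in> carrier_mat (length b) (length e)"
    using D C C' B by (auto simp: graded_mats_def poly_mats_def)
  show "B = D * C'"
  proof (rule eq_matI)
    fix i j assume "i < dim_row (D * C')" "j < dim_col (D * C')"
    then have ij: "i < length b" "j < length e" using cD cC' by auto
    have "hom_comp (e ! j - b ! i) (D $$ (i, k) * C $$ (k, j)) = D $$ (i, k) * C' $$ (k, j)" if "k < length c" for k
      using hom_comp_mult [of "c ! k - b ! i" "D $$ (i, k)" "e ! j - b ! i" "C $$ (k, j)"] D that ij
      by (simp add: graded_mats_def C'_def)
    then have "(D * C') $$ (i, j) = (\<Sum>k<length c. hom_comp (e ! j - b ! i) (D $$ (i, k) * C $$ (k, j)))"
      by (subst mult_mat_index [OF cD cC' ij]) auto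
    also have "\<dots> = hom_comp (e ! j - b ! i) (B $$ (i, j))"
      unfolding eq mult_mat_index [OF cD cC ij] hom_comp_sum ..
    also have "\<dots> = B $$ (i, j)" using B ij by (auto simp: graded_mats_def intro: hom_comp_homogeneous)
    finally show "B $$ (i, j) = (D * C') $$ (i, j)" by simp
  qed (use cB cD cC' in auto)
qed

text \<open>Exactness is required from step 1 on; the image of \<open>D 0\<close> is left to further
  hypotheses. It is stated for matrices with any number of columns, so that a whole map is lifted at
  once.\<close>

definition minimal_exact_matrices ::
  "'x set \<Rightarrow> (nat \<Rightarrow> int list) \<Rightarrow> (nat \<Rightarrow> ('x, 'k::comm_ring_1) mpoly mat) \<Rightarrow> bool" where
  "minimal_exact_matrices X a D \<longleftrightarrow>
    (\<forall>i. D i \<in> graded_mats X (a i) (a (Suc i)) \<and> irrelevant_mat (D i) \<and>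
       D i * D (Suc i) = 0\<^sub>m (length (a i)) (length (a (Suc (Suc i)))) \<and>
       (\<forall>n. \<forall>B\<in>poly_mats X (length (a (Suc i))) n. D i * B = 0\<^sub>m (length (a i)) n \<longrightarrow>
          (\<exists>C\<in>poly_mats X (length (a (Suc (Suc i)))) n. B = D (Suc i) * C)))"

text \<open>A single step of the comparison theorem suffices: \<open>h\<close> need not be graded, and it only has to be a
  homotopy on the image of \<open>D i\<close>. The next \<open>\<psi> \<phi> - 1\<close> is then \<open>h D i + D (Suc i) h'\<close>, which
  vanishes modulo the irrelevant ideal by minimality.\<close>

lemma minimal_exact_matrices_comparison:
  fixes D D' :: "nat \<Rightarrow> ('x, 'k::comm_ring_1) mpoly mat"
  assumes D: "minimal_exact_matrices X a D" and D': "minimal_exact_matrices X a' D'"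
    and start: "a' 0 = a 0"
    and im1: "\<exists>C\<in>poly_mats X (length (a' 1)) (length (a 1)). D 0 = D' 0 * C"
    and im2: "\<exists>C\<in>poly_mats X (length (a 1)) (length (a' 1)). D' 0 = D 0 * C"
  shows "\<exists>\<phi>\<in>graded_mats X (a' i) (a i). \<exists>\<psi>\<in>graded_mats X (a i) (a' i).
    \<exists>h\<in>poly_mats X (length (a (Suc i))) (length (a i)).
    (\<exists>C\<in>poly_mats X (length (a' (Suc i))) (length (a (Suc i))). \<phi> * D i = D' i * C) \<and>
    (\<exists>C\<in>poly_mats X (length (a (Suc i))) (length (a' (Suc i))). \<psi> * D' i = D i * C) \<and>
    (\<psi> * \<phi> - 1\<^sub>m (length (a i))) * D i = D i * (h * D i) \<and>
    irrelevant_mat (\<psi> * \<phi> - 1\<^sub>m (length (a i)))"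
proof -
  have gD: "D i \<in> graded_mats X (a i) (a (Suc i))" and mD: "irrelevant_mat (D i)"
    and DD: "D i * D (Suc i) = 0\<^sub>m (length (a i)) (length (a (Suc (Suc i))))"
    and exD: "\<And>B n. B \<in> poly_mats X (length (a (Suc i))) n \<Longrightarrow> D i * B = 0\<^sub>m (length (a i)) n \<Longrightarrow>
          \<exists>C\<in>poly_mats X (length (a (Suc (Suc i)))) n. B = D (Suc i) * C" for i
    using D unfolding minimal_exact_matrices_def by blast+
  have gD': "D' i \<in> graded_mats X (a' i) (a' (Suc i))"
    and DD': "D' i * D' (Suc i) = 0\<^sub>m (length (a' i)) (length (a' (Suc (Suc i))))"
    and exD': "\<And>B n. B \<in> poly_mats X (length (a' (Suc i))) n \<Longrightarrow> D' i * B = 0\<^sub>m (length (a' i)) n \<Longrightarrow>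
          \<exists>C\<in>poly_mats X (length (a' (Suc (Suc i)))) n. B = D' (Suc i) * C" for i
    using D' unfolding minimal_exact_matrices_def by blast+
  note pD = graded_mats_poly [OF gD] note pD' = graded_mats_poly [OF gD']
  note cD = poly_mats_carrier [OF pD] note cD' = poly_mats_carrier [OF pD']
  show ?thesis
  proof (induction i)
    case 0
    let ?n = "length (a 0)"
    have c: "D 0 \<in> carrier_mat ?n (length (a 1))" "D' 0 \<in> carrier_mat ?n (length (a' 1))"
      using cD [of 0] cD' [of 0] start by auto
    have id: "1\<^sub>m ?n * 1\<^sub>m ?n - 1\<^sub>m ?n = (0\<^sub>m ?n ?n :: ('x, 'k) mpoly mat)" by simp
    show ?case
      unfolding start
    \<comment> \<open>Both sequences end in the same module, so the comparison starts with identity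
      matrices and the zero homotopy.\<close>
    proof (rule bexI [of _ "1\<^sub>m ?n"], rule bexI [of _ "1\<^sub>m ?n"], rule bexI [of _ "0\<^sub>m (length (a 1)) ?n"],
        intro conjI)
      show "\<exists>C\<in>poly_mats X (length (a' (Suc 0))) (length (a (Suc 0))). 1\<^sub>m ?n * D 0 = D' 0 * C"
        using im1 left_mult_one_mat [OF c(1)] by simp
      show "\<exists>C\<in>poly_mats X (length (a (Suc 0))) (length (a' (Suc 0))). 1\<^sub>m ?n * D' 0 = D 0 * C"
        using im2 left_mult_one_mat [OF c(2)] by simp
      show "(1\<^sub>m ?n * 1\<^sub>m ?n - 1\<^sub>m ?n) * D 0 = D 0 * (0\<^sub>m (length (a 1)) ?n * D 0)"
        unfolding id using left_mult_zero_mat [OF c(1)] right_mult_zero_mat [OF c(1)] by simp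
      show "irrelevant_mat (1\<^sub>m ?n * 1\<^sub>m ?n - 1\<^sub>m ?n :: ('x, 'k) mpoly mat)"
        unfolding id by (simp add: irrelevant_mat_def)
    qed (simp_all add: graded_mats_one poly_mats_zero)
  next
    case (Suc i)
    let ?m = "length (a i)" and ?n = "length (a (Suc i))" and ?r = "length (a (Suc (Suc i)))"
    let ?m' = "length (a' i)" and ?n' = "length (a' (Suc i))" and ?r' = "length (a' (Suc (Suc i)))"
    obtain \<phi> \<psi> h C1 C2 where \<phi>: "\<phi> \<in> graded_mats X (a' i) (a i)" and \<psi>: "\<psi> \<in> graded_mats X (a i) (a' i)"
      and h: "h \<in> poly_mats X ?n ?m"
      and C1: "C1 \<in> poly_mats X ?n' ?n" "\<phi> * D i = D' i * C1"
      and C2: "C2 \<in> poly_mats X ?n ?n'" "\<psi> * D' i = D i * C2"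
      and hom: "(\<psi> * \<phi> - 1\<^sub>m ?m) * D i = D i * (h * D i)"
      using Suc by blast
    \<comment> \<open>The induction hypothesis provides solutions without control of degrees; the
      next comparison maps have to be graded.\<close>
    obtain \<phi>' where \<phi>': "\<phi>' \<in> graded_mats X (a' (Suc i)) (a (Suc i))" "\<phi> * D i = D' i * \<phi>'"
      using graded_lift [OF gD' graded_mats_mult [OF \<phi> gD] C1] by blast
    obtain \<psi>' where \<psi>': "\<psi>' \<in> graded_mats X (a (Suc i)) (a' (Suc i))" "\<psi> * D' i = D i * \<psi>'"
      using graded_lift [OF gD graded_mats_mult [OF \<psi> gD'] C2] by blast
    note p = graded_mats_poly [OF \<phi>] graded_mats_poly [OF \<psi>] graded_mats_poly [OF \<phi>'(1)]
      graded_mats_poly [OF \<psi>'(1)]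
    note c = p [THEN poly_mats_carrier] poly_mats_carrier [OF h] cD cD'
    define \<chi> where "\<chi> = \<psi>' * \<phi>' - 1\<^sub>m ?n"
    have \<chi>: "\<chi> \<in> poly_mats X ?n ?n"
      unfolding \<chi>_def using p by (intro poly_mats_minus poly_mats_mult poly_mats_one)
    note c\<chi> = poly_mats_carrier [OF \<chi>]
    have hD: "h * D i \<in> poly_mats X ?n ?n" using h pD by (rule poly_mats_mult)
    have "D i * (\<psi>' * \<phi>') = (D i * \<psi>') * \<phi>'" using assoc_mult_mat [OF cD c(4) c(3)] by simp
    also have "\<dots> = \<psi> * (D' i * \<phi>')" using assoc_mult_mat [OF c(2) cD' c(3)] \<psi>'(2) by simp
    also have "\<dots> = (\<psi> * \<phi>) * D i" using assoc_mult_mat [OF c(2) c(1) cD] \<phi>'(2) by simp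
    finally have "D i * \<chi> = (\<psi> * \<phi>) * D i - D i"
      unfolding \<chi>_def using c right_mult_one_mat [OF cD [of i]] by (subst mult_minus_distrib_mat [OF cD]) auto
    also have "\<dots> = (\<psi> * \<phi> - 1\<^sub>m ?m) * D i"
      using c left_mult_one_mat [OF cD [of i]] by (subst minus_mult_distrib_mat) auto
    finally have D\<chi>: "D i * \<chi> = D i * (h * D i)" using hom by simp
    \<comment> \<open>Both \<open>D i * \<chi>\<close> and \<open>D i * (h * D i)\<close> equal
      \<open>(\<psi> * \<phi> - 1) * D i\<close>, so exactness applies to the difference and yields
      the next homotopy.\<close>
    have "D i * (\<chi> - h * D i) = 0\<^sub>m ?m ?n"
      using D\<chi> poly_mats_carrier [OF hD] c\<chi> cD [of i]
      by (subst mult_minus_distrib_mat [OF cD]) auto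
    then obtain h' where h': "h' \<in> poly_mats X ?r ?n" "\<chi> - h * D i = D (Suc i) * h'"
      using exD [OF poly_mats_minus [OF \<chi> hD]] by blast
    note ch' = poly_mats_carrier [OF h'(1)]
    have \<chi>eq: "\<chi> = h * D i + D (Suc i) * h'"
      unfolding h'(2) [symmetric] using c\<chi> poly_mats_carrier [OF hD]
      by (intro eq_matI) auto
    have "irrelevant_mat \<chi>"
      unfolding \<chi>eq
    proof (rule irrelevant_mat_add)
      show "irrelevant_mat (h * D i)" using irrelevant_mat_mult_right [OF poly_mats_carrier [OF h] cD mD] .
      show "irrelevant_mat (D (Suc i) * h')" using irrelevant_mat_mult_left [OF cD ch' mD] .
    qed (use poly_mats_carrier [OF hD] cD [of "Suc i"] ch' in auto)
    \<comment> \<open>Multiplication by \<open>D (Suc i)\<close> kills the summand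
      \<open>h * D i\<close>. What remains is the homotopy relation in the weak form that the
      induction carries.\<close>
    moreover have "\<chi> * D (Suc i) = D (Suc i) * (h' * D (Suc i))"
    proof -
      have "\<chi> * D (Suc i) = h * D i * D (Suc i) + D (Suc i) * h' * D (Suc i)"
        unfolding \<chi>eq using poly_mats_carrier [OF hD] cD [of "Suc i"] ch'
        by (intro add_mult_distrib_mat) auto
      also have "h * D i * D (Suc i) = 0\<^sub>m ?n ?r"
        using assoc_mult_mat [OF poly_mats_carrier [OF h] cD cD [of "Suc i"]] DD [of i] poly_mats_carrier [OF h] by simp
      also have "0\<^sub>m ?n ?r + D (Suc i) * h' * D (Suc i) = D (Suc i) * h' * D (Suc i)"
        using cD [of "Suc i"] by (intro left_add_zero_mat) auto
      also have "\<dots> = D (Suc i) * (h' * D (Suc i))"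
        by (rule assoc_mult_mat [OF cD ch' cD])
      finally show ?thesis .
    qed
    moreover have "\<exists>C\<in>poly_mats X ?r' ?r. \<phi>' * D (Suc i) = D' (Suc i) * C"
    proof (rule exD')
      show "\<phi>' * D (Suc i) \<in> poly_mats X ?n' ?r" using p(3) pD by (rule poly_mats_mult)
      have "D' i * (\<phi>' * D (Suc i)) = \<phi> * D i * D (Suc i)"
        using assoc_mult_mat [OF cD' c(3) cD] \<phi>'(2) by simp
      also have "\<dots> = 0\<^sub>m ?m' ?r" using assoc_mult_mat [OF c(1) cD cD [of "Suc i"]] DD [of i] c(1) by simp
      finally show "D' i * (\<phi>' * D (Suc i)) = 0\<^sub>m ?m' ?r" .
    qed
    moreover have "\<exists>C\<in>poly_mats X ?r ?r'. \<psi>' * D' (Suc i) = D (Suc i) * C"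
    proof (rule exD)
      show "\<psi>' * D' (Suc i) \<in> poly_mats X ?n ?r'" using p(4) pD' by (rule poly_mats_mult)
      have "D i * (\<psi>' * D' (Suc i)) = \<psi> * D' i * D' (Suc i)"
        using assoc_mult_mat [OF cD c(4) cD'] \<psi>'(2) by simp
      also have "\<dots> = 0\<^sub>m ?m ?r'" using assoc_mult_mat [OF c(2) cD' cD' [of "Suc i"]] DD' [of i] c(2) by simp
      finally show "D i * (\<psi>' * D' (Suc i)) = 0\<^sub>m ?m ?r'" .
    qed
    ultimately show ?case using \<phi>'(1) \<psi>'(1) h'(1) unfolding \<chi>_def by blast
  qed
qed

lemma count_list_eq_card: "count_list xs x = card {i. i < length xs \<and> xs ! i = x}"
proof -
  have "count_list xs x = length (filter (\<lambda>y. y = x) xs)"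
    by (induction xs) auto
  then show ?thesis by (simp add: length_filter_conv_card)
qed

text \<open>Modulo the irrelevant ideal \<open>\<psi> * \<phi>\<close> is the identity, and a graded
  entry with nonzero constant term joins basis elements of equal degree. So the identity on the
  basis elements of degree \<open>j\<close> in \<open>a i\<close> factors through those of degree
  \<open>j\<close> in \<open>a' i\<close>.\<close>

lemma minimal_exact_matrices_count_le:
  fixes D D' :: "nat \<Rightarrow> ('x, 'k::field) mpoly mat"
  assumes "minimal_exact_matrices X a D" "minimal_exact_matrices X a' D'"
    and "a' 0 = a 0"
    and "\<exists>C\<in>poly_mats X (length (a' 1)) (length (a 1)). D 0 = D' 0 * C"
    and "\<exists>C\<in>poly_mats X (length (a 1)) (length (a' 1)). D' 0 = D 0 * C"
  shows "count_list (a i) j \<le> count_list (a' i) j"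
proof -
  obtain \<phi> \<psi> :: "('x, 'k) mpoly mat"
    where \<phi>: "\<phi> \<in> graded_mats X (a' i) (a i)" and \<psi>: "\<psi> \<in> graded_mats X (a i) (a' i)"
    and irr: "irrelevant_mat (\<psi> * \<phi> - 1\<^sub>m (length (a i)))"
    using minimal_exact_matrices_comparison [OF assms, of i] by blast
  note c = poly_mats_carrier [OF graded_mats_poly [OF \<phi>]] poly_mats_carrier [OF graded_mats_poly [OF \<psi>]]
  define S where "S = {l. l < length (a i) \<and> a i ! l = j}"
  define T where "T = {l. l < length (a' i) \<and> a' i ! l = j}"
  have "(\<Sum>k\<in>T. coef (\<psi> $$ (m, k)) 0 * coef (\<phi> $$ (k, l)) 0) = (if m = l then 1 else 0)"
    if "m \<in> S" "l \<in> S" for m l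
  proof -
    have ml: "m < length (a i)" "l < length (a i)" "a i ! l = j" using that by (auto simp: S_def)
    have "coef (\<phi> $$ (k, l)) 0 = 0" if "k < length (a' i)" "k \<notin> T" for k
    proof (rule ccontr)
      assume "coef (\<phi> $$ (k, l)) 0 \<noteq> 0"
      then have "0 \<in> pkeys (\<phi> $$ (k, l))" by (simp add: in_keys_iff)
      moreover have "homogeneous (a i ! l - a' i ! k) (\<phi> $$ (k, l))"
        using \<phi> that(1) ml(2) unfolding graded_mats_def by blast
      ultimately have "a i ! l - a' i ! k = 0" by (auto simp: homogeneous_def)
      then show False using that ml by (simp add: T_def)
    qed
    then have "(\<Sum>k\<in>T. coef (\<psi> $$ (m, k)) 0 * coef (\<phi> $$ (k, l)) 0) =
      (\<Sum>k<length (a' i). coef (\<psi> $$ (m, k)) 0 * coef (\<phi> $$ (k, l)) 0)"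
      by (intro sum.mono_neutral_left) (auto simp: T_def)
    also have "\<dots> = coef ((\<psi> * \<phi>) $$ (m, l)) 0"
      unfolding mult_mat_index [OF c(2,1) ml(1,2)] lookup_0_sum_mult ..
    also have "\<dots> = coef ((1\<^sub>m (length (a i)) :: ('x, 'k) mpoly mat) $$ (m, l)) 0"
      using irr ml c by (auto simp: irrelevant_mat_def lookup_minus)
    also have "\<dots> = (if m = l then 1 else 0)" using ml by auto
    finally show ?thesis .
  qed
  then have "card S \<le> card T"
    by (intro card_le_if_identity_factors [where P = "\<lambda>m k. coef (\<psi> $$ (m, k)) 0"
          and Q = "\<lambda>k l. coef (\<phi> $$ (k, l)) 0"]) (auto simp: S_def T_def)
  then show ?thesis by (simp add: S_def T_def count_list_eq_card)
qed

section \<open>From minimal resolutions of R/I to exact matrices\<close>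

lemma minimal_graded_free_resolutionD:
  assumes "minimal_graded_free_resolution X I a g d"
  shows "\<forall>l<length (a 0). g l \<in> poly_ring X \<and> homogeneous (a 0 ! l) (g l)"
    and "\<forall>i. graded_matrix X (a i) (a (Suc i)) (d (Suc i))"
    and "\<forall>p\<in>poly_ring X. \<exists>u\<in>free_module X (length (a 0)). p - (\<Sum>l<length (a 0). u l * g l) \<in> I"
    and "{u \<in> free_module X (length (a 0)). (\<Sum>l<length (a 0). u l * g l) \<in> I} =
       mat_map (length (a 0)) (length (a 1)) (d 1) ` free_module X (length (a 1))"
    and "\<forall>i\<ge>1. {u \<in> free_module X (length (a i)).
               mat_map (length (a (i - 1))) (length (a i)) (d i) u = (\<lambda>_. 0)} =
       mat_map (length (a i)) (length (a (Suc i))) (d (Suc i)) ` free_module X (length (a (Suc i)))"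
    and "\<forall>i. \<forall>k<length (a i). \<forall>l<length (a (Suc i)). d (Suc i) k l \<in> irrelevant_ideal X"
  using assms unfolding minimal_graded_free_resolution_def graded_free_resolution_def
  by - (elim conjE, assumption)+

definition proper_graded_ideal :: "'x set \<Rightarrow> ('x, 'k::comm_ring_1) mpoly set \<Rightarrow> bool" where
  "proper_graded_ideal X I \<longleftrightarrow> I \<subseteq> poly_ring X \<and> (\<forall>p\<in>I. \<forall>q\<in>I. p - q \<in> I) \<and>
     (\<forall>r\<in>poly_ring X. \<forall>p\<in>I. r * p \<in> I) \<and> (\<forall>p\<in>I. \<forall>n. hom_comp n p \<in> I) \<and> 1 \<notin> I"

text \<open>The definition admits any finite generating family of R/I in step 0. As
  \<open>1 \<notin> I\<close>, some generator has a nonzero constant term, and by homogeneity it is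
  a constant. A further generator would be a multiple of it, and that relation has a coefficient 1,
  against minimality.\<close>

lemma graded_resolution_unit_start:
  fixes g :: "nat \<Rightarrow> ('x, 'k::field) mpoly"
  assumes res: "minimal_graded_free_resolution X I a g d"
    and I: "proper_graded_ideal X I"
  shows "a 0 = [0] \<and> (\<exists>c. c \<noteq> 0 \<and> g 0 = monom_of 0 c)"
proof -
  have diffI: "p \<in> I \<Longrightarrow> q \<in> I \<Longrightarrow> p - q \<in> I" and homI: "p \<in> I \<Longrightarrow> hom_comp n p \<in> I"
    and oneI: "1 \<notin> I" for p q n
    using I by (auto simp: proper_graded_ideal_def)
  have g: "\<And>l. l < length (a 0) \<Longrightarrow> g l \<in> poly_ring X \<and> homogeneous (a 0 ! l) (g l)"
    and surj: "\<And>p. p \<in> poly_ring X \<Longrightarrow> \<exists>u\<in>free_module X (length (a 0)). p - (\<Sum>l<length (a 0). u l * g l) \<in> I"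
    and ex0: "{u \<in> free_module X (length (a 0)). (\<Sum>l<length (a 0). u l * g l) \<in> I} =
       mat_map (length (a 0)) (length (a 1)) (d 1) ` free_module X (length (a 1))"
    and min: "\<And>i k l. k < length (a i) \<Longrightarrow> l < length (a (Suc i)) \<Longrightarrow> d (Suc i) k l \<in> irrelevant_ideal X"
    using minimal_graded_free_resolutionD [OF res, rule_format] by simp_all
  obtain u where u: "1 - (\<Sum>l<length (a 0). u l * g l) \<in> I" using surj [of 1] by auto
  then have zeroI: "0 \<in> I" using diffI by force
  have "\<exists>l<length (a 0). coef (g l) 0 \<noteq> 0"
  proof (rule ccontr)
    assume no: "\<not> ?thesis"
    have "hom_comp 0 (u l * g l) = 0" if "l < length (a 0)" for l
    proof -
      have "coef (u l * g l) 0 = 0" using no that by (simp add: lookup_0_mult)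
      then show ?thesis
        by (auto simp: hom_comp_def restrict_monoms_eq_0_iff mono_degree_eq_0_iff in_keys_iff)
    qed
    moreover have "hom_comp 0 (1 - (\<Sum>l<length (a 0). u l * g l)) =
        1 - (\<Sum>l<length (a 0). hom_comp 0 (u l * g l))"
      using hom_comp_homogeneous [OF homogeneous_1]
      by (simp add: hom_comp_def restrict_monoms_diff restrict_monoms_sum)
    ultimately show False using homI [OF u, of 0] oneI by simp
  qed
  then obtain l where l: "l < length (a 0)" "coef (g l) 0 \<noteq> 0" by blast
  then have "0 \<in> pkeys (g l)" by (simp add: in_keys_iff)
  then have al: "a 0 ! l = 0" using g [OF l(1)] by (auto simp: homogeneous_def)
  define c where "c = coef (g l) 0"
  have gl: "g l = monom_of 0 c"
  proof (rule poly_mapping_eqI)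
    fix m show "coef (g l) m = coef (monom_of 0 c) m"
      using g [OF l(1)] al
      by (cases "m = 0") (auto simp: c_def lookup_single when_def homogeneous_def mono_degree_eq_0_iff in_keys_iff)
  qed
  have "k = l" if k: "k < length (a 0)" for k
  proof (rule ccontr)
    assume "k \<noteq> l"
    \<comment> \<open>The coefficients of the relation that expresses \<open>g k\<close> through the
      constant \<open>g l\<close>.\<close>
    define v where "v j = (if j = k then 1 else if j = l then - (g k * monom_of 0 (inverse c)) else 0)" for j
    have "(\<Sum>j<length (a 0). v j * g j) = (\<Sum>j\<in>{k, l}. v j * g j)"
      using k l by (intro sum.mono_neutral_right) (auto simp: v_def)
    also have "\<dots> = g k - g k * (monom_of 0 (inverse c) * monom_of 0 c)"
      using \<open>k \<noteq> l\<close> by (simp add: v_def gl mult.assoc)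
    also have "\<dots> = 0" using l(2) by (simp add: mult_single c_def)
    finally have "(\<Sum>j<length (a 0). v j * g j) \<in> I" using zeroI by simp
    moreover have "v \<in> free_module X (length (a 0))"
      using k l g by (auto simp: free_module_def v_def poly_ring_def [of X, symmetric]
          intro!: poly_ring_uminus poly_ring_mult) (auto simp: poly_ring_def)
    ultimately obtain w where w: "v = mat_map (length (a 0)) (length (a 1)) (d 1) w"
      using ex0 by blast
    have "coef (v k) 0 = 0"
      unfolding w using k min [of k 0]
      by (auto simp: mat_map_def lookup_0_sum_mult irrelevant_ideal_def intro!: sum.neutral)
    then show False by (simp add: v_def)
  qed
  then have "l = 0" "length (a 0) = 1" using l(1)
    by (metis gr_implies_not0 neq0_conv, metis One_nat_def Suc_lessI gr_implies_not0 neq0_conv zero_neq_one)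
  then show ?thesis using al gl l(2) c_def by (auto simp: length_Suc_conv)
qed

text \<open>The index is shifted: \<open>resolution_mat a d i\<close> is the differential \<open>d (Suc i)\<close>.\<close>

definition resolution_mat ::
  "(nat \<Rightarrow> int list) \<Rightarrow> (nat \<Rightarrow> nat \<Rightarrow> nat \<Rightarrow> ('x, 'k::comm_ring_1) mpoly) \<Rightarrow> nat \<Rightarrow> ('x, 'k) mpoly mat" where
  "resolution_mat a d i = mat (length (a i)) (length (a (Suc i))) (\<lambda>(k, l). d (Suc i) k l)"

lemma lift_columns:
  assumes B: "B \<in> carrier_mat p n"
    and v: "\<And>l. l < n \<Longrightarrow> (\<lambda>k. if k < p then B $$ (k, l) else 0) \<in> mat_map p q A ` free_module X q"
  shows "\<exists>C\<in>poly_mats X q n. B = mat p q (\<lambda>(k, l). A k l) * C"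
proof -
  have "\<forall>l. \<exists>u. l < n \<longrightarrow> u \<in> free_module X q \<and> (\<lambda>k. if k < p then B $$ (k, l) else 0) = mat_map p q A u"
    using v by blast
  then obtain u where u: "\<And>l. l < n \<Longrightarrow> u l \<in> free_module X q"
    "\<And>l. l < n \<Longrightarrow> (\<lambda>k. if k < p then B $$ (k, l) else 0) = mat_map p q A (u l)"
    by (rule choice [THEN exE]) blast
  define C where "C = mat q n (\<lambda>(j, l). u l j)"
  have C: "C \<in> poly_mats X q n" using u(1) by (auto simp: C_def poly_mats_def free_module_def)
  have "B = mat p q (\<lambda>(k, l). A k l) * C"
  proof (rule eq_matI)
    fix k l assume "k < dim_row (mat p q (\<lambda>(k, l). A k l) * C)" "l < dim_col (mat p q (\<lambda>(k, l). A k l) * C)"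
    then have kl: "k < p" "l < n" by (auto simp: C_def)
    have "(mat p q (\<lambda>(k, l). A k l) * C) $$ (k, l) = (\<Sum>j<q. A k j * u l j)"
      using kl by (subst mult_mat_index [of _ p q _ n]) (auto simp: C_def)
    then show "B $$ (k, l) = (mat p q (\<lambda>(k, l). A k l) * C) $$ (k, l)"
      using fun_cong [OF u(2) [OF kl(2)], of k] kl(1) by (simp add: mat_map_def)
  qed (use B in \<open>auto simp: C_def\<close>)
  then show ?thesis using C by blast
qed

text \<open>The last two conclusions say that the single row of the first differential has its
  entries in \<open>I\<close> and generates \<open>I\<close>. For two resolutions each first
  differential thus factors through the other, which starts the comparison.\<close>

lemma resolution_minimal_exact_matrices:
  fixes g :: "nat \<Rightarrow> ('x, 'k::field) mpoly"
  assumes res: "minimal_graded_free_resolution X I a g d"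
    and start: "a 0 = [0]" "g 0 = monom_of 0 c" "c \<noteq> 0"
    and I: "proper_graded_ideal X I"
  shows "minimal_exact_matrices X a (resolution_mat a d)"
    and "\<And>l. l < length (a 1) \<Longrightarrow> resolution_mat a d 0 $$ (0, l) \<in> I"
    and "\<And>B n. B \<in> carrier_mat 1 n \<Longrightarrow> (\<And>l. l < n \<Longrightarrow> B $$ (0, l) \<in> I) \<Longrightarrow>
           \<exists>C\<in>poly_mats X (length (a 1)) n. B = resolution_mat a d 0 * C"
proof -
  let ?D = "resolution_mat a d"
  have sub: "I \<subseteq> poly_ring X" and multI: "r \<in> poly_ring X \<Longrightarrow> p \<in> I \<Longrightarrow> r * p \<in> I" for r p
    using I by (auto simp: proper_graded_ideal_def)
  have gr: "\<And>i. graded_matrix X (a i) (a (Suc i)) (d (Suc i))"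
    and ex0: "{u \<in> free_module X (length (a 0)). (\<Sum>l<length (a 0). u l * g l) \<in> I} =
       mat_map (length (a 0)) (length (a 1)) (d 1) ` free_module X (length (a 1))"
    and ex: "\<And>i. i \<ge> 1 \<Longrightarrow> {u \<in> free_module X (length (a i)).
               mat_map (length (a (i - 1))) (length (a i)) (d i) u = (\<lambda>_. 0)} =
       mat_map (length (a i)) (length (a (Suc i))) (d (Suc i)) ` free_module X (length (a (Suc i)))"
    and min: "\<And>i k l. k < length (a i) \<Longrightarrow> l < length (a (Suc i)) \<Longrightarrow> d (Suc i) k l \<in> irrelevant_ideal X"
    using minimal_graded_free_resolutionD [OF res, rule_format] by simp_all
  have gD: "?D i \<in> graded_mats X (a i) (a (Suc i))" for i
    using gr [of i] by (simp add: graded_matrix_def graded_mats_def poly_mats_def resolution_mat_def)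
  note cD = poly_mats_carrier [OF graded_mats_poly [OF gD]]
  \<comment> \<open>Columns are images of unit vectors; this turns statements about images into
    statements about entries.\<close>
  have unit: "(\<lambda>k. if k < q then A k l else 0) \<in> mat_map q n A ` free_module X n"
    if "l < n" for l n q and A :: "nat \<Rightarrow> nat \<Rightarrow> ('x, 'k) mpoly"
  proof
    let ?e = "\<lambda>j. if j = l then 1 else 0 :: ('x, 'k) mpoly"
    show "?e \<in> free_module X n" using that by (auto simp: free_module_def)
    show "(\<lambda>k. if k < q then A k l else 0) = mat_map q n A ?e"
      using that by (auto simp: mat_map_def fun_eq_iff if_distrib [of "(*) _"] cong: if_cong)
  qed
  have cancel: "p \<in> I" if "p * monom_of 0 c \<in> I" for p
  proof -
    have "monom_of 0 (inverse c) * (p * monom_of 0 c) \<in> I"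
      by (rule multI [OF _ that]) (auto simp: poly_ring_def)
    also have "monom_of 0 (inverse c) * (p * monom_of 0 c) = p * (monom_of 0 (inverse c) * monom_of 0 c)"
      by (simp add: mult_ac)
    finally show ?thesis using start(3) by (simp add: mult_single)
  qed
  have ex0': "{u \<in> free_module X 1. u 0 \<in> I} = mat_map 1 (length (a 1)) (d 1) ` free_module X (length (a 1))"
  proof -
    have "u 0 * monom_of 0 c \<in> I \<longleftrightarrow> u 0 \<in> I" for u :: "nat \<Rightarrow> ('x, 'k) mpoly"
      using cancel multI [of "monom_of 0 c" "u 0"] by (auto simp: mult.commute poly_ring_def)
    then show ?thesis using ex0 start by simp
  qed
  show entry: "?D 0 $$ (0, l) \<in> I" if l: "l < length (a 1)" for l
  proof -
    have "(\<lambda>k. if k < 1 then d 1 k l else 0) \<in> {u \<in> free_module X 1. u 0 \<in> I}"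
      unfolding ex0' using unit [OF l] .
    then show ?thesis using l start by (simp add: resolution_mat_def)
  qed
  show "\<exists>C\<in>poly_mats X (length (a 1)) n. B = ?D 0 * C"
    if "B \<in> carrier_mat 1 n" "\<And>l. l < n \<Longrightarrow> B $$ (0, l) \<in> I" for B n
  proof -
    have "\<exists>C\<in>poly_mats X (length (a 1)) n. B = mat 1 (length (a 1)) (\<lambda>(k, l). d 1 k l) * C"
    proof (rule lift_columns [OF that(1)])
      fix l assume "l < n"
      then have "B $$ (0, l) \<in> I" by (rule that(2))
      then show "(\<lambda>k. if k < 1 then B $$ (k, l) else 0) \<in> mat_map 1 (length (a 1)) (d 1) ` free_module X (length (a 1))"
        unfolding ex0' [symmetric] using sub by (auto simp: free_module_def)
    qed
    then show ?thesis using start by (simp add: resolution_mat_def)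
  qed
  show "minimal_exact_matrices X a ?D"
    unfolding minimal_exact_matrices_def
  proof (intro allI conjI ballI impI)
    fix i
    show "?D i \<in> graded_mats X (a i) (a (Suc i))" by (rule gD)
    show "irrelevant_mat (?D i)"
      using min by (auto simp: irrelevant_mat_def resolution_mat_def irrelevant_ideal_def)
    show "?D i * ?D (Suc i) = 0\<^sub>m (length (a i)) (length (a (Suc (Suc i))))"
    proof (rule eq_matI)
      fix k l assume "k < dim_row (0\<^sub>m (length (a i)) (length (a (Suc (Suc i)))) :: ('x, 'k) mpoly mat)"
        "l < dim_col (0\<^sub>m (length (a i)) (length (a (Suc (Suc i)))) :: ('x, 'k) mpoly mat)"
      then have kl: "k < length (a i)" "l < length (a (Suc (Suc i)))" by auto
      let ?u = "\<lambda>j. if j < length (a (Suc i)) then d (Suc (Suc i)) j l else 0"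
      have "?u \<in> {u \<in> free_module X (length (a (Suc i))).
               mat_map (length (a i)) (length (a (Suc i))) (d (Suc i)) u = (\<lambda>_. 0)}"
        using ex [of "Suc i"] unit [OF kl(2), of "length (a (Suc i))" "d (Suc (Suc i))"] by simp
      then have "mat_map (length (a i)) (length (a (Suc i))) (d (Suc i)) ?u k = 0" by simp
      then show "(?D i * ?D (Suc i)) $$ (k, l) = 0\<^sub>m (length (a i)) (length (a (Suc (Suc i)))) $$ (k, l)"
        using kl by (subst mult_mat_index [OF cD cD kl]) (simp add: mat_map_def resolution_mat_def)
    qed (auto simp: resolution_mat_def)
    fix n and B :: "('x, 'k) mpoly mat"
    assume B: "B \<in> poly_mats X (length (a (Suc i))) n" and DB: "?D i * B = 0\<^sub>m (length (a i)) n"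
    show "\<exists>C\<in>poly_mats X (length (a (Suc (Suc i)))) n. B = ?D (Suc i) * C"
      unfolding resolution_mat_def
    proof (rule lift_columns)
      show "B \<in> carrier_mat (length (a (Suc i))) n" using B by (rule poly_mats_carrier)
      fix l assume l: "l < n"
      let ?u = "\<lambda>k. if k < length (a (Suc i)) then B $$ (k, l) else 0"
      have "?u \<in> free_module X (length (a (Suc i)))" using B l by (auto simp: free_module_def poly_mats_def)
      moreover have "mat_map (length (a i)) (length (a (Suc i))) (d (Suc i)) ?u = (\<lambda>_. 0)"
      proof
        fix k show "mat_map (length (a i)) (length (a (Suc i))) (d (Suc i)) ?u k = 0"
      proof (cases "k < length (a i)")
        case True
        have "(?D i * B) $$ (k, l) = 0" using True l by (simp add: DB)
        then show ?thesis
          unfolding mult_mat_index [OF cD poly_mats_carrier [OF B] True l]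
          using True by (simp add: mat_map_def resolution_mat_def)
      qed (simp add: mat_map_def)
      qed
      ultimately have "?u \<in> {u \<in> free_module X (length (a (Suc i))).
          mat_map (length (a (Suc i - 1))) (length (a (Suc i))) (d (Suc i)) u = (\<lambda>_. 0)}"
        unfolding diff_Suc_1 by blast
      then show "?u \<in> mat_map (length (a (Suc i))) (length (a (Suc (Suc i)))) (d (Suc (Suc i))) `
          free_module X (length (a (Suc (Suc i))))"
        by (subst (asm) ex) simp_all
    qed
  qed
qed

theorem minimal_resolution_shifts_unique:
  fixes I :: "('x, 'k::field) mpoly set"
  assumes res: "minimal_graded_free_resolution X I a g d" "minimal_graded_free_resolution X I a' g' d'"
    and I: "proper_graded_ideal X I"
  shows "count_list (a i) j = count_list (a' i) j"
proof (rule antisym)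
  have main: "count_list (a i) j \<le> count_list (a' i) j"
    if res: "minimal_graded_free_resolution X I a g d" "minimal_graded_free_resolution X I a' g' d'" for a g d a' g' d'
  proof -
    obtain c where c: "a 0 = [0]" "g 0 = monom_of 0 c" "c \<noteq> 0"
      using graded_resolution_unit_start [OF res(1) I] by blast
    obtain c' where c': "a' 0 = [0]" "g' 0 = monom_of 0 c'" "c' \<noteq> 0"
      using graded_resolution_unit_start [OF res(2) I] by blast
    note r = resolution_minimal_exact_matrices [OF res(1) c I]
    note r' = resolution_minimal_exact_matrices [OF res(2) c' I]
    show ?thesis
    proof (rule minimal_exact_matrices_count_le [OF r(1) r'(1)])
      show "a' 0 = a 0" using c c' by simp
      show "\<exists>C\<in>poly_mats X (length (a' 1)) (length (a 1)). resolution_mat a d 0 = resolution_mat a' d' 0 * C"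
        by (rule r'(3) [OF _ r(2)]) (simp_all add: c(1) resolution_mat_def)
      show "\<exists>C\<in>poly_mats X (length (a 1)) (length (a' 1)). resolution_mat a' d' 0 = resolution_mat a d 0 * C"
        by (rule r(3) [OF _ r'(2)]) (simp_all add: c'(1) resolution_mat_def)
    qed
  qed
  show "count_list (a i) j \<le> count_list (a' i) j" using main [OF res] .
  show "count_list (a' i) j \<le> count_list (a i) j" using main [OF res(2,1)] .
qed

section \<open>The toric ideal\<close>

definition toric_exp :: "('v set \<Rightarrow>\<^sub>0 nat) \<Rightarrow> 'v \<Rightarrow>\<^sub>0 nat" where
  "toric_exp m = (\<Sum>e\<in>pkeys m. \<Sum>x\<in>e. monom_of x (coef m e))"

lemma toric_exp_superset:
  "finite A \<Longrightarrow> pkeys m \<subseteq> A \<Longrightarrow> toric_exp m = (\<Sum>e\<in>A. \<Sum>x\<in>e. monom_of x (coef m e))"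
  unfolding toric_exp_def by (rule sum.mono_neutral_left) (auto simp: in_keys_iff)

lemma toric_exp_add: "toric_exp (m + n) = toric_exp m + toric_exp n"
  using toric_exp_superset [of "pkeys m \<union> pkeys n" m] toric_exp_superset [of "pkeys m \<union> pkeys n" n]
    toric_exp_superset [of "pkeys m \<union> pkeys n" "m + n"]
  by (simp add: keys_add_nat lookup_add sum.distrib single_add)

lemma toric_exp_0 [simp]: "toric_exp 0 = 0"
  by (simp add: toric_exp_def)

lemma prod_monom_of_1:
  "(\<Prod>x\<in>A. monom_of (f x) (1::'k::comm_ring_1)) = monom_of (\<Sum>x\<in>A. f x :: 'x \<Rightarrow>\<^sub>0 nat) 1"
  by (induction A rule: infinite_finite_induct) (auto simp: mult_single)

lemma monom_of_power: "monom_of m (1::'k::comm_ring_1) ^ n = monom_of (\<Sum>i<n. m :: 'x \<Rightarrow>\<^sub>0 nat) 1"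
  by (induction n) (auto simp: mult_single add.commute)

lemma toric_map_eq: "toric_map p = (\<Sum>m\<in>pkeys p. monom_of (toric_exp m) (coef p m))"
proof -
  have "(\<Sum>i<n. monom_of x (1::nat)) = monom_of x n" for n and x :: 'a
    by (induction n) (auto simp: single_add [symmetric])
  then have "(\<Sum>i<n. \<Sum>x\<in>e. monom_of x (1::nat)) = (\<Sum>x\<in>e. monom_of x n)" for n and e :: "'a set"
    by (subst sum.swap) simp
  then have "(\<Prod>x\<in>e. var x) ^ n = monom_of (\<Sum>x\<in>e. monom_of x n) (1::'b)" for e :: "'a set" and n
    by (simp add: prod_power_distrib [symmetric] var_def monom_of_power prod_monom_of_1)
  then show ?thesis
    by (simp add: toric_map_def const_def prod_monom_of_1 mult_single toric_exp_def)
qed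

lemma toric_map_superset:
  "finite A \<Longrightarrow> pkeys p \<subseteq> A \<Longrightarrow> toric_map p = (\<Sum>m\<in>A. monom_of (toric_exp m) (coef p m))"
  unfolding toric_map_eq by (rule sum.mono_neutral_left) (auto simp: in_keys_iff)

lemma toric_map_add: "toric_map (p + q) = toric_map p + toric_map q"
  using toric_map_superset [of "pkeys p \<union> pkeys q" p] toric_map_superset [of "pkeys p \<union> pkeys q" q]
    toric_map_superset [of "pkeys p \<union> pkeys q" "p + q"] keys_add [of p q]
  by (simp add: lookup_add sum.distrib single_add)

lemma toric_map_0 [simp]: "toric_map 0 = 0"
  by (simp add: toric_map_eq)

lemma toric_map_diff: "toric_map (p - q) = toric_map p - toric_map q"
  using toric_map_add [of "p - q" q] by simp

lemma toric_map_sum: "toric_map (sum f A) = (\<Sum>a\<in>A. toric_map (f a))"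
  by (induction A rule: infinite_finite_induct) (auto simp: toric_map_add)

lemma toric_map_monom: "toric_map (monom_of m c) = monom_of (toric_exp m) c"
  by (cases "c = 0") (auto simp: toric_map_eq)

lemma toric_map_1: "toric_map 1 = 1"
  using toric_map_monom [of 0 1] by simp

lemma toric_map_mult: "toric_map (p * q) = toric_map p * toric_map q"
proof -
  have "p * q = (\<Sum>m\<in>pkeys p. monom_of m (coef p m)) * (\<Sum>n\<in>pkeys q. monom_of n (coef q n))"
    by (simp add: poly_mapping_sum_single)
  then show ?thesis
    by (simp add: sum_product toric_map_sum mult_single toric_map_monom toric_exp_add toric_map_eq [of p] toric_map_eq [of q])
qed

lemma restrict_monoms_monom_of: "restrict_monoms P (monom_of m c) = (if P m then monom_of m c else 0)"
  by (rule poly_mapping_eqI) (simp add: lookup_restrict_monoms lookup_single when_def)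

text \<open>Every edge has two ends, so the toric map doubles degrees. This is why the toric ideal
  is graded.\<close>

lemma hom_comp_toric_map:
  assumes p: "p \<in> poly_ring E" and E: "\<And>e. e \<in> E \<Longrightarrow> card e = 2"
  shows "hom_comp (2 * n) (toric_map p) = toric_map (hom_comp n p)"
proof -
  have deg: "mono_degree (toric_exp m) = 2 * mono_degree m" if "pkeys m \<subseteq> E" for m
  proof -
    have "mono_degree (toric_exp m) = (\<Sum>e\<in>pkeys m. \<Sum>x\<in>e. coef m e)"
      by (simp add: toric_exp_def mono_degree_sum mono_degree_single)
    also have "\<dots> = (\<Sum>e\<in>pkeys m. 2 * coef m e)"
      using that E by (intro sum.cong) auto
    finally show ?thesis by (simp add: mono_degree_def sum_distrib_left)
  qed
  have "hom_comp (2 * n) (toric_map p) = (\<Sum>m\<in>pkeys p. if int (mono_degree m) = n then monom_of (toric_exp m) (coef p m) else 0)"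
    unfolding toric_map_eq hom_comp_def restrict_monoms_sum restrict_monoms_monom_of
    using p deg by (intro sum.cong) (auto simp: poly_ring_def)
  also have "\<dots> = (\<Sum>m\<in>pkeys (hom_comp n p). monom_of (toric_exp m) (coef p m))"
    by (auto simp: hom_comp_def keys_restrict_monoms sum.inter_filter)
  also have "\<dots> = toric_map (hom_comp n p)"
    unfolding toric_map_eq by (intro sum.cong) (auto simp: hom_comp_def keys_restrict_monoms lookup_restrict_monoms)
  finally show ?thesis .
qed

text \<open>If the image of \<open>p\<close> is zero, each monomial \<open>m\<close> of
  \<open>p\<close> shares its image with another monomial of \<open>p\<close>, as its coefficient
  would survive otherwise. Subtracting a multiple of their difference removes \<open>m\<close> and
  brings in no new monomial.\<close>

lemma toric_ideal_induct_binomials: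
  assumes p: "p \<in> poly_ring E" "toric_map p = 0"
    and J0: "0 \<in> J" and Jadd: "\<And>p q. p \<in> J \<Longrightarrow> q \<in> J \<Longrightarrow> p + q \<in> J"
    and bin: "\<And>m m' c. pkeys m \<subseteq> E \<Longrightarrow> pkeys m' \<subseteq> E \<Longrightarrow> toric_exp m = toric_exp m' \<Longrightarrow>
       monom_of m c - monom_of m' c \<in> J"
  shows "p \<in> J"
  using p
proof (induction "card (pkeys p)" arbitrary: p rule: less_induct)
  case less
  show ?case
  proof (cases "p = 0")
    case False
    then obtain m where m: "m \<in> pkeys p" by (metis all_not_in_conv in_keys_iff lookup_zero poly_mapping_eqI)
    have "\<exists>m'\<in>pkeys p. m' \<noteq> m \<and> toric_exp m' = toric_exp m"
    proof (rule ccontr)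
      assume no: "\<not> ?thesis"
      have "coef (toric_map p) (toric_exp m) = (\<Sum>m'\<in>pkeys p. if m' = m then coef p m else 0)"
        unfolding toric_map_eq lookup_sum lookup_single using no by (intro sum.cong) (auto simp: when_def)
      then show False using m less.prems by (simp add: in_keys_iff)
    qed
    then obtain m' where m': "m' \<in> pkeys p" "m' \<noteq> m" "toric_exp m = toric_exp m'" by metis
    define b where "b = monom_of m (coef p m) - monom_of m' (coef p m)"
    have "coef (p - b) x = (if x = m then 0 else if x = m' then coef p m' + coef p m else coef p x)" for x
      using m' by (simp add: b_def lookup_minus lookup_single when_def)
    then have sub: "pkeys (p - b) \<subseteq> pkeys p - {m}" using m' by (auto simp: in_keys_iff split: if_splits)
    then have "card (pkeys (p - b)) < card (pkeys p)"
      using m by (metis card_Diff1_less card_mono finite_Diff finite_keys le_less_trans)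
    moreover have "p - b \<in> poly_ring E" using sub less.prems(1) by (auto simp: poly_ring_def)
    moreover have "toric_map (p - b) = 0"
      by (simp add: less.prems b_def toric_map_diff toric_map_monom m'(3))
    ultimately have "p - b \<in> J" using less.hyps by blast
    moreover have "b \<in> J" unfolding b_def using m m' less.prems(1) by (intro bin) (auto simp: poly_ring_def)
    ultimately show ?thesis using Jadd [of "p - b" b] by simp
  qed (simp add: J0)
qed

section \<open>Edges of the cycles and monomials with equal image\<close>

locale odd_cycles =
  fixes s :: nat and t :: "nat \<Rightarrow> nat"
  assumes t_pos: "\<And>i. i \<in> {1..s} \<Longrightarrow> t i \<ge> 1"
begin

abbreviation "N \<equiv> {1..s}"
abbreviation "E \<equiv> edges (odd_cycles_graph s t)"
abbreviation "c \<equiv> cycle_edge t"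
abbreviation "L i \<equiv> {1..2 * t i + 1}"

lemma E_eq: "E = (\<lambda>(i, j). c i j) ` (SIGMA i:N. L i)"
proof (rule Set.set_eqI)
  fix e
  have "e \<in> E \<longleftrightarrow> (\<exists>i\<in>N. \<exists>j\<in>L i. e = c i j)" unfolding odd_cycles_graph_def snd_conv by blast
  moreover have "e \<in> (\<lambda>(i, j). c i j) ` (SIGMA i:N. L i) \<longleftrightarrow> (\<exists>i\<in>N. \<exists>j\<in>L i. e = c i j)" by fast
  ultimately show "e \<in> E \<longleftrightarrow> e \<in> (\<lambda>(i, j). c i j) ` (SIGMA i:N. L i)" by simp
qed

lemma c_in_E: "i \<in> N \<Longrightarrow> j \<in> L i \<Longrightarrow> c i j \<in> E"
  by (auto simp: E_eq)

lemma finite_E: "finite E"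
  unfolding E_eq by (intro finite_imageI finite_SigmaI) auto

lemma card_E: "e \<in> E \<Longrightarrow> card e = 2"
  using finite_simple_graph_odd_cycles_graph [of s t] t_pos by (auto simp: finite_simple_graph_def)

lemma Outer_in_c_iff:
  assumes "i' \<in> N" "j' \<in> L i'" "1 \<le> j" "j \<le> 2 * t i"
  shows "Outer i j \<in> c i' j' \<longleftrightarrow> i' = i \<and> (j' = j \<or> j' = Suc j)"
  using assms t_pos [of i'] by (auto simp: cycle_edge_def)

lemma Center_in_c_iff:
  assumes "i' \<in> N" "j' \<in> L i'"
  shows "Center \<in> c i' j' \<longleftrightarrow> j' = 1 \<or> j' = 2 * t i' + 1"
  using assms t_pos [of i'] by (auto simp: cycle_edge_def)

lemma c_eq_iff:
  assumes "i \<in> N" "j \<in> L i" "i' \<in> N" "j' \<in> L i'"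
  shows "c i j = c i' j' \<longleftrightarrow> i = i' \<and> j = j'"
  using assms t_pos [of i] t_pos [of i'] by (auto simp: cycle_edge_def doubleton_eq_iff split: if_splits)

lemma inj_c: "inj_on (\<lambda>(i, j). c i j) (SIGMA i:N. L i)"
  by (intro inj_onI) (auto simp: c_eq_iff)

lemma sum_E: "(\<Sum>e\<in>E. f e) = (\<Sum>i\<in>N. \<Sum>j\<in>L i. f (c i j))"
  unfolding E_eq sum.reindex [OF inj_c] by (subst sum.Sigma) (auto simp: case_prod_unfold)

lemma lookup_toric_exp:
  assumes "pkeys m \<subseteq> E"
  shows "coef (toric_exp m) v = (\<Sum>i\<in>N. \<Sum>j\<in>L i. if v \<in> c i j then coef m (c i j) else 0)"
proof -
  have "finite e" if "e \<in> E" for e using card_E [OF that] by (metis card.infinite zero_neq_numeral)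
  then have "(\<Sum>x\<in>e. coef m e when x = v) = (if v \<in> e then coef m e else 0)" if "e \<in> E" for e
    using that by (simp add: when_def)
  then show ?thesis
    unfolding toric_exp_superset [OF finite_E assms] lookup_sum lookup_single sum_E
    by (intro sum.cong refl) (simp only: c_in_E)
qed

lemma lookup_toric_exp_Outer:
  assumes m: "pkeys m \<subseteq> E" and ij: "i \<in> N" "1 \<le> j" "j \<le> 2 * t i"
  shows "coef (toric_exp m) (Outer i j) = coef m (c i j) + coef m (c i (Suc j))"
proof -
  have "coef (toric_exp m) (Outer i j) = (\<Sum>i'\<in>N. if i' = i then \<Sum>j'\<in>L i. if j' = j \<or> j' = Suc j then coef m (c i j') else 0 else 0)"
    unfolding lookup_toric_exp [OF m] using ij by (intro sum.cong) (auto simp: Outer_in_c_iff intro!: sum.cong sum.neutral)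
  also have "\<dots> = (\<Sum>j'\<in>L i. if j' = j \<or> j' = Suc j then coef m (c i j') else 0)"
    using ij by simp
  also have "\<dots> = (\<Sum>j'\<in>{j, Suc j}. coef m (c i j'))"
    using ij by (intro sum.mono_neutral_cong_right) auto
  finally show ?thesis by simp
qed

lemma lookup_toric_exp_Center:
  assumes m: "pkeys m \<subseteq> E"
  shows "coef (toric_exp m) Center = (\<Sum>i\<in>N. coef m (c i 1) + coef m (c i (2 * t i + 1)))"
  unfolding lookup_toric_exp [OF m]
proof (intro sum.cong refl)
  fix i assume i: "i \<in> N"
  have "(\<Sum>j\<in>L i. if Center \<in> c i j then coef m (c i j) else 0) = (\<Sum>j\<in>{1, 2 * t i + 1}. coef m (c i j))"
    using i t_pos [OF i] by (intro sum.mono_neutral_cong_right) (auto simp: Center_in_c_iff split: if_splits)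
  then show "(\<Sum>j\<in>L i. if Center \<in> c i j then coef m (c i j) else 0) = coef m (c i 1) + coef m (c i (2 * t i + 1))"
    using t_pos [OF i] by simp
qed

definition A_exp :: "nat \<Rightarrow> vertex set \<Rightarrow>\<^sub>0 nat" where
  "A_exp i = (\<Sum>l<t i + 1. monom_of (c i (2 * l + 1)) 1)"

definition B_exp :: "nat \<Rightarrow> vertex set \<Rightarrow>\<^sub>0 nat" where
  "B_exp i = (\<Sum>l<t i. monom_of (c i (2 * l + 2)) 1)"

lemma mono_degree_A_exp: "mono_degree (A_exp i) = t i + 1"
  unfolding A_exp_def mono_degree_sum mono_degree_single by simp

lemma mono_degree_B_exp: "mono_degree (B_exp i) = t i"
  unfolding B_exp_def mono_degree_sum mono_degree_single by simp

lemma keys_A_exp: "pkeys (A_exp i) \<subseteq> (\<lambda>l. c i (2 * l + 1)) ` {..<t i + 1}"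
  unfolding A_exp_def using keys_sum [of "\<lambda>l. monom_of (c i (2 * l + 1)) (1::nat)" "{..<t i + 1}"] by auto

lemma keys_B_exp: "pkeys (B_exp i) \<subseteq> (\<lambda>l. c i (2 * l + 2)) ` {..<t i}"
  unfolding B_exp_def using keys_sum [of "\<lambda>l. monom_of (c i (2 * l + 2)) (1::nat)" "{..<t i}"] by auto

lemma keys_AB_subset:
  assumes "i \<in> N" shows "pkeys (A_exp i) \<subseteq> c i ` L i" "pkeys (B_exp i) \<subseteq> c i ` L i"
  using keys_A_exp [of i] keys_B_exp [of i] by force+

lemma keys_AB_E:
  assumes "i \<in> N" shows "pkeys (A_exp i) \<subseteq> E" "pkeys (B_exp i) \<subseteq> E"
  using keys_AB_subset [OF assms] c_in_E [OF assms] by blast+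

lemma lookup_A_exp:
  assumes "i \<in> N" "i' \<in> N" "j \<in> L i'"
  shows "coef (A_exp i) (c i' j) = (if i = i' \<and> odd j then 1 else 0)"
proof -
  have "coef (A_exp i) (c i' j) = (\<Sum>l<t i + 1. if i = i' \<and> j = 2 * l + 1 then 1 else 0)"
    unfolding A_exp_def lookup_sum lookup_single when_def
    using assms by (intro sum.cong refl) (subst c_eq_iff, auto)
  also have "\<dots> = (\<Sum>l<t i + 1. if l = j div 2 then (if i = i' \<and> odd j then 1 else 0) else 0)"
    by (intro sum.cong) (auto elim!: oddE)
  also have "\<dots> = (if i = i' \<and> odd j then 1 else 0)"
    using assms by (auto simp: sum.delta)
  finally show ?thesis .
qed

lemma lookup_B_exp:
  assumes "i \<in> N" "i' \<in> N" "j \<in> L i'"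
  shows "coef (B_exp i) (c i' j) = (if i = i' \<and> even j then 1 else 0)"
proof -
  have "coef (B_exp i) (c i' j) = (\<Sum>l<t i. if i = i' \<and> j = 2 * l + 2 then 1 else 0)"
    unfolding B_exp_def lookup_sum lookup_single when_def
    using assms by (intro sum.cong refl) (subst c_eq_iff, auto)
  also have "\<dots> = (\<Sum>l<t i. if l = j div 2 - 1 then (if i = i' \<and> even j then 1 else 0) else 0)"
    using assms by (intro sum.cong) (auto elim!: evenE)
  also have "\<dots> = (if i = i' \<and> even j then 1 else 0)"
    using assms by (auto simp: sum.delta elim!: evenE)
  finally show ?thesis .
qed

lemma exp_eqI:
  assumes "pkeys m \<subseteq> E" "pkeys m' \<subseteq> E" "\<And>i j. i \<in> N \<Longrightarrow> j \<in> L i \<Longrightarrow> coef m (c i j) = coef m' (c i j)"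
  shows "m = m'"
proof (rule poly_mapping_eqI)
  fix e show "coef m e = coef m' e"
  proof (cases "e \<in> E")
    case True
    then show ?thesis using assms(3) by (auto simp: E_eq)
  next
    case False
    then have "e \<notin> pkeys m" "e \<notin> pkeys m'" using assms(1,2) by auto
    then show ?thesis by (simp add: in_keys_iff)
  qed
qed

text \<open>The vertex exponents of a cycle determine its edge exponents up to adding an alternating
  sequence \<open>\<plusminus>\<delta>\<close>, and the center forces these \<open>\<delta>\<close> to cancel.\<close>

lemma toric_exp_eq_alternating:
  assumes m: "pkeys m \<subseteq> E" "pkeys m' \<subseteq> E" and eq: "toric_exp m = toric_exp m'"
    and i: "i \<in> N" and j: "j \<in> L i"
  shows "int (coef m' (c i j)) - int (coef m (c i j)) =
    (if odd j then 1 else -1) * (int (coef m' (c i 1)) - int (coef m (c i 1)))"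
proof -
  have "1 \<le> j" "j \<le> 2 * t i + 1" using j by auto
  then show ?thesis
  proof (induction j rule: dec_induct)
    case (step j)
    have "coef m (c i j) + coef m (c i (Suc j)) = coef m' (c i j) + coef m' (c i (Suc j))"
      using lookup_toric_exp_Outer [OF m(1) i, of j] lookup_toric_exp_Outer [OF m(2) i, of j] step eq by simp
    then show ?case using step by (auto split: if_splits)
  qed simp
qed

lemma toric_exp_eq_balanced:
  assumes m: "pkeys m \<subseteq> E" "pkeys m' \<subseteq> E" and eq: "toric_exp m = toric_exp m'"
  shows "(\<Sum>i\<in>N. int (coef m' (c i 1)) - int (coef m (c i 1))) = 0"
proof -
  \<comment> \<open>The last edge has the odd number \<open>2 * t i + 1\<close>, so both edges at
    the center change by the same amount; hence the factor 2.\<close>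
  have "2 * (int (coef m' (c i 1)) - int (coef m (c i 1))) =
     int (coef m' (c i 1) + coef m' (c i (2 * t i + 1))) - int (coef m (c i 1) + coef m (c i (2 * t i + 1)))"
    if "i \<in> N" for i
    using toric_exp_eq_alternating [OF m eq that, of "2 * t i + 1"] by simp
  then have "2 * (\<Sum>i\<in>N. int (coef m' (c i 1)) - int (coef m (c i 1))) =
     (\<Sum>i\<in>N. int (coef m' (c i 1) + coef m' (c i (2 * t i + 1))) - int (coef m (c i 1) + coef m (c i (2 * t i + 1))))"
    unfolding sum_distrib_left by (intro sum.cong) auto
  also have "\<dots> = int (coef (toric_exp m') Center) - int (coef (toric_exp m) Center)"
    unfolding lookup_toric_exp_Center [OF m(1)] lookup_toric_exp_Center [OF m(2)] by (simp add: sum_subtractf)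
  finally show ?thesis using eq by simp
qed

text \<open>The differences \<open>\<delta>\<close> sum to 0 and do not all vanish, so both signs
  occur. On the way from \<open>m\<close> to \<open>m'\<close> the even edges of a cycle with
  \<open>\<delta> i > 0\<close> and the odd edges of a cycle with \<open>\<delta> j < 0\<close> lose
  exponents, so all of these edges occur in \<open>m\<close>.\<close>

lemma toric_exp_eq_swap:
  assumes m: "pkeys m \<subseteq> E" "pkeys m' \<subseteq> E" and eq: "toric_exp m = toric_exp m'" and ne: "m \<noteq> m'"
  obtains i j n where "i \<in> N" "j \<in> N" "coef m (c i 1) < coef m' (c i 1)" "coef m' (c j 1) < coef m (c j 1)"
    "m = n + B_exp i + A_exp j"
proof -
  define \<delta> where "\<delta> i = int (coef m' (c i 1)) - int (coef m (c i 1))" for i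
  have alt: "int (coef m' (c i j)) - int (coef m (c i j)) = (if odd j then 1 else -1) * \<delta> i"
    if "i \<in> N" "j \<in> L i" for i j
    using toric_exp_eq_alternating [OF m eq that] by (simp add: \<delta>_def)
  have sum0: "(\<Sum>i\<in>N. \<delta> i) = 0" using toric_exp_eq_balanced [OF m eq] by (simp add: \<delta>_def)
  have "\<exists>i\<in>N. \<delta> i \<noteq> 0"
  proof (rule ccontr)
    assume "\<not> ?thesis"
    then have "coef m (c i j) = coef m' (c i j)" if "i \<in> N" "j \<in> L i" for i j
      using alt [OF that] that by simp
    then show False using exp_eqI [OF m] ne by blast
  qed
  then obtain i0 where i0: "i0 \<in> N" "\<delta> i0 \<noteq> 0" by blast
  have "\<exists>i\<in>N. \<delta> i > 0"
  proof (rule ccontr)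
    assume "\<not> ?thesis"
    then have "\<And>i. i \<in> N \<Longrightarrow> \<delta> i \<le> 0" by force
    then have "\<delta> i0 = 0" using sum_nonneg_eq_0_iff [of N "\<lambda>i. - \<delta> i"] sum0 i0 by (simp add: sum_negf)
    then show False using i0 by simp
  qed
  then obtain i where i: "i \<in> N" "\<delta> i > 0" by blast
  have "\<exists>i\<in>N. \<delta> i < 0"
  proof (rule ccontr)
    assume "\<not> ?thesis"
    then have "\<And>i. i \<in> N \<Longrightarrow> \<delta> i \<ge> 0" by force
    then have "\<delta> i0 = 0" using sum_nonneg_eq_0_iff [of N \<delta>] sum0 i0 by simp
    then show False using i0 by simp
  qed
  then obtain j where j: "j \<in> N" "\<delta> j < 0" by blast
  have ij: "i \<noteq> j" using i j by auto
  define n where "n = m - (B_exp i + A_exp j)"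
  have le: "coef (B_exp i + A_exp j) (c k l) \<le> coef m (c k l)" if "k \<in> N" "l \<in> L k" for k l
    using alt [OF that] i j ij that
    by (auto simp: lookup_add lookup_A_exp lookup_B_exp)
  have "m = n + (B_exp i + A_exp j)"
  proof (rule exp_eqI)
    show "pkeys m \<subseteq> E" by (rule m)
    have "pkeys n \<subseteq> pkeys m" by (auto simp: n_def in_keys_iff lookup_minus)
    then show "pkeys (n + (B_exp i + A_exp j)) \<subseteq> E"
      using m(1) keys_AB_E [OF i(1)] keys_AB_E [OF j(1)] by (auto simp: keys_add_nat)
  next
    fix k l assume "k \<in> N" "l \<in> L k"
    then show "coef m (c k l) = coef (n + (B_exp i + A_exp j)) (c k l)"
      using le by (simp add: n_def lookup_add [of "m - _"] lookup_minus)
  qed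
  then show ?thesis using that [of i j n] i j by (simp add: \<delta>_def add.assoc)
qed

end

text \<open>This supplies the matrix of a differential that is given as an operator on families: its
  entries are the values on unit vectors.\<close>

lemma linear_functional_expand:
  fixes F :: "('q \<Rightarrow> 'a::comm_ring_1) \<Rightarrow> 'a"
  assumes fin: "finite Q"
    and add: "\<And>v w. F (\<lambda>q. v q + w q) = F v + F w"
    and scale: "\<And>c w. F (\<lambda>q. c * w q) = c * F w"
    and local: "\<And>v w. (\<And>q. q \<in> Q \<Longrightarrow> v q = w q) \<Longrightarrow> F v = F w"
  shows "F w = (\<Sum>r\<in>Q. F (\<lambda>q. if q = r then 1 else 0) * w r)"
proof -
  have zero: "F (\<lambda>_. 0) = 0" using scale [of 0 "\<lambda>_. 0"] by simp
  have "F (\<lambda>q. \<Sum>r\<in>R. w r * (if q = r then 1 else 0)) = (\<Sum>r\<in>R. F (\<lambda>q. if q = r then 1 else 0) * w r)"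
    if "finite R" for R
    using that
  proof (induction R rule: finite_induct)
    case (insert r R)
    have "F (\<lambda>q. \<Sum>r\<in>insert r R. w r * (if q = r then 1 else 0)) =
      F (\<lambda>q. w r * (if q = r then 1 else 0) + (\<Sum>r\<in>R. w r * (if q = r then 1 else 0)))"
      by (rule arg_cong [of _ _ F], rule ext, rule sum.insert) (use insert.hyps in auto)
    also have "\<dots> = w r * F (\<lambda>q. if q = r then 1 else 0) + (\<Sum>r\<in>R. F (\<lambda>q. if q = r then 1 else 0) * w r)"
      unfolding add scale insert.IH ..
    finally show ?case using insert.hyps by (simp add: mult.commute)
  qed (simp add: zero)
  note this [OF fin, symmetric]
  also have "F (\<lambda>q. \<Sum>r\<in>Q. w r * (if q = r then 1 else 0)) = F w"
    using fin by (intro local) (simp add: if_distrib [of "(*) _"] cong: if_cong)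
  finally show ?thesis by simp
qed

lemma kdiff_poly_ring:
  assumes "\<And>k. k \<in> N \<Longrightarrow> f k \<in> poly_ring X" "\<And>k. k \<in> N - T \<Longrightarrow> w (insert k T) \<in> poly_ring X"
  shows "(kdiff N f w T :: ('x, 'k::comm_ring_1) mpoly) \<in> poly_ring X"
proof -
  have "(ksgn k T :: ('x, 'k) mpoly) \<in> poly_ring X" for k :: 'a and T
    by (cases "even (card {j \<in> T. j < k})") (auto simp: ksgn_def poly_ring_uminus)
  then show ?thesis unfolding kdiff_def using assms by (auto intro!: poly_ring_sum poly_ring_mult)
qed

lemma kdiff_homogeneous:
  assumes "\<And>k. k \<in> N - T \<Longrightarrow> homogeneous n (f k * w (insert k T))"
  shows "homogeneous n (kdiff N f w T :: ('x, 'k::comm_ring_1) mpoly)"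
proof -
  have "homogeneous n (ksgn k T * f k * w (insert k T) :: ('x, 'k) mpoly)" if "k \<in> N - T" for k
    using assms [OF that] homogeneous_uminus [OF assms [OF that]]
    by (cases "even (card {j \<in> T. j < k})") (auto simp: ksgn_def)
  then show ?thesis unfolding kdiff_def by (rule homogeneous_sum)
qed

lemma kdiff_lookup_0:
  assumes "\<And>k. k \<in> N \<Longrightarrow> coef (f k) 0 = 0"
  shows "coef (kdiff N f w T :: ('x, 'k::comm_ring_1) mpoly) 0 = 0"
  unfolding kdiff_def lookup_0_sum_mult lookup_0_mult using assms by (auto intro!: sum.neutral)

section \<open>The two rows and the ideal of their minors\<close>

context odd_cycles
begin

definition A_poly :: "nat \<Rightarrow> (vertex set, 'k::field) mpoly" where
  "A_poly i = monom_of (A_exp i) 1"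

definition B_poly :: "nat \<Rightarrow> (vertex set, 'k::field) mpoly" where
  "B_poly i = monom_of (B_exp i) 1"

lemma AB_poly_ring:
  assumes "i \<in> N" shows "A_poly i \<in> poly_ring E" "B_poly i \<in> poly_ring E"
  using keys_AB_E [OF assms] by (auto simp: A_poly_def B_poly_def poly_ring_def)

lemma AB_homogeneous:
  "homogeneous (int (t i) + 1) (A_poly i)" "homogeneous (int (t i)) (B_poly i)"
  by (auto simp: A_poly_def B_poly_def homogeneous_def mono_degree_A_exp mono_degree_B_exp)

text \<open>Here minimality relies on \<open>t i \<ge> 1\<close>: for \<open>t i = 0\<close> there
  are no even edges and \<open>B_poly i\<close> would be 1.\<close>

lemma AB_lookup_0:
  assumes "i \<in> N" shows "coef (A_poly i) 0 = 0" "coef (B_poly i) 0 = 0"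
  using mono_degree_A_exp [of i] mono_degree_B_exp [of i] t_pos [OF assms]
  by (auto simp: A_poly_def B_poly_def lookup_single when_def)

lemma regular_AB:
  "regular_family N (A_poly :: nat \<Rightarrow> (vertex set, 'k::field) mpoly)"
  "regular_family N (B_poly :: nat \<Rightarrow> (vertex set, 'k::field) mpoly)"
proof -
  have disj: "c k ` L k \<inter> c l ` L l = {}" if "k \<in> N" "l \<in> N" "k \<noteq> l" for k l
    using that by (auto simp del: atLeastAtMost_iff simp: c_eq_iff)
  have "pkeys (A_exp k) \<inter> pkeys (A_exp l) \<subseteq> c k ` L k \<inter> c l ` L l"
    "pkeys (B_exp k) \<inter> pkeys (B_exp l) \<subseteq> c k ` L k \<inter> c l ` L l" if "k \<in> N" "l \<in> N" for k l
    by (rule Int_mono; rule keys_AB_subset; rule that)+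
  then have "pkeys (A_exp k) \<inter> pkeys (A_exp l) = {}" "pkeys (B_exp k) \<inter> pkeys (B_exp l) = {}"
    if "k \<in> N" "l \<in> N" "k \<noteq> l" for k l
    using disj [OF that] that(1,2) by (metis subset_empty)+
  then show "regular_family N (A_poly :: nat \<Rightarrow> (vertex set, 'k::field) mpoly)"
    "regular_family N (B_poly :: nat \<Rightarrow> (vertex set, 'k::field) mpoly)"
    using regular_family_monomials [of N A_exp, where ?'k = 'k] regular_family_monomials [of N B_exp, where ?'k = 'k]
    by (auto simp: A_poly_def [abs_def] B_poly_def [abs_def])
qed

lemma sum_lookup_AB:
  assumes k: "k \<in> N"
  shows "(\<Sum>i\<in>N. coef (A_exp k) (c i 1)) = 1" "(\<Sum>i\<in>N. coef (A_exp k) (c i (2 * t i + 1))) = 1"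
    and "(\<Sum>i\<in>N. coef (B_exp k) (c i 1)) = 0" "(\<Sum>i\<in>N. coef (B_exp k) (c i (2 * t i + 1))) = 0"
proof -
  have one: "1 \<in> L i" and last: "2 * t i + 1 \<in> L i" for i by simp_all
  have "(\<Sum>i\<in>N. coef (A_exp k) (c i 1)) = (\<Sum>i\<in>N. if k = i then 1 else 0)"
    by (intro sum.cong refl) (subst lookup_A_exp [OF k _ one], simp_all)
  then show "(\<Sum>i\<in>N. coef (A_exp k) (c i 1)) = 1" using k by simp
  have "(\<Sum>i\<in>N. coef (A_exp k) (c i (2 * t i + 1))) = (\<Sum>i\<in>N. if k = i then 1 else 0)"
    by (intro sum.cong refl) (subst lookup_A_exp [OF k _ last], simp_all)
  then show "(\<Sum>i\<in>N. coef (A_exp k) (c i (2 * t i + 1))) = 1" using k by simp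
  show "(\<Sum>i\<in>N. coef (B_exp k) (c i 1)) = 0"
    by (intro sum.neutral ballI) (subst lookup_B_exp [OF k _ one], simp_all)
  show "(\<Sum>i\<in>N. coef (B_exp k) (c i (2 * t i + 1))) = 0"
    by (intro sum.neutral ballI) (subst lookup_B_exp [OF k _ last], simp_all)
qed

lemma AB_two_row_exact:
  assumes "\<And>T. T \<subseteq> N \<Longrightarrow> card T = k \<Longrightarrow> kdiff N A_poly (kdiff N B_poly w) T = 0"
  shows "\<exists>p q. \<forall>T\<subseteq>N. card T = Suc (Suc k) \<longrightarrow>
    w T = kdiff N A_poly p T + kdiff N (B_poly :: nat \<Rightarrow> (vertex set, 'k::field) mpoly) q T"
proof -
  \<comment> \<open>The weight counts first edges of cycles. Each \<open>A_exp k\<close> contains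
    exactly one of them and each \<open>B_exp k\<close> none, which gives the degrees 1 and 0 of the
    descent.\<close>
  define wt where "wt m = (\<Sum>i\<in>N. coef m (c i 1))" for m :: "vertex set \<Rightarrow>\<^sub>0 nat"
  define tr where "tr n u = restrict_monoms (\<lambda>m. wt m < n) u" for n and u :: "(vertex set, 'k) mpoly"
  have wt_add: "wt (m + n) = wt m + wt n" for m n by (simp add: wt_def lookup_add sum.distrib)
  have wtA: "wt (A_exp k) = 1" and wtB: "wt (B_exp k) = 0" if "k \<in> N" for k
    using sum_lookup_AB [OF that] by (simp_all add: wt_def)
  show ?thesis
  proof (rule two_row_exact [of N A_poly B_poly tr k w, OF _ regular_AB])
    show "\<exists>n. \<forall>m\<ge>n. tr m u = u" for u
    proof (intro exI allI impI)
      fix m assume m: "Suc (Max (wt ` pkeys u)) \<le> m"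
      have "wt x < m" if "x \<in> pkeys u" for x
      proof -
        have "wt x \<le> Max (wt ` pkeys u)" using that by (intro Max_ge) auto
        then show ?thesis using m by linarith
      qed
      then show "tr m u = u" by (simp add: tr_def restrict_monoms_id_iff)
    qed
    show "tr (Suc n) (A_poly k * u) = A_poly k * tr n u" if "k \<in> N" for n k u
      unfolding tr_def by (rule restrict_monoms_mult) (auto simp: A_poly_def wt_add wtA [OF that])
    show "tr n (B_poly k * u) = B_poly k * tr n u" if "k \<in> N" for n k u
      unfolding tr_def by (rule restrict_monoms_mult) (auto simp: B_poly_def wt_add wtB [OF that])
  qed (use assms in \<open>auto simp: tr_def restrict_monoms_add restrict_monoms_idem restrict_monoms_eq_0_iff\<close>)
qed

text \<open>The coefficient of \<open>w {k, l}\<close> in \<open>minors w\<close> is, up to sign, the 2-minor of columns \<open>k\<close> and \<open>l\<close> of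
  the matrix with rows \<open>A_poly\<close> and \<open>B_poly\<close>.\<close>

definition minors :: "(nat set \<Rightarrow> (vertex set, 'k::field) mpoly) \<Rightarrow> (vertex set, 'k) mpoly" where
  "minors w = kdiff N A_poly (kdiff N B_poly w) {}"

lemma minors_add: "minors (\<lambda>S. v S + w S) = minors v + minors w"
proof -
  have "minors (\<lambda>S. v S + w S) = kdiff N A_poly (\<lambda>T. kdiff N B_poly v T + kdiff N B_poly w T) {}"
    unfolding minors_def by (intro kdiff_cong) (rule kdiff_add)
  then show ?thesis by (simp add: kdiff_add minors_def)
qed

lemma minors_scale: "minors (\<lambda>S. r * w S) = r * minors w"
proof -
  have "minors (\<lambda>S. r * w S) = kdiff N A_poly (\<lambda>T. r * kdiff N B_poly w T) {}"
    unfolding minors_def by (intro kdiff_cong) (rule kdiff_scale)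
  then show ?thesis by (simp add: kdiff_scale minors_def)
qed

lemma minors_carrier_part: "carrier_part E (minors w) = minors (\<lambda>S. carrier_part E (w S))"
proof -
  have "carrier_part E (minors w) = kdiff N A_poly (\<lambda>T. carrier_part E (kdiff N B_poly w T)) {}"
    unfolding minors_def by (rule kdiff_hom) (auto simp: carrier_part_add carrier_part_mult AB_poly_ring)
  also have "\<dots> = minors (\<lambda>S. carrier_part E (w S))"
    unfolding minors_def
    by (intro kdiff_cong kdiff_hom) (auto simp: carrier_part_add carrier_part_mult AB_poly_ring)
  finally show ?thesis .
qed

text \<open>Every outer vertex lies on one odd and one even edge of its cycle, whereas the two edges
  at the center are both odd.\<close>

lemma toric_exp_A: 
  assumes i: "i \<in> N" shows "toric_exp (A_exp i) = toric_exp (B_exp i) + monom_of Center 2"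
proof (rule poly_mapping_eqI)
  fix v
  note k = keys_AB_E [OF i]
  show "coef (toric_exp (A_exp i)) v = coef (toric_exp (B_exp i) + monom_of Center 2) v"
  proof (cases v)
    case Center
    show ?thesis
      unfolding Center lookup_add lookup_toric_exp_Center [OF k(1)] lookup_toric_exp_Center [OF k(2)]
        sum.distrib sum_lookup_AB [OF i] by simp
  next
    case (Outer i' j)
    show ?thesis
    proof (cases "i' \<in> N \<and> 1 \<le> j \<and> j \<le> 2 * t i'")
      case True
      then have i': "i' \<in> N" and j: "1 \<le> j" "j \<le> 2 * t i'" and jj: "j \<in> L i'" "Suc j \<in> L i'" by auto
      show ?thesis
        unfolding Outer lookup_add lookup_toric_exp_Outer [OF k(1) i' j] lookup_toric_exp_Outer [OF k(2) i' j]
        by (simp add: lookup_A_exp [OF i i' jj(1)] lookup_A_exp [OF i i' jj(2)]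
          lookup_B_exp [OF i i' jj(1)] lookup_B_exp [OF i i' jj(2)] lookup_single when_def)
    next
      case False
      then have "Outer i' j \<notin> c k l" if "k \<in> N" "l \<in> L k" for k l
        using that t_pos [of k] by (auto simp: cycle_edge_def split: if_splits)
      then show ?thesis
        unfolding Outer lookup_add lookup_toric_exp [OF k(1)] lookup_toric_exp [OF k(2)]
        by (simp add: lookup_single when_def)
    qed
  qed
qed

text \<open>The toric map makes the two rows proportional, with factor the square of the center.\<close>

lemma toric_map_minors: "toric_map (minors w :: (vertex set, 'k::field) mpoly) = 0"
proof -
  define B' where "B' k = (toric_map (B_poly k) :: (vertex, 'k) mpoly)" for k
  define V where "V = monom_of (monom_of Center (2::nat)) (1::'k)"
  have A': "toric_map (A_poly k) = B' k * V" if "k \<in> N" for k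
    using toric_exp_A [OF that] by (simp add: B'_def V_def A_poly_def B_poly_def toric_map_monom mult_single)
  \<comment> \<open>The factor \<open>V\<close> is moved from the coefficients into the argument, so
    that both differentials get the coefficients \<open>B'\<close>.\<close>
  have "toric_map (minors w) = kdiff N B' (\<lambda>T. V * toric_map (kdiff N B_poly w T)) {}"
    unfolding minors_def by (rule kdiff_hom) (auto simp: toric_map_add toric_map_mult A' mult_ac)
  also have "\<dots> = kdiff N B' (\<lambda>T. V * kdiff N B' (\<lambda>S. toric_map (w S)) T) {}"
  proof (rule kdiff_cong)
    fix k show "V * toric_map (kdiff N B_poly w (insert k {})) = V * kdiff N B' (\<lambda>S. toric_map (w S)) (insert k {})"
      by (subst kdiff_hom [where f' = B' and g = toric_map]) (auto simp: toric_map_add toric_map_mult B'_def)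
  qed
  also have "\<dots> = V * kdiff N B' (kdiff N B' (\<lambda>S. toric_map (w S))) {}" by (rule kdiff_scale)
  also have "\<dots> = 0" by (simp add: kdiff_square)
  finally show ?thesis .
qed

lemma minors_pair:
  assumes ij: "i \<in> N" "j \<in> N" "i \<noteq> j"
  shows "\<exists>w. minors w = (B_poly i * A_poly j - A_poly i * B_poly j :: (vertex set, 'k::field) mpoly)"
proof -
  \<comment> \<open>The value cancels the sign in front of \<open>B_poly i * A_poly j\<close>; the
    other order of the two columns then carries the sign -1.\<close>
  define w where "w S = (if S = {i, j} then ksgn i {j} else 0 :: (vertex set, 'k) mpoly)" for S
  have sq: "ksgn i {j} * ksgn i {j} = (1 :: (vertex set, 'k) mpoly)"
    by (simp add: ksgn_def power_add [symmetric])
  have sw: "ksgn j {i} = - (ksgn i {j} :: (vertex set, 'k) mpoly)"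
    using ksgn_swap [of i j "{}", where ?'b = "(vertex set, 'k) mpoly"] ij by (simp add: ksgn_def)
  have delta: "(\<Sum>k\<in>N. \<Sum>l\<in>N. if k = a then if l = b then x else 0 else 0) = x"
    if "a \<in> N" "b \<in> N" for a b and x :: "(vertex set, 'k) mpoly"
  proof -
    have "(\<Sum>l\<in>N. if k = a then if l = b then x else 0 else 0) = (if k = a then x else 0)" for k
      using that by simp
    then show ?thesis using that by simp
  qed
  have "minors w = (\<Sum>k\<in>N. \<Sum>l\<in>N. (if k = j then if l = i then B_poly i * A_poly j else 0 else 0)
      - (if k = i then if l = j then A_poly i * B_poly j else 0 else 0))"
    unfolding minors_def kdiff_kdiff [OF finite_atLeastAtMost] Diff_empty
  proof (intro sum.cong refl)
    fix k l
    have "k \<noteq> l \<Longrightarrow> {k, l} = {i, j} \<Longrightarrow> (k = i \<and> l = j) \<or> (k = j \<and> l = i)" by (auto simp: doubleton_eq_iff)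
    then show "(if k = l then 0 else ksgn k {} * ksgn l {k} * (A_poly k * B_poly l * w {k, l})) =
      (if k = j then if l = i then B_poly i * A_poly j else 0 else 0)
      - (if k = i then if l = j then A_poly i * B_poly j else 0 else 0)"
      using ij(3) sq by (auto simp: w_def sw ksgn_def [of _ "{}"] insert_commute mult_ac)
  qed
  also have "\<dots> = B_poly i * A_poly j - A_poly i * B_poly j"
    unfolding sum_subtractf using ij by (simp only: delta)
  finally show ?thesis by blast
qed

text \<open>Replacing a factor \<open>B_exp i + A_exp j\<close> of \<open>m\<close> by
  \<open>A_exp i + B_exp j\<close> changes the monomial by a multiple of a 2-minor and moves the
  exponents of the first edges of cycles \<open>i\<close> and \<open>j\<close> one step towards
  those of \<open>m'\<close>. The induction is on the total distance at the first edges.\<close>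

lemma binomial_in_minors:
  assumes "pkeys m \<subseteq> E" "pkeys m' \<subseteq> E" "toric_exp m = toric_exp m'"
  shows "\<exists>w. minors w = monom_of m a - monom_of m' (a::'k::field)"
  using assms
proof (induction "\<Sum>k\<in>N. nat \<bar>int (coef m' (c k 1)) - int (coef m (c k 1))\<bar>" arbitrary: m rule: less_induct)
  case less
  show ?case
  proof (cases "m = m'")
    case True
    have "minors (\<lambda>_. 0 * 0) = (0 :: (vertex set, 'k) mpoly)" by (subst minors_scale) simp
    then show ?thesis using True by auto
  next
    case False
    then obtain i j n where ij: "i \<in> N" "j \<in> N"
      and lt: "coef m (c i 1) < coef m' (c i 1)" "coef m' (c j 1) < coef m (c j 1)"
      and m: "m = n + B_exp i + A_exp j"
      using toric_exp_eq_swap [OF less.prems] by blast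
    have ne: "i \<noteq> j" using lt by auto
    define m1 where "m1 = n + A_exp i + B_exp j"
    have first: "coef (A_exp l) (c k (Suc 0)) = (if l = k then 1 else 0)" "coef (B_exp l) (c k (Suc 0)) = 0"
      if "l \<in> N" "k \<in> N" for k l
      using lookup_A_exp [of l k 1] lookup_B_exp [of l k 1] that by auto
    \<comment> \<open>The change of the exponents, written additively to avoid truncated
      subtraction.\<close>
    have m1c: "coef m1 (c k 1) + (if k = j then 1 else 0) = coef m (c k 1) + (if k = i then 1 else 0)" if "k \<in> N" for k
      using ne by (simp add: m m1_def lookup_add first [OF ij(1) that] first [OF ij(2) that])
    have "(\<Sum>k\<in>N. nat \<bar>int (coef m' (c k 1)) - int (coef m1 (c k 1))\<bar>) <
        (\<Sum>k\<in>N. nat \<bar>int (coef m' (c k 1)) - int (coef m (c k 1))\<bar>)"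
    proof (rule sum_strict_mono_ex1)
      show "\<forall>k\<in>N. nat \<bar>int (coef m' (c k 1)) - int (coef m1 (c k 1))\<bar> \<le> nat \<bar>int (coef m' (c k 1)) - int (coef m (c k 1))\<bar>"
      proof
        fix k assume "k \<in> N"
        from m1c [OF this] show "nat \<bar>int (coef m' (c k 1)) - int (coef m1 (c k 1))\<bar> \<le> nat \<bar>int (coef m' (c k 1)) - int (coef m (c k 1))\<bar>"
          using lt by (cases "k = i"; cases "k = j") auto
      qed
      show "\<exists>k\<in>N. nat \<bar>int (coef m' (c k 1)) - int (coef m1 (c k 1))\<bar> < nat \<bar>int (coef m' (c k 1)) - int (coef m (c k 1))\<bar>"
        using m1c [OF ij(1)] lt ne ij(1) by (intro bexI [of _ i]) auto
    qed simp
    moreover have "pkeys m1 \<subseteq> E"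
      using less.prems(1) keys_AB_E [OF ij(1)] keys_AB_E [OF ij(2)] by (auto simp: m m1_def keys_add_nat)
    moreover have "toric_exp m1 = toric_exp m'"
      using less.prems(3) toric_exp_A [OF ij(1)] toric_exp_A [OF ij(2)]
      by (simp add: m m1_def toric_exp_add add_ac)
    ultimately obtain w1 where w1: "minors w1 = monom_of m1 a - monom_of m' a"
      using less.hyps less.prems(2) by blast
    obtain w2 where w2: "minors w2 = B_poly i * A_poly j - A_poly i * (B_poly j :: (vertex set, 'k) mpoly)"
      using minors_pair [OF ij ne] by blast
    have "minors (\<lambda>S. monom_of n a * w2 S) = monom_of m a - monom_of m1 a"
      unfolding minors_scale w2 by (simp add: A_poly_def B_poly_def mult_single m m1_def algebra_simps)
    then have "minors (\<lambda>S. monom_of n a * w2 S + w1 S) = monom_of m a - monom_of m' a"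
      by (simp add: minors_add w1)
    then show ?thesis by blast
  qed
qed

text \<open>The toric ideal is spanned by binomials, and these lie in the range of
  \<open>minors\<close>. The coefficients obtained this way may involve variables outside
  \<open>E\<close>, which the projection removes.\<close>

lemma toric_ideal_eq:
  "(toric_ideal (odd_cycles_graph s t) :: (vertex set, 'k::field) mpoly set) =
     {minors w | w. \<forall>S. w S \<in> poly_ring E}"
proof (rule subset_antisym; rule subsetI)
  fix p :: "(vertex set, 'k) mpoly"
  assume "p \<in> toric_ideal (odd_cycles_graph s t)"
  then have p: "p \<in> poly_ring E" "toric_map p = 0" by (auto simp: toric_ideal_def)
  have "p \<in> range minors"
  proof (rule toric_ideal_induct_binomials [OF p])
    have "minors (\<lambda>_. 0 * 0) = (0 :: (vertex set, 'k) mpoly)" by (subst minors_scale) simp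
    then show "0 \<in> range (minors :: _ \<Rightarrow> (vertex set, 'k) mpoly)" by (metis rangeI)
    show "u + v \<in> range minors" if "u \<in> range minors" "v \<in> range (minors :: _ \<Rightarrow> (vertex set, 'k) mpoly)" for u v
      using that by (auto simp: minors_add [symmetric])
    show "monom_of m a - monom_of m' a \<in> range minors"
      if "pkeys m \<subseteq> E" "pkeys m' \<subseteq> E" "toric_exp m = toric_exp m'" for m m' and a :: 'k
      using binomial_in_minors [OF that, of a] by (metis rangeI)
  qed
  then obtain w where "p = minors w" by blast
  then have "p = minors (\<lambda>S. carrier_part E (w S))"
    using minors_carrier_part [of w] carrier_part_id [OF p(1)] by simp
  then show "p \<in> {minors w | w. \<forall>S. w S \<in> poly_ring E}"
    using carrier_part_in by blast
next
  fix p :: "(vertex set, 'k) mpoly"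
  assume "p \<in> {minors w | w. \<forall>S. w S \<in> poly_ring E}"
  then obtain w where w: "p = minors w" "\<And>S. w S \<in> poly_ring E" by blast
  have "p \<in> poly_ring E" unfolding w minors_def by (intro kdiff_poly_ring AB_poly_ring w(2))
  then show "p \<in> toric_ideal (odd_cycles_graph s t)" by (simp add: toric_ideal_def w(1) toric_map_minors)
qed

lemma proper_graded_toric_ideal:
  "proper_graded_ideal E (toric_ideal (odd_cycles_graph s t) :: (vertex set, 'k::field) mpoly set)"
proof -
  have "toric_map (hom_comp n p) = 0" if "p \<in> poly_ring E" "toric_map p = 0" for n and p :: "(vertex set, 'k) mpoly"
    using hom_comp_toric_map [OF that(1) card_E, of n] that(2) by (simp add: hom_comp_def)
  then show ?thesis
    unfolding proper_graded_ideal_def toric_ideal_def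
    by (auto simp: toric_map_diff toric_map_mult toric_map_1 intro: poly_ring_diff poly_ring_mult poly_ring_hom_comp)
qed

end

section \<open>The Eagon--Northcott resolution\<close>

context odd_cycles
begin

text \<open>For \<open>i \<ge> 1\<close> the pair \<open>(S, a)\<close> stands for the basis element \<open>e\<^sub>S \<otimes> X\<^bsup>(a)\<^esup> Y\<^bsup>(i-1-a)\<^esup>\<close> of
  \<open>\<And>\<^bsup>i+1\<^esup> R\<^bsup>s\<^esup> \<otimes> D\<^bsub>i-1\<^esub> R\<^sup>2\<close>, and \<open>en_diff i w\<close> gives the coefficients of the differential of the
  element with coefficients \<open>w\<close>.\<close>

definition en_basis :: "nat \<Rightarrow> (nat set \<times> nat) set" where
  "en_basis i = (if i = 0 then {({}, 0)} else {S. S \<subseteq> N \<and> card S = Suc i} \<times> {..<i})"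

definition en_diff ::
  "nat \<Rightarrow> (nat set \<times> nat \<Rightarrow> (vertex set, 'k::field) mpoly) \<Rightarrow> nat set \<times> nat \<Rightarrow> (vertex set, 'k) mpoly" where
  "en_diff i w P = (if i = 1 then minors (\<lambda>S. w (S, 0))
     else kdiff N A_poly (\<lambda>S. w (S, Suc (snd P))) (fst P) + kdiff N B_poly (\<lambda>S. w (S, snd P)) (fst P))"

text \<open>The empty set occurs in step 0 only, so the step need not be an argument. The constant 1
  comes from the minors, whose degrees are \<open>t k + t l + 1\<close>.\<close>

definition en_degree :: "nat set \<times> nat \<Rightarrow> int" where
  "en_degree P = (if fst P = {} then 0 else int (\<Sum>k\<in>fst P. t k) + int (snd P) + 1)"

lemma finite_en_basis: "finite (en_basis i)"
  by (auto simp: en_basis_def)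

lemma finite_subset_N: "S \<subseteq> N \<Longrightarrow> finite S"
  by (rule finite_subset) auto

lemma en_diff_add: "en_diff i (\<lambda>Q. v Q + w Q) P = en_diff i v P + en_diff i w P"
  by (simp add: en_diff_def minors_add kdiff_add)

lemma en_diff_scale: "en_diff i (\<lambda>Q. r * w Q) P = r * en_diff i w P"
  by (simp add: en_diff_def minors_scale kdiff_scale algebra_simps)

lemma minors_cong:
  assumes "\<And>S. S \<subseteq> N \<Longrightarrow> card S = 2 \<Longrightarrow> v S = w S"
  shows "minors v = minors w"
  unfolding minors_def
proof (rule kdiff_cong, rule kdiff_cong)
  fix k l assume "k \<in> N - {}" "l \<in> N - insert k {}"
  then show "v (insert l (insert k {})) = w (insert l (insert k {}))" by (intro assms) auto
qed

lemma en_diff_cong: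
  assumes "P \<in> en_basis i" "\<And>Q. Q \<in> en_basis (Suc i) \<Longrightarrow> v Q = w Q"
  shows "en_diff (Suc i) v P = en_diff (Suc i) w P"
proof (cases "i = 0")
  case True
  then show ?thesis using assms by (auto simp: en_diff_def en_basis_def intro!: minors_cong)
next
  case False
  then obtain T a where P: "P = (T, a)" "T \<subseteq> N" "card T = Suc i" "a < i"
    using assms(1) by (auto simp: en_basis_def)
  have "(insert k T, b) \<in> en_basis (Suc i)" if "k \<in> N - T" "b \<le> Suc a" for k b
    using that P finite_subset_N [OF P(2)] by (auto simp: en_basis_def)
  then have "kdiff N A_poly (\<lambda>S. v (S, Suc a)) T = kdiff N A_poly (\<lambda>S. w (S, Suc a)) T"
    "kdiff N B_poly (\<lambda>S. v (S, a)) T = kdiff N B_poly (\<lambda>S. w (S, a)) T"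
    using assms(2) by (auto intro!: kdiff_cong)
  then show ?thesis using False by (simp add: en_diff_def P)
qed

text \<open>The mixed terms cancel by anticommutation and the others are squares. At the splice with
  the minors, the term with two B-differentials vanishes, and in the other one anticommutation
  brings the two A-differentials together.\<close>

lemma en_diff_en_diff:
  assumes "P \<in> en_basis i"
  shows "en_diff (Suc i) (en_diff (Suc (Suc i)) w) P = 0"
proof -
  define u where "u a S = w (S, a)" for a S
  have d: "en_diff (Suc (Suc j)) w (S, a) = kdiff N A_poly (u (Suc a)) S + kdiff N B_poly (u a) S" for j S a
    by (simp add: en_diff_def u_def [abs_def])
  have step: "kdiff N f (\<lambda>S. kdiff N A_poly (u b) S + kdiff N B_poly (u a) S) T =
     kdiff N f (kdiff N A_poly (u b)) T + kdiff N f (kdiff N B_poly (u a)) T" for f a b T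
    by (rule kdiff_add)
  note anti = kdiff_anticommute [of N _ B_poly A_poly]
  note sq = kdiff_square [of N]
  show ?thesis
  proof (cases "i = 0")
    case True
    have AB: "kdiff N B_poly (\<lambda>S. kdiff N A_poly (u 1) S + kdiff N B_poly (u 0) S) T = - kdiff N A_poly (kdiff N B_poly (u 1)) T"
      if "T \<subseteq> N" for T
      unfolding step using sq [OF finite_atLeastAtMost that, of B_poly "u 0"] anti [OF finite_atLeastAtMost that, of "u 1"]
      by simp
    have "en_diff (Suc 0) (en_diff (Suc (Suc 0)) w) P =
      kdiff N A_poly (kdiff N B_poly (\<lambda>S. kdiff N A_poly (u 1) S + kdiff N B_poly (u 0) S)) {}"
      by (subst en_diff_def) (simp add: d minors_def)
    also have "\<dots> = kdiff N A_poly (\<lambda>T. - kdiff N A_poly (kdiff N B_poly (u 1)) T) {}"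
      by (intro kdiff_cong AB) auto
    also have "\<dots> = 0"
      using sq [OF finite_atLeastAtMost empty_subsetI, of A_poly "kdiff N B_poly (u 1)"] by (simp add: kdiff_minus)
    finally show ?thesis using True by simp
  next
    case False
    then obtain T a where P: "P = (T, a)" "T \<subseteq> N" using assms by (auto simp: en_basis_def)
    have "en_diff (Suc i) (en_diff (Suc (Suc i)) w) P =
      kdiff N A_poly (\<lambda>S. kdiff N A_poly (u (Suc (Suc a))) S + kdiff N B_poly (u (Suc a)) S) T +
      kdiff N B_poly (\<lambda>S. kdiff N A_poly (u (Suc a)) S + kdiff N B_poly (u a) S) T"
      using False by (subst en_diff_def) (simp add: P d)
    then show ?thesis
      using sq [OF finite_atLeastAtMost P(2), of A_poly "u (Suc (Suc a))"] sq [OF finite_atLeastAtMost P(2), of B_poly "u a"]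
        anti [OF finite_atLeastAtMost P(2), of "u (Suc a)"] by (simp add: kdiff_add)
  qed
qed

text \<open>In the components \<open>u a\<close> the kernel condition is the chain relation of
  \<open>two_row_chain_exact\<close>. Its base condition is the kernel condition itself at the
  splice \<open>i = 0\<close>; for \<open>i > 0\<close> it follows from the link
  \<open>a = 0\<close> by applying the A-differential once more.\<close>

lemma en_diff_exact:
  fixes w :: "nat set \<times> nat \<Rightarrow> (vertex set, 'k::field) mpoly"
  assumes ker: "\<And>P. P \<in> en_basis i \<Longrightarrow> en_diff (Suc i) w P = 0"
  shows "\<exists>p. \<forall>Q\<in>en_basis (Suc i). w Q = en_diff (Suc (Suc i)) p Q"
proof -
  define u where "u a S = w (S, a)" for a S
  have chain: "kdiff N A_poly (u (Suc a)) T + kdiff N B_poly (u a) T = 0"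
    if "a < i" "T \<subseteq> N" "card T = Suc i" for a T
    using ker [of "(T, a)"] that by (auto simp: en_diff_def en_basis_def u_def [abs_def])
  have base: "kdiff N A_poly (kdiff N B_poly (u 0)) T = 0" if T: "T \<subseteq> N" "card T = i" for T
  proof (cases "i = 0")
    case True
    then have "T = {}" using T finite_subset_N [OF T(1)] by simp
    then show ?thesis
      using ker [of "({}, 0)"] True by (simp add: en_diff_def en_basis_def minors_def u_def [abs_def])
  next
    case False
    have "kdiff N A_poly (kdiff N B_poly (u 0)) T = kdiff N A_poly (\<lambda>S. - kdiff N A_poly (u 1) S) T"
    proof (rule kdiff_cong)
      fix k assume "k \<in> N - T"
      then show "kdiff N B_poly (u 0) (insert k T) = - kdiff N A_poly (u 1) (insert k T)"
        using chain [of 0 "insert k T"] False T finite_subset_N [OF T(1)]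
        by (simp add: eq_neg_iff_add_eq_0 add.commute)
    qed
    then show ?thesis using T(1) by (simp add: kdiff_minus kdiff_square)
  qed
  have "\<exists>p. \<forall>a\<le>i. \<forall>T\<subseteq>N. card T = Suc (Suc i) \<longrightarrow>
      u a T = kdiff N A_poly (p (Suc a)) T + kdiff N B_poly (p a) T"
    by (rule two_row_chain_exact [OF finite_atLeastAtMost regular_AB(1) AB_two_row_exact base chain])
  then obtain p where p: "\<And>a T. a \<le> i \<Longrightarrow> T \<subseteq> N \<Longrightarrow> card T = Suc (Suc i) \<Longrightarrow>
      u a T = kdiff N A_poly (p (Suc a)) T + kdiff N B_poly (p a) T"
    by blast
  have "w Q = en_diff (Suc (Suc i)) (\<lambda>(S, a). p a S) Q" if "Q \<in> en_basis (Suc i)" for Q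
    using that p [of "snd Q" "fst Q"] by (auto simp: en_basis_def en_diff_def u_def)
  then show ?thesis by blast
qed

lemma en_diff_carrier_part:
  "carrier_part E (en_diff i w P) = en_diff i (\<lambda>Q. carrier_part E (w Q)) P"
proof -
  have "carrier_part E (kdiff N f v T) = kdiff N f (\<lambda>T. carrier_part E (v T)) T"
    if "\<And>k. k \<in> N \<Longrightarrow> f k \<in> poly_ring E" for f and v :: "nat set \<Rightarrow> (vertex set, 'a) mpoly" and T
    using that by (intro kdiff_hom) (auto simp: carrier_part_add carrier_part_mult)
  then show ?thesis
    by (simp add: en_diff_def minors_carrier_part carrier_part_add AB_poly_ring)
qed

lemma en_diff_poly_ring:
  assumes "\<And>Q. w Q \<in> poly_ring E" shows "en_diff i w P \<in> poly_ring E"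
  using assms unfolding en_diff_def minors_def
  by (auto intro!: kdiff_poly_ring poly_ring_add simp: AB_poly_ring)

section \<open>The differentials as graded matrices\<close>

definition en_entry :: "nat \<Rightarrow> nat set \<times> nat \<Rightarrow> nat set \<times> nat \<Rightarrow> (vertex set, 'k::field) mpoly" where
  "en_entry i P Q = en_diff i (\<lambda>R. if R = Q then 1 else 0) P"

lemma en_diff_expand:
  assumes "P \<in> en_basis i"
  shows "en_diff (Suc i) w P = (\<Sum>Q\<in>en_basis (Suc i). en_entry (Suc i) P Q * w Q)"
  unfolding en_entry_def
proof (rule linear_functional_expand [where F = "\<lambda>w. en_diff (Suc i) w P"])
  show "en_diff (Suc i) v P = en_diff (Suc i) w P" if "\<And>Q. Q \<in> en_basis (Suc i) \<Longrightarrow> v Q = w Q" for v w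
    using assms that by (rule en_diff_cong)
qed (rule finite_en_basis en_diff_add en_diff_scale)+

lemma en_entry_poly_ring: "en_entry i P Q \<in> poly_ring E"
  unfolding en_entry_def by (rule en_diff_poly_ring) simp

lemma en_entry_lookup_0: "coef (en_entry i P Q) 0 = 0"
proof -
  have "coef (kdiff N A_poly v T) 0 = 0" "coef (kdiff N B_poly v T) 0 = 0"
    for T and v :: "nat set \<Rightarrow> (vertex set, 'a) mpoly"
    by (rule kdiff_lookup_0, rule AB_lookup_0, assumption)+
  then show ?thesis by (simp add: en_entry_def en_diff_def minors_def lookup_add)
qed

lemma en_entry_homogeneous:
  assumes P: "P \<in> en_basis i" and Q: "Q \<in> en_basis (Suc i)"
  shows "homogeneous (en_degree Q - en_degree P) (en_entry (Suc i) P Q :: (vertex set, 'k::field) mpoly)"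
proof -
  obtain S b where Q': "Q = (S, b)" "S \<subseteq> N" "card S = Suc (Suc i)" "b \<le> i"
    using Q by (auto simp: en_basis_def)
  have S: "S \<noteq> {}" using Q'(3) by auto
  have unit_case: "homogeneous n (f * (if Q' = Q then 1 else 0 :: (vertex set, 'k) mpoly))"
    if "Q' = Q \<Longrightarrow> homogeneous n f" for n f Q'
    using that by auto
  show ?thesis
  proof (cases "i = 0")
    case True
    then have P': "P = ({}, 0)" using P by (simp add: en_basis_def)
    let ?u = "\<lambda>S. if (S, 0) = Q then 1 else 0 :: (vertex set, 'k) mpoly"
    have "homogeneous (en_degree Q) (A_poly k * kdiff N B_poly ?u (insert k {}))" if k: "k \<in> N" for k
    proof -
      have "homogeneous (en_degree Q - (int (t k) + 1)) (kdiff N B_poly ?u (insert k {}))"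
      proof (rule kdiff_homogeneous, rule unit_case)
        fix l assume "l \<in> N - insert k {}" "(insert l (insert k {}), 0) = Q"
        then have "en_degree Q - (int (t k) + 1) = int (t l)" by (auto simp: en_degree_def)
        then show "homogeneous (en_degree Q - (int (t k) + 1)) (B_poly l :: (vertex set, 'k) mpoly)"
          using AB_homogeneous(2) by simp
      qed
      from homogeneous_mult [OF AB_homogeneous(1) [of k] this] show ?thesis by simp
    qed
    then have "homogeneous (en_degree Q) (minors ?u)"
      unfolding minors_def by (intro kdiff_homogeneous) simp
    then show ?thesis using True by (simp add: en_entry_def en_diff_def P' en_degree_def)
  next
    case False
    then obtain T a where P': "P = (T, a)" "T \<subseteq> N" "card T = Suc i"
      using P by (auto simp: en_basis_def)
    have T: "T \<noteq> {}" "finite T" using P'(3) finite_subset_N [OF P'(2)] by auto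
    have "homogeneous (en_degree Q - en_degree P) (kdiff N A_poly (\<lambda>S. if (S, Suc a) = Q then 1 else 0 :: (vertex set, 'k) mpoly) T)"
    proof (rule kdiff_homogeneous, rule unit_case)
      fix k assume "k \<in> N - T" "(insert k T, Suc a) = Q"
      then have "en_degree Q - en_degree P = int (t k) + 1" using T P' by (auto simp: en_degree_def)
      then show "homogeneous (en_degree Q - en_degree P) (A_poly k :: (vertex set, 'k) mpoly)"
        using AB_homogeneous(1) by simp
    qed
    moreover have "homogeneous (en_degree Q - en_degree P) (kdiff N B_poly (\<lambda>S. if (S, a) = Q then 1 else 0 :: (vertex set, 'k) mpoly) T)"
    proof (rule kdiff_homogeneous, rule unit_case)
      fix k assume "k \<in> N - T" "(insert k T, a) = Q"
      then have "en_degree Q - en_degree P = int (t k)" using T P' by (auto simp: en_degree_def)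
      then show "homogeneous (en_degree Q - en_degree P) (B_poly k :: (vertex set, 'k) mpoly)"
        using AB_homogeneous(2) by simp
    qed
    ultimately show ?thesis
      using False by (simp add: en_entry_def en_diff_def P'(1) homogeneous_add)
  qed
qed

definition en_list :: "nat \<Rightarrow> (nat set \<times> nat) list" where
  "en_list i = (SOME xs. set xs = en_basis i \<and> distinct xs)"

lemma en_list: "set (en_list i) = en_basis i" "distinct (en_list i)"
  using someI_ex [OF finite_distinct_list [OF finite_en_basis [of i]]] by (auto simp: en_list_def)

lemma en_list_nth: "l < length (en_list i) \<Longrightarrow> en_list i ! l \<in> en_basis i"
  using en_list(1) nth_mem by blast

lemma en_list_0: "en_list 0 = [({}, 0)]"
proof -
  have "length (en_list 0) = 1" using distinct_card [OF en_list(2), of 0] by (simp add: en_list(1) en_basis_def)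
  then obtain x where "en_list 0 = [x]" by (auto simp: length_Suc_conv)
  then show ?thesis using en_list(1) [of 0] by (simp add: en_basis_def)
qed

definition en_shifts :: "nat \<Rightarrow> int list" where
  "en_shifts i = map en_degree (en_list i)"

definition en_matrix :: "nat \<Rightarrow> nat \<Rightarrow> nat \<Rightarrow> (vertex set, 'k::field) mpoly" where
  "en_matrix i k l = en_entry i (en_list (i - 1) ! k) (en_list i ! l)"

lemma mat_map_en_matrix:
  assumes u: "\<And>l. l < length (en_list (Suc i)) \<Longrightarrow> u l = w (en_list (Suc i) ! l)"
  shows "mat_map (length (en_list i)) (length (en_list (Suc i))) (en_matrix (Suc i)) u =
    (\<lambda>k. if k < length (en_list i) then en_diff (Suc i) w (en_list i ! k) else 0)"
proof (rule ext)
  fix k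
  show "mat_map (length (en_list i)) (length (en_list (Suc i))) (en_matrix (Suc i)) u k =
    (if k < length (en_list i) then en_diff (Suc i) w (en_list i ! k) else 0)"
  proof (cases "k < length (en_list i)")
    case True
    have bij: "bij_betw ((!) (en_list (Suc i))) {..<length (en_list (Suc i))} (en_basis (Suc i))"
      using bij_betw_nth [OF en_list(2) refl en_list(1) [symmetric]] .
    have "(\<Sum>l<length (en_list (Suc i)). en_matrix (Suc i) k l * u l) =
      (\<Sum>l<length (en_list (Suc i)). en_entry (Suc i) (en_list i ! k) (en_list (Suc i) ! l) * w (en_list (Suc i) ! l))"
      by (intro sum.cong) (auto simp: en_matrix_def u)
    also have "\<dots> = (\<Sum>Q\<in>en_basis (Suc i). en_entry (Suc i) (en_list i ! k) Q * w Q)"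
      by (rule sum.reindex_bij_betw [OF bij])
    also have "\<dots> = en_diff (Suc i) w (en_list i ! k)"
      by (rule en_diff_expand [symmetric]) (rule en_list_nth [OF True])
    finally show ?thesis using True by (simp add: mat_map_def)
  qed (simp add: mat_map_def)
qed

definition en_coords :: "nat \<Rightarrow> (nat set \<times> nat \<Rightarrow> (vertex set, 'k::field) mpoly) \<Rightarrow> nat \<Rightarrow> (vertex set, 'k) mpoly" where
  "en_coords i w l = (if l < length (en_list i) then w (en_list i ! l) else 0)"

lemma en_coords_in_free_module:
  "(\<And>Q. w Q \<in> poly_ring E) \<Longrightarrow> en_coords i w \<in> free_module E (length (en_list i))"
  by (auto simp: en_coords_def free_module_def)

lemma free_module_en_coords:
  assumes "u \<in> free_module E (length (en_list i))"
  obtains w where "u = en_coords i w" "\<And>Q. w Q \<in> poly_ring E"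
proof
  let ?w = "\<lambda>Q. if Q \<in> en_basis i then u (inv_into {..<length (en_list i)} ((!) (en_list i)) Q) else 0"
  have bij: "bij_betw ((!) (en_list i)) {..<length (en_list i)} (en_basis i)"
    using bij_betw_nth [OF en_list(2) refl en_list(1) [symmetric]] .
  show "u = en_coords i ?w"
  proof (rule ext)
    fix l show "u l = en_coords i ?w l"
      using assms en_list_nth [of l i] inv_into_f_f [OF bij_betw_imp_inj_on [OF bij], of l]
      by (auto simp: en_coords_def free_module_def)
  qed
  show "?w Q \<in> poly_ring E" for Q
  proof (cases "Q \<in> en_basis i")
    case True
    then have "inv_into {..<length (en_list i)} ((!) (en_list i)) Q \<in> {..<length (en_list i)}"
      using bij by (intro inv_into_into) (auto simp: bij_betw_def)
    then show ?thesis using assms True by (auto simp: free_module_def)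
  qed simp
qed

lemma mat_map_en_coords:
  "mat_map (length (en_list i)) (length (en_list (Suc i))) (en_matrix (Suc i)) (en_coords (Suc i) w) =
     en_coords i (en_diff (Suc i) w)"
  by (subst mat_map_en_matrix [where w = w]) (auto simp: en_coords_def fun_eq_iff)

lemma en_coords_cong: "(\<And>Q. Q \<in> en_basis i \<Longrightarrow> v Q = w Q) \<Longrightarrow> en_coords i v = en_coords i w"
  by (auto simp: en_coords_def fun_eq_iff en_list_nth)

lemma en_coords_eq_0D: "en_coords i w = (\<lambda>_. 0) \<Longrightarrow> Q \<in> en_basis i \<Longrightarrow> w Q = 0"
  using en_list(1) [of i] by (auto simp: en_coords_def fun_eq_iff in_set_conv_nth) (metis in_set_conv_nth)

lemma en_exact_middle:
  "{u \<in> free_module E (length (en_list (Suc i))).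
     mat_map (length (en_list i)) (length (en_list (Suc i))) (en_matrix (Suc i)) u = (\<lambda>_. 0)} =
   mat_map (length (en_list (Suc i))) (length (en_list (Suc (Suc i)))) (en_matrix (Suc (Suc i) )) `
     (free_module E (length (en_list (Suc (Suc i)))) :: (nat \<Rightarrow> (vertex set, 'k::field) mpoly) set)"
proof (rule subset_antisym; rule subsetI)
  fix u :: "nat \<Rightarrow> (vertex set, 'k) mpoly"
  assume "u \<in> {u \<in> free_module E (length (en_list (Suc i))).
     mat_map (length (en_list i)) (length (en_list (Suc i))) (en_matrix (Suc i)) u = (\<lambda>_. 0)}"
  then have u: "u \<in> free_module E (length (en_list (Suc i)))"
    "mat_map (length (en_list i)) (length (en_list (Suc i))) (en_matrix (Suc i)) u = (\<lambda>_. 0)" by auto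
  obtain w where w: "u = en_coords (Suc i) w" "\<And>Q. w Q \<in> poly_ring E"
    using free_module_en_coords [OF u(1)] by blast
  have "en_diff (Suc i) w P = 0" if "P \<in> en_basis i" for P
    using u(2) that unfolding w mat_map_en_coords by (rule en_coords_eq_0D)
  then obtain p where p: "\<And>Q. Q \<in> en_basis (Suc i) \<Longrightarrow> w Q = en_diff (Suc (Suc i)) p Q"
    using en_diff_exact by blast
  \<comment> \<open>The preimage may involve variables outside \<open>E\<close>; the differential
    commutes with the projection, and \<open>w\<close> is fixed by it.\<close>
  define p' where "p' Q = carrier_part E (p Q)" for Q
  have "w Q = en_diff (Suc (Suc i)) p' Q" if "Q \<in> en_basis (Suc i)" for Q
    using arg_cong [OF p [OF that], of "carrier_part E"]
    by (simp add: carrier_part_id w(2) en_diff_carrier_part p'_def [abs_def])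
  then have "u = mat_map (length (en_list (Suc i))) (length (en_list (Suc (Suc i)))) (en_matrix (Suc (Suc i))) (en_coords (Suc (Suc i)) p')"
    unfolding w mat_map_en_coords by (rule en_coords_cong)
  moreover have "en_coords (Suc (Suc i)) p' \<in> free_module E (length (en_list (Suc (Suc i))))"
    by (rule en_coords_in_free_module) (simp add: p'_def carrier_part_in)
  ultimately show "u \<in> mat_map (length (en_list (Suc i))) (length (en_list (Suc (Suc i)))) (en_matrix (Suc (Suc i) )) `
     free_module E (length (en_list (Suc (Suc i))))" by (rule image_eqI)
next
  fix u :: "nat \<Rightarrow> (vertex set, 'k) mpoly"
  assume "u \<in> mat_map (length (en_list (Suc i))) (length (en_list (Suc (Suc i)))) (en_matrix (Suc (Suc i) )) `
     free_module E (length (en_list (Suc (Suc i))))"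
  then obtain v where v: "v \<in> free_module E (length (en_list (Suc (Suc i))))"
    "u = mat_map (length (en_list (Suc i))) (length (en_list (Suc (Suc i)))) (en_matrix (Suc (Suc i) )) v" by blast
  obtain w where w: "v = en_coords (Suc (Suc i)) w" "\<And>Q. w Q \<in> poly_ring E"
    using free_module_en_coords [OF v(1)] by blast
  have u: "u = en_coords (Suc i) (en_diff (Suc (Suc i)) w)" unfolding v(2) w(1) by (rule mat_map_en_coords)
  have "mat_map (length (en_list i)) (length (en_list (Suc i))) (en_matrix (Suc i)) u = en_coords i (\<lambda>_. 0)"
    unfolding u mat_map_en_coords by (rule en_coords_cong) (rule en_diff_en_diff)
  moreover have "u \<in> free_module E (length (en_list (Suc i)))"
    unfolding u by (intro en_coords_in_free_module en_diff_poly_ring w(2))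
  ultimately show "u \<in> {u \<in> free_module E (length (en_list (Suc i))).
     mat_map (length (en_list i)) (length (en_list (Suc i))) (en_matrix (Suc i)) u = (\<lambda>_. 0)}"
    by (simp add: en_coords_def fun_eq_iff)
qed

text \<open>The augmentation sends the only basis element of step 0 to 1, so exactness there is the
  description of the toric ideal by minors.\<close>

lemma en_exact_start:
  "{u \<in> free_module E (length (en_list 0)). (\<Sum>l<length (en_list 0). u l * 1) \<in> toric_ideal (odd_cycles_graph s t)} =
   mat_map (length (en_list 0)) (length (en_list 1)) (en_matrix 1) `
     (free_module E (length (en_list 1)) :: (nat \<Rightarrow> (vertex set, 'k::field) mpoly) set)"
proof (rule subset_antisym; rule subsetI)
  fix u :: "nat \<Rightarrow> (vertex set, 'k) mpoly"
  assume "u \<in> {u \<in> free_module E (length (en_list 0)). (\<Sum>l<length (en_list 0). u l * 1) \<in> toric_ideal (odd_cycles_graph s t)}"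
  then have u: "u \<in> free_module E 1" "u 0 \<in> toric_ideal (odd_cycles_graph s t)" by (auto simp: en_list_0)
  then obtain w where w: "u 0 = minors w" "\<And>S. w S \<in> poly_ring E" unfolding toric_ideal_eq by blast
  have "u = mat_map (length (en_list 0)) (length (en_list 1)) (en_matrix 1) (en_coords 1 (\<lambda>Q. w (fst Q)))"
    using u(1) w(1) mat_map_en_coords [of 0 "\<lambda>Q. w (fst Q)"]
    by (auto simp: en_coords_def [of 0] en_list_0 en_diff_def fun_eq_iff free_module_def)
  moreover have "en_coords 1 (\<lambda>Q. w (fst Q)) \<in> free_module E (length (en_list 1))"
    by (rule en_coords_in_free_module) (rule w(2))
  ultimately show "u \<in> mat_map (length (en_list 0)) (length (en_list 1)) (en_matrix 1) ` free_module E (length (en_list 1))"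
    by (rule image_eqI)
next
  fix u :: "nat \<Rightarrow> (vertex set, 'k) mpoly"
  assume "u \<in> mat_map (length (en_list 0)) (length (en_list 1)) (en_matrix 1) ` free_module E (length (en_list 1))"
  then obtain v where v: "v \<in> free_module E (length (en_list 1))"
    "u = mat_map (length (en_list 0)) (length (en_list 1)) (en_matrix 1) v" by blast
  obtain w where w: "v = en_coords 1 w" "\<And>Q. w Q \<in> poly_ring E"
    using free_module_en_coords [OF v(1)] by blast
  have u: "u = en_coords 0 (en_diff 1 w)" using mat_map_en_coords [of 0 w] by (simp add: v(2) w(1))
  then have "u 0 = minors (\<lambda>S. w (S, 0))" by (simp add: en_coords_def en_list_0 en_diff_def)
  then have "u 0 \<in> toric_ideal (odd_cycles_graph s t)" unfolding toric_ideal_eq using w(2) by blast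
  moreover have "u \<in> free_module E (length (en_list 0))"
    unfolding u by (intro en_coords_in_free_module en_diff_poly_ring w(2))
  ultimately show "u \<in> {u \<in> free_module E (length (en_list 0)). (\<Sum>l<length (en_list 0). u l * 1) \<in> toric_ideal (odd_cycles_graph s t)}"
    by (simp add: en_list_0)
qed

lemma en_resolution:
  "minimal_graded_free_resolution E (toric_ideal (odd_cycles_graph s t) :: (vertex set, 'k::field) mpoly set)
     en_shifts (\<lambda>_. 1) en_matrix"
  unfolding minimal_graded_free_resolution_def graded_free_resolution_def
proof (intro conjI allI impI ballI)
  have len: "length (en_shifts i) = length (en_list i)" for i by (simp add: en_shifts_def)
  have s0: "en_shifts 0 = [0]" by (simp add: en_shifts_def en_list_0 en_degree_def)
  show "(1 :: (vertex set, 'k) mpoly) \<in> poly_ring E" by simp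
  show "homogeneous (en_shifts 0 ! l) (1 :: (vertex set, 'k) mpoly)" if "l < length (en_shifts 0)" for l
    using that by (simp add: s0 homogeneous_1)
  show "graded_matrix E (en_shifts i) (en_shifts (Suc i)) (en_matrix (Suc i) :: _ \<Rightarrow> _ \<Rightarrow> (vertex set, 'k) mpoly)" for i
    unfolding graded_matrix_def en_matrix_def
    by (auto simp: en_shifts_def en_entry_poly_ring en_entry_homogeneous en_list_nth)
  show "\<exists>u\<in>free_module E (length (en_shifts 0)). p - (\<Sum>l<length (en_shifts 0). u l * 1) \<in> toric_ideal (odd_cycles_graph s t)"
    if "p \<in> poly_ring E" for p :: "(vertex set, 'k) mpoly"
    using that by (intro bexI [of _ "\<lambda>l. if l = 0 then p else 0"])
      (auto simp: s0 free_module_def toric_ideal_def)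
  show "{u \<in> free_module E (length (en_shifts 0)). (\<Sum>l<length (en_shifts 0). u l * 1) \<in> toric_ideal (odd_cycles_graph s t)} =
     mat_map (length (en_shifts 0)) (length (en_shifts 1)) (en_matrix 1) `
       (free_module E (length (en_shifts 1)) :: (nat \<Rightarrow> (vertex set, 'k) mpoly) set)"
    unfolding len by (rule en_exact_start)
  show "{u \<in> free_module E (length (en_shifts i)). mat_map (length (en_shifts (i - 1))) (length (en_shifts i)) (en_matrix i) u = (\<lambda>_. 0)} =
     mat_map (length (en_shifts i)) (length (en_shifts (Suc i))) (en_matrix (Suc i)) `
       (free_module E (length (en_shifts (Suc i))) :: (nat \<Rightarrow> (vertex set, 'k) mpoly) set)" if "1 \<le> i" for i
    using that en_exact_middle [of "i - 1"] unfolding len by simp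
  show "en_matrix (Suc i) k l \<in> irrelevant_ideal E" for i k l
    by (simp add: irrelevant_ideal_def en_matrix_def en_entry_poly_ring en_entry_lookup_0)
qed

text \<open>The resolution behind \<open>minimal_shifts\<close> is unspecified, but its shifts are
  those of the Eagon--Northcott resolution by uniqueness. The regularity depends only on which
  degrees occur, so sets are enough.\<close>

lemma minimal_shifts_set:
  "set (minimal_shifts E (toric_ideal (odd_cycles_graph s t) :: (vertex set, 'k::field) mpoly set) i) =
     en_degree ` en_basis i"
proof -
  let ?I = "toric_ideal (odd_cycles_graph s t) :: (vertex set, 'k) mpoly set"
  let ?a = "minimal_shifts E ?I"
  have "\<exists>g d. minimal_graded_free_resolution E ?I ?a g d"
    unfolding minimal_shifts_def 
    by (rule someI [of "\<lambda>a. \<exists>g d. minimal_graded_free_resolution E ?I a g d" en_shifts])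
      (use en_resolution in blast)
  then obtain g d where "minimal_graded_free_resolution E ?I ?a g d" by blast
  then have "count_list (?a i) j = count_list (en_shifts i) j" for j
    using en_resolution proper_graded_toric_ideal by (rule minimal_resolution_shifts_unique)
  then have "set (?a i) = set (en_shifts i)" by (auto simp: set_eq_iff) (metis count_list_0_iff)+
  then show ?thesis by (simp add: en_shifts_def en_list)
qed

lemma regularity_eq:
  assumes "s \<ge> 1"
  shows "regularity E (toric_ideal (odd_cycles_graph s t) :: (vertex set, 'k::field) mpoly set)
         = (if s \<ge> 2 then int (\<Sum>i=1..s. t i) else 0)"
proof -
  let ?I = "toric_ideal (odd_cycles_graph s t) :: (vertex set, 'k) mpoly set"
  define D where "D = {j - int i | i j. graded_betti E ?I i j \<noteq> 0}"
  have D: "D = {en_degree Q - int i | i Q. Q \<in> en_basis i}"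
    unfolding D_def graded_betti_def count_list_0_iff not_not minimal_shifts_set by blast
  have basis_empty: "en_basis i = {}" if "i \<ge> s" "i \<noteq> 0" for i
  proof -
    have "card S \<noteq> Suc i" if "S \<subseteq> N" for S
      using card_mono [OF _ that] \<open>i \<ge> s\<close> by simp
    then have "{S. S \<subseteq> N \<and> card S = Suc i} = {}" by blast
    then show ?thesis using \<open>i \<noteq> 0\<close> by (simp only: en_basis_def if_False Sigma_empty1)
  qed
  \<comment> \<open>No set has more than \<open>s\<close> columns, so the complex stops before step
    \<open>s\<close>. This makes \<open>D\<close> finite, as \<open>Max\<close> requires.\<close>
  have "D \<subseteq> (\<Union>i\<in>{..<s}. (\<lambda>Q. en_degree Q - int i) ` en_basis i)"
  proof
    fix d assume "d \<in> D"
    then obtain i Q where iQ: "d = en_degree Q - int i" "Q \<in> en_basis i" by (auto simp: D)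
    then have "i < s" using basis_empty [of i] assms by (cases "i < s") auto
    then show "d \<in> (\<Union>i\<in>{..<s}. (\<lambda>Q. en_degree Q - int i) ` en_basis i)" using iQ by blast
  qed
  then have fin: "finite D" by (rule finite_subset) (auto simp: finite_en_basis)
  have zero: "0 \<in> D" unfolding D by (auto simp: en_basis_def en_degree_def intro!: exI [of _ 0])
  have bound: "en_degree Q - int i \<le> int (\<Sum>i=1..s. t i)" if Q0: "Q \<in> en_basis i" for Q i
  proof (cases "i = 0")
    case True
    then show ?thesis using Q0 by (simp add: en_basis_def en_degree_def sum_nonneg)
  next
    case False
    then obtain S b where Q: "Q = (S, b)" "S \<subseteq> N" "card S = Suc i" "b < i"
      using Q0 by (auto simp: en_basis_def)
    have "sum t S \<le> sum t N" using Q by (intro sum_mono2) auto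
    then have "int (sum t S) \<le> int (sum t N)" by (simp only: of_nat_le_iff)
    moreover have "en_degree Q = int (sum t S) + int b + 1" using Q by (auto simp: en_degree_def)
    ultimately show ?thesis using Q(4) by linarith
  qed
  show ?thesis
  proof (cases "s \<ge> 2")
    case True
    have "(N, s - 2) \<in> en_basis (s - 1)" using True by (auto simp: en_basis_def)
    moreover have "en_degree (N, s - 2) - int (s - 1) = int (\<Sum>i=1..s. t i)"
      using True by (simp add: en_degree_def of_nat_diff)
    ultimately have "int (\<Sum>i=1..s. t i) \<in> D" unfolding D by (metis (mono_tags, lifting) mem_Collect_eq)
    then have "Max D = int (\<Sum>i=1..s. t i)"
      using bound by (intro Max_eqI fin) (auto simp: D)
    then show ?thesis using True by (simp add: regularity_def D_def)
  next
    case False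
    then have "s = 1" using assms by simp
    \<comment> \<open>A single column has no 2-minors, so the resolution consists of step 0
      alone.\<close>
    then have "d = 0" if d: "d \<in> D" for d
    proof -
      obtain i Q where iQ: "d = en_degree Q - int i" "Q \<in> en_basis i" using d by (auto simp: D)
      then have "i = 0" using basis_empty [of i] \<open>s = 1\<close> by (cases "i = 0") auto
      then show ?thesis using iQ by (simp add: en_basis_def en_degree_def)
    qed
    then have "D = {0}" using zero by auto
    then show ?thesis using False by (simp add: regularity_def D_def)
  qed
qed

end

theorem corollary1p3:
  fixes s :: nat and t :: "nat \<Rightarrow> nat"
  assumes "s \<ge> 1"
    and "\<And>i. i \<in> {1..s} \<Longrightarrow> t i \<ge> 1"
  shows "regularity (edges (odd_cycles_graph s t))
           (toric_ideal (odd_cycles_graph s t) :: (vertex set, 'k::field) mpoly set)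
         = (if s \<ge> 2 then int (\<Sum>i=1..s. t i) else 0)"
proof -
  interpret odd_cycles s t
    using assms(2) by unfold_locales
  show ?thesis
    using assms(1) by (rule regularity_eq)
qed

end
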